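(* Let $\Phi:\mathcal H\to\mathbb R\cup\{+\infty\}$ be convex, lower semicontinuous, with nonempty effective domain and bounded from below; let $u_0\in D(\Phi)$, $f\in L^2_\alpha(0,T;\mathcal H)$, and let $u$ be the energy solution of $D_c^\alpha u+\partial\Phi(u)\ni f$ on $(0,T]$, $u(0)=u_0$. Let $\mathcal P$ be a partition of $[0,T]$ with maximal step size $\tau$, let $\mathbf U$ be the discrete solution on $\mathcal P$ starting from $U_0\in D(\Phi)$, with interpolants $\widehat U_{\mathcal P},\overline U_{\mathcal P}$. Assume that there are $\beta\in(0,1]$ and $C_\beta>0$ ($C_\beta$ depending on the problem data but not on $\mathcal P$) such that $$\Phi(w_2)-\Phi(w_1)-\langle\xi_1,w_2-w_1\rangle\le C_\beta\|w_2-w_1\|^{1+\beta}\qquad\forall w_1,w_2\in\widehat U_{\mathcal P}([0,T]),\ \xi_1\in\partial\Phi(w_1).$$ If there is $q>1/\alpha$ for which $f\in W^{\alpha(\beta+1)/2,q}(0,T;\mathcal H)$, then the error $E=\big(\sup_{t\in[0,T]}\{E_{\mathcal H}^2(t)+E_\sigma^2(t)\}\big)^{1/2}$, where $E_{\mathcal H}(t)=\|u(t)-\widehat U_{\mathcal P}(t)\|$ and $$E_\sigma(t)=\Big(\frac2{\Gamma(\alpha)}\int_0^t(t-s)^{\alpha-1}\big[\sigma(u(s);\widehat U_{\mathcal P}(s))+\sigma(\overline U_{\mathcal P}(s);u(s))\big]ds\Big)^{1/2},$$ satisfies $$E\le\|u_0-U_0\|+C\tau^{\alpha(\beta+1)/2}\Big[\Big(\|f\|^2_{L^2_\alpha(0,T;\mathcal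 H)}+\Phi(U_0)-\Phi_{\inf}\Big)^{(\beta+1)/4}+|f|_{W^{\alpha(\beta+1)/2,q}(0,T;\mathcal H)}\Big],$$ where the constant $C$ depends on $\alpha,\beta,q,T$, and the problem data (including $C_\beta$), but not on $\mathcal P$.
   Context: Setting: $T\in(0,\infty)$, $\alpha\in(0,1)$, $\mathcal H$ is a separable real Hilbert space. $D(\Phi)=\{w\in\mathcal H:\Phi(w)<+\infty\}$, $\Phi_{\inf}=\inf_{\mathcal H}\Phi$, $\partial\Phi(w)=\{\xi:\langle\xi,v-w\rangle\le\Phi(v)-\Phi(w)\ \forall v\in\mathcal H\}$, $D(\partial\Phi)=\{w:\partial\Phi(w)\ne\emptyset\}$. Coercivity modulus: for $w_1\in D(\partial\Phi)$ and $w_2\in D(\Phi)$, $\sigma(w_1;w_2)=\Phi(w_2)-\Phi(w_1)-\sup_{\xi\in\partial\Phi(w_1)}\langle\xi,w_2-w_1\rangle\ge0$. $\|w\|_{L^p_\alpha(0,T;\mathcal H)}=\sup_{t\in[0,T]}\big(\int_0^t(t-s)^{\alpha-1}\|w(s)\|^p\,ds\big)^{1/p}$, and $L^p_\alpha(0,T;\mathcal H)$ is the space of (strongly measurable) functions for which this is finite. $W^{s,q}(0,T;\mathcal H)$, $s\in(0,1)$, is the usual fractional Sobolev (Sobolev--Slobodeckij) Bochner space with seminorm $|\cdot|_{W^{s,q}(0,T;\mathcal H)}$. Generalized Caputo derivative: for $w\in L^1_{loc}([0,T);\mathcal H)$ with initial value $w_0$, $D_c^\alpha w$ is the distributional derivative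 on $(-\infty,T)$ of the function equal to $\frac1{\Gamma(1-\alpha)}\int_0^t(t-s)^{-\alpha}(w(s)-w_0)\,ds$ for $t\ge0$ and $0$ for $t<0$; if $\lim_{t\downarrow0}\frac1t\int_0^t\|w(s)-w(0)\|ds=0$ for some $w(0)\in\mathcal H$, then $w_0=w(0)$. Energy solution: $u\in L^2(0,T;\mathcal H)$ with $\lim_{t\downarrow0}\frac1t\int_0^t\|u(s)-u_0\|^2ds=0$, $D_c^\alpha u\in L^2(0,T;\mathcal H)$, and $\int_0^T[\langle D_c^\alpha u,u-w\rangle+\Phi(u)-\Phi(w)]dt\le\int_0^T\langle f,u-w\rangle dt$ for all $w\in L^2(0,T;\mathcal H)$ (trivially satisfied when $\int_0^T\Phi(w)dt=+\infty$). Under the stated assumptions it exists, is unique, and $f(t)-D_c^\alpha u(t)\in\partial\Phi(u(t))$ for a.e. $t$. Discretization: $\mathcal P=\{0=t_0<t_1<\dots<t_N=T\}$, $\tau_n=t_n-t_{n-1}$, $\tau=\max_n\tau_n$; for $t\in(t_{n-1},t_n]$ put $n(t)=n$. $\mathbf K_{\mathcal P}\in\mathbb R^{N\times N}$ is the (invertible) lower triangular matrix with $\mathbf K_{\mathcal P,ni}=\frac1{\Gamma(\alpha+1)}\big((t_n-t_{i-1})^\alpha-(t_n-t_i)^\alpha\big)$ for $1\le i\le n\le N$ and $0$ for $i>n$. The discrete Caputo derivative of $(W_0,\dots,W_N)$ is $(D^\alpha_{\mathcal P}\mathbf W)_n=\sum_{i=1}^n\mathbf K^{-1}_{\mathcal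 P,ni}(W_i-W_0)$, where $\mathbf K^{-1}_{\mathcal P,ni}$ are the entries of $\mathbf K_{\mathcal P}^{-1}$. With $F_n=\frac1{\tau_n}\int_{t_{n-1}}^{t_n}f(t)\,dt$, the discrete solution $\mathbf U=(U_n)_{n=0}^N$ starting from $U_0$ is defined recursively (and uniquely) by $F_n-(D^\alpha_{\mathcal P}\mathbf U)_n\in\partial\Phi(U_n)$, $n=1,\dots,N$. Interpolants: $\overline U_{\mathcal P}(t)=U_{n(t)}$ and $\widehat U_{\mathcal P}(t)=U_0+\frac1{\Gamma(\alpha)}\int_0^t(t-s)^{\alpha-1}(D^\alpha_{\mathcal P}\mathbf U)_{n(s)}\,ds$. *)

theory Defs
  imports "HOL-Analysis.Analysis"
begin

section \<open>Convex functionals with values in \<open>(-\<infinity>, \<infinity>]\<close>\<close>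

text \<open>
  A separable real Hilbert space is a type of sort
  \<open>{real_inner, banach, second_countable_topology}\<close>. In a separable space strong measurability
  is measurability with respect to the Borel sigma-algebra. All measurability and integration
  below is with respect to the (complete) Lebesgue measure.
\<close>

definition eff_dom :: "('h \<Rightarrow> ereal) \<Rightarrow> 'h set" where
  "eff_dom \<Phi> = {w. \<Phi> w < \<infinity>}"

definition convex_ereal :: "('h::real_vector \<Rightarrow> ereal) \<Rightarrow> bool" where
  "convex_ereal \<Phi> \<longleftrightarrow> (\<forall>v w. \<forall>r\<in>{0..1}.
     \<Phi> ((1 - r) *\<^sub>R v + r *\<^sub>R w) \<le> ereal (1 - r) * \<Phi> v + ereal r * \<Phi> w)"

definition lower_semicont :: "('h::topological_space \<Rightarrow> ereal) \<Rightarrow> bool" where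
  "lower_semicont \<Phi> \<longleftrightarrow> (\<forall>w. \<Phi> w \<le> Liminf (at w) \<Phi>)"

definition subdiff :: "('h::real_inner \<Rightarrow> ereal) \<Rightarrow> 'h \<Rightarrow> 'h set" where
  "subdiff \<Phi> w = {\<xi>. \<forall>v. ereal (\<xi> \<bullet> (v - w)) \<le> \<Phi> v - \<Phi> w}"

text \<open>
  The coercivity modulus is only meaningful, and is then a nonnegative real number, if
  \<open>subdiff \<Phi> w1 \<noteq> {}\<close> and \<open>w2 \<in> eff_dom \<Phi>\<close>.
\<close>

definition coercivity_modulus :: "('h::real_inner \<Rightarrow> ereal) \<Rightarrow> 'h \<Rightarrow> 'h \<Rightarrow> ereal" where
  "coercivity_modulus \<Phi> w1 w2 =
     \<Phi> w2 - \<Phi> w1 - (SUP \<xi>\<in>subdiff \<Phi> w1. ereal (\<xi> \<bullet> (w2 - w1)))"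

definition energy_inf :: "('h \<Rightarrow> ereal) \<Rightarrow> ereal" where
  "energy_inf \<Phi> = (INF w. \<Phi> w)"


section \<open>Function spaces on \<open>(0, T)\<close>\<close>

definition ennreal_powr :: "ennreal \<Rightarrow> real \<Rightarrow> ennreal" where
  "ennreal_powr x r = (if x = \<infinity> then \<infinity> else ennreal (enn2real x powr r))"

definition Lp_space :: "real \<Rightarrow> real \<Rightarrow> (real \<Rightarrow> 'h::{banach, second_countable_topology}) set" where
  "Lp_space p T = {w. w \<in> borel_measurable (lebesgue_on {0..T}) \<and>
     (\<integral>\<^sup>+ t\<in>{0..T}. ennreal (norm (w t) powr p) \<partial>lebesgue) < \<infinity>}"

definition Lp_alpha_norm ::
    "real \<Rightarrow> real \<Rightarrow> real \<Rightarrow> (real \<Rightarrow> 'h::{banach, second_countable_topology}) \<Rightarrow> ennreal" where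
  "Lp_alpha_norm \<alpha> p T w = (SUP t\<in>{0..T}. ennreal_powr
     (\<integral>\<^sup>+ s\<in>{0..t}. ennreal ((t - s) powr (\<alpha> - 1) * norm (w s) powr p) \<partial>lebesgue) (1 / p))"

definition Lp_alpha_space ::
    "real \<Rightarrow> real \<Rightarrow> real \<Rightarrow> (real \<Rightarrow> 'h::{banach, second_countable_topology}) set" where
  "Lp_alpha_space \<alpha> p T =
     {w. w \<in> borel_measurable (lebesgue_on {0..T}) \<and> Lp_alpha_norm \<alpha> p T w < \<infinity>}"

text \<open>The Sobolev-Slobodeckij (Gagliardo) seminorm and space, for \<open>0 < s < 1\<close> and
  \<open>1 \<le> q < \<infinity>\<close>. On the diagonal the integrand is \<open>0 / 0 = 0\<close>.\<close>

definition slobodeckij_seminorm ::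
    "real \<Rightarrow> real \<Rightarrow> real \<Rightarrow> (real \<Rightarrow> 'h::{banach, second_countable_topology}) \<Rightarrow> ennreal" where
  "slobodeckij_seminorm s q T w = ennreal_powr
     (\<integral>\<^sup>+ x\<in>{0..T}. (\<integral>\<^sup>+ y\<in>{0..T}.
        ennreal (norm (w x - w y) powr q / \<bar>x - y\<bar> powr (1 + s * q)) \<partial>lebesgue) \<partial>lebesgue) (1 / q)"

definition Wsq_space ::
    "real \<Rightarrow> real \<Rightarrow> real \<Rightarrow> (real \<Rightarrow> 'h::{banach, second_countable_topology}) set" where
  "Wsq_space s q T = {w \<in> Lp_space q T. slobodeckij_seminorm s q T w < \<infinity>}"


section \<open>The generalized Caputo derivative and energy solutions\<close>

text \<open>Smooth real functions with compact support in \<open>(-\<infinity>, T)\<close>.\<close>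

definition test_fun :: "real \<Rightarrow> (real \<Rightarrow> real) \<Rightarrow> bool" where
  "test_fun T \<phi> \<longleftrightarrow> (\<forall>k x. ((deriv ^^ k) \<phi>) differentiable (at x)) \<and>
     (\<exists>a b. b < T \<and> (\<forall>x. x \<notin> {a..b} \<longrightarrow> \<phi> x = 0))"

definition caputo_primitive ::
    "real \<Rightarrow> (real \<Rightarrow> 'h::{banach, second_countable_topology}) \<Rightarrow> 'h \<Rightarrow> real \<Rightarrow> 'h" where
  "caputo_primitive \<alpha> w w0 t = (if t < 0 then 0 else
     (1 / Gamma (1 - \<alpha>)) *\<^sub>R (LINT s:{0..t}|lebesgue. (t - s) powr (- \<alpha>) *\<^sub>R (w s - w0)))"

text \<open>
  The generalized Caputo derivative of \<open>w\<close> with initial value \<open>w0\<close> is the locally integrable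
  function \<open>h\<close> on \<open>[0, T)\<close>: extended by 0 to negative times, \<open>h\<close> is the
  distributional derivative of \<open>caputo_primitive \<alpha> w w0\<close> on \<open>(-\<infinity>, T)\<close>.
\<close>

definition has_caputo_derivative ::
    "real \<Rightarrow> real \<Rightarrow> (real \<Rightarrow> 'h::{banach, second_countable_topology}) \<Rightarrow> 'h \<Rightarrow> (real \<Rightarrow> 'h) \<Rightarrow> bool"
  where
  "has_caputo_derivative \<alpha> T w w0 h \<longleftrightarrow>
     (\<forall>b\<in>{0<..<T}. set_integrable lebesgue {0..b} w \<and> set_integrable lebesgue {0..b} h) \<and>
     (\<forall>\<phi>. test_fun T \<phi> \<longrightarrow>
        (LINT t:{..<T}|lebesgue. deriv \<phi> t *\<^sub>R caputo_primitive \<alpha> w w0 t) =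
        - (LINT t:{0..<T}|lebesgue. \<phi> t *\<^sub>R h t))"

text \<open>For \<open>\<Phi>\<close> bounded below and \<open>\<Phi> \<circ> w\<close> measurable, this says that the integral of
  \<open>\<Phi> \<circ> w\<close> over \<open>(0, T)\<close>, which is a well-defined element of \<open>(-\<infinity>, \<infinity>]\<close>, is finite.\<close>

definition finite_energy :: "('h \<Rightarrow> ereal) \<Rightarrow> real \<Rightarrow> (real \<Rightarrow> 'h) \<Rightarrow> bool" where
  "finite_energy \<Phi> T w \<longleftrightarrow> (AE t in lebesgue_on {0..T}. \<Phi> (w t) < \<infinity>) \<and>
     integrable (lebesgue_on {0..T}) (\<lambda>t. real_of_ereal (\<Phi> (w t)))"

text \<open>
  The energy inequality is only demanded for test functions of finite energy, since it is void
  for the others. Testing with a constant in the effective domain shows that the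
  inequality, read in the extended reals, forces \<open>finite_energy \<Phi> T u\<close>; this is made explicit
  so that all integrals are ordinary real integrals.
  The initial value used in the Caputo derivative is \<open>u0\<close>, in accordance with the limit condition.
\<close>

definition energy_solution ::
    "real \<Rightarrow> real \<Rightarrow> ('h::{real_inner, banach, second_countable_topology} \<Rightarrow> ereal) \<Rightarrow>
     (real \<Rightarrow> 'h) \<Rightarrow> 'h \<Rightarrow> (real \<Rightarrow> 'h) \<Rightarrow> bool" where
  "energy_solution \<alpha> T \<Phi> f u0 u \<longleftrightarrow>
     u \<in> Lp_space 2 T \<and>
     ((\<lambda>t. (1 / t) * (LINT s:{0..t}|lebesgue. (norm (u s - u0))\<^sup>2)) \<longlongrightarrow> 0) (at_right 0) \<and>
     finite_energy \<Phi> T u \<and>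
     (\<exists>Du\<in>Lp_space 2 T. has_caputo_derivative \<alpha> T u u0 Du \<and>
        (\<forall>w\<in>Lp_space 2 T. finite_energy \<Phi> T w \<longrightarrow>
           (LINT t:{0..T}|lebesgue. Du t \<bullet> (u t - w t)
               + real_of_ereal (\<Phi> (u t)) - real_of_ereal (\<Phi> (w t)))
           \<le> (LINT t:{0..T}|lebesgue. f t \<bullet> (u t - w t))))"


section \<open>Discretization\<close>

text \<open>A partition is given by its nodes \<open>tt 0, ..., tt N\<close>.\<close>

definition is_partition :: "real \<Rightarrow> nat \<Rightarrow> (nat \<Rightarrow> real) \<Rightarrow> bool" where
  "is_partition T N tt \<longleftrightarrow> tt 0 = 0 \<and> tt N = T \<and> (\<forall>n<N. tt n < tt (Suc n))"

definition step_size :: "(nat \<Rightarrow> real) \<Rightarrow> nat \<Rightarrow> real" where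
  "step_size tt n = tt n - tt (n - 1)"

definition max_step :: "nat \<Rightarrow> (nat \<Rightarrow> real) \<Rightarrow> real" where
  "max_step N tt = Max (step_size tt ` {1..N})"

definition interval_index :: "nat \<Rightarrow> (nat \<Rightarrow> real) \<Rightarrow> real \<Rightarrow> nat" where
  "interval_index N tt s = (THE n. n \<in> {1..N} \<and> tt (n - 1) < s \<and> s \<le> tt n)"

text \<open>Real \<open>N \<times> N\<close> matrices are functions \<open>nat \<Rightarrow> nat \<Rightarrow> real\<close> with both indices in \<open>{1..N}\<close>;
  the inverse is normalised to vanish outside this range, which makes it unique.\<close>

definition inverse_matrix :: "nat \<Rightarrow> (nat \<Rightarrow> nat \<Rightarrow> real) \<Rightarrow> nat \<Rightarrow> nat \<Rightarrow> real" where
  "inverse_matrix N A = (THE B.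
     (\<forall>n i. n \<notin> {1..N} \<or> i \<notin> {1..N} \<longrightarrow> B n i = 0) \<and>
     (\<forall>n\<in>{1..N}. \<forall>i\<in>{1..N}. (\<Sum>j=1..N. A n j * B j i) = (if n = i then 1 else 0) \<and>
                           (\<Sum>j=1..N. B n j * A j i) = (if n = i then 1 else 0)))"

definition K_matrix :: "real \<Rightarrow> (nat \<Rightarrow> real) \<Rightarrow> nat \<Rightarrow> nat \<Rightarrow> real" where
  "K_matrix \<alpha> tt n i = (if i \<le> n
     then ((tt n - tt (i - 1)) powr \<alpha> - (tt n - tt i) powr \<alpha>) / Gamma (\<alpha> + 1) else 0)"

definition discrete_caputo ::
    "real \<Rightarrow> nat \<Rightarrow> (nat \<Rightarrow> real) \<Rightarrow> (nat \<Rightarrow> 'h::real_vector) \<Rightarrow> nat \<Rightarrow> 'h" where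
  "discrete_caputo \<alpha> N tt W n =
     (\<Sum>i=1..n. inverse_matrix N (K_matrix \<alpha> tt) n i *\<^sub>R (W i - W 0))"

definition cell_average ::
    "(nat \<Rightarrow> real) \<Rightarrow> (real \<Rightarrow> 'h::{banach, second_countable_topology}) \<Rightarrow> nat \<Rightarrow> 'h" where
  "cell_average tt f n = (1 / step_size tt n) *\<^sub>R (LINT t:{tt (n - 1)..tt n}|lebesgue. f t)"

text \<open>The starting value of the discrete solution \<open>U\<close> is \<open>U 0\<close>.\<close>

definition discrete_solution ::
    "real \<Rightarrow> ('h::{real_inner, banach, second_countable_topology} \<Rightarrow> ereal) \<Rightarrow> (real \<Rightarrow> 'h) \<Rightarrow>
     nat \<Rightarrow> (nat \<Rightarrow> real) \<Rightarrow> (nat \<Rightarrow> 'h) \<Rightarrow> bool" where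
  "discrete_solution \<alpha> \<Phi> f N tt U \<longleftrightarrow>
     (\<forall>n\<in>{1..N}. cell_average tt f n - discrete_caputo \<alpha> N tt U n \<in> subdiff \<Phi> (U n))"

definition interp_const :: "nat \<Rightarrow> (nat \<Rightarrow> real) \<Rightarrow> (nat \<Rightarrow> 'h) \<Rightarrow> real \<Rightarrow> 'h" where
  "interp_const N tt U t = U (interval_index N tt t)"

definition interp_frac ::
    "real \<Rightarrow> nat \<Rightarrow> (nat \<Rightarrow> real) \<Rightarrow> (nat \<Rightarrow> 'h::{banach, second_countable_topology}) \<Rightarrow> real \<Rightarrow> 'h"
  where
  "interp_frac \<alpha> N tt U t = U 0 + (1 / Gamma \<alpha>) *\<^sub>R
     (LINT s:{0..t}|lebesgue.
        (t - s) powr (\<alpha> - 1) *\<^sub>R discrete_caputo \<alpha> N tt U (interval_index N tt s))"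


section \<open>The error\<close>

text \<open>
  The error is an element of \<open>[0, \<infinity>]\<close>, so that bounding it by a real number includes its
  finiteness. For almost every \<open>s\<close> both moduli in \<open>err_sigma\<close> have admissible arguments.
  An energy solution is determined only up to null sets, whereas \<open>err_H\<close> uses pointwise values:
  \<open>u\<close> has to be the representative that is continuous on \<open>[0, T]\<close>.
\<close>

definition err_H ::
    "real \<Rightarrow> nat \<Rightarrow> (nat \<Rightarrow> real) \<Rightarrow> (nat \<Rightarrow> 'h::{banach, second_countable_topology}) \<Rightarrow>
     (real \<Rightarrow> 'h) \<Rightarrow> real \<Rightarrow> real" where
  "err_H \<alpha> N tt U u t = norm (u t - interp_frac \<alpha> N tt U t)"

definition err_sigma ::
    "real \<Rightarrow> ('h::{real_inner, banach, second_countable_topology} \<Rightarrow> ereal) \<Rightarrow>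
     nat \<Rightarrow> (nat \<Rightarrow> real) \<Rightarrow> (nat \<Rightarrow> 'h) \<Rightarrow> (real \<Rightarrow> 'h) \<Rightarrow> real \<Rightarrow> ennreal" where
  "err_sigma \<alpha> \<Phi> N tt U u t = ennreal_powr (ennreal (2 / Gamma \<alpha>) *
     (\<integral>\<^sup>+ s\<in>{0..t}. ennreal ((t - s) powr (\<alpha> - 1)) *
        e2ennreal (coercivity_modulus \<Phi> (u s) (interp_frac \<alpha> N tt U s)
                 + coercivity_modulus \<Phi> (interp_const N tt U s) (u s)) \<partial>lebesgue)) (1 / 2)"

definition err_total ::
    "real \<Rightarrow> real \<Rightarrow> ('h::{real_inner, banach, second_countable_topology} \<Rightarrow> ereal) \<Rightarrow>
     nat \<Rightarrow> (nat \<Rightarrow> real) \<Rightarrow> (nat \<Rightarrow> 'h) \<Rightarrow> (real \<Rightarrow> 'h) \<Rightarrow> ennreal" where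
  "err_total \<alpha> T \<Phi> N tt U u = ennreal_powr
     (SUP t\<in>{0..T}. ennreal ((err_H \<alpha> N tt U u t)\<^sup>2) + (err_sigma \<alpha> \<Phi> N tt U u t)\<^sup>2) (1 / 2)"

end

theory Submission
  imports Defs
begin

text \<open>
  Write \<open>I\<^sup>a\<close> for the Riemann-Liouville integral. The energy solution satisfies \<open>u = u0 + I\<^sup>a Du\<close> with
  \<open>f - Du \<in> \<partial>\<Phi>(u)\<close> almost everywhere, and the fractional interpolant satisfies \<open>Uh = U 0 + I\<^sup>a V\<close> with
  \<open>F - V \<in> \<partial>\<Phi>(Ub)\<close>, where \<open>V\<close>, \<open>F\<close>, \<open>Ub\<close> are piecewise constant. Adding the two subgradient inequalities and the
  assumed upper bound for \<open>\<Phi>(Uh) - \<Phi>(Ub)\<close> bounds the sum of the coercivity moduli by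
  \<open>C \<parallel>Uh - Ub\<parallel>\<^bsup>1 + \<beta>\<^esup> + (f - F) \<bullet> e - (Du - V) \<bullet> e\<close>, where \<open>e = u - Uh\<close>. Apply \<open>I\<^sup>a\<close>: by the chain inequality
  \<open>\<parallel>e\<parallel>\<^sup>2 \<le> \<parallel>e 0\<parallel>\<^sup>2 + 2 I\<^sup>a((Du - V) \<bullet> e)\<close> the last term controls the error, first for almost every
  time and then, by lower semicontinuity, for all times.

  The chain inequality amounts to positivity of the kernel \<open>(1 - x)\<^bsup>a - 1\<^esup> - 1\<close> with
  \<open>x = (t - s) / (t - s')\<close>, which is a binomial series with positive coefficients in the positive definite
  kernels \<open>x\<^sup>k\<close>. Its discrete counterpart, valid for every convex \<open>\<Phi>\<close>, holds because the discrete solution operator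
  produces convex combinations of earlier values; it yields \<open>I\<^sup>a(\<parallel>V\<parallel>\<^sup>2) \<le> C (\<parallel>f\<parallel>\<^sup>2 + \<Phi>(U 0) - inf \<Phi>)\<close>.
  The two residuals are then of the right order: \<open>Uh - Ub\<close> is \<open>O(\<tau>\<^sup>a)\<close> times the norm of \<open>V\<close>, and
  \<open>f - F\<close> is \<open>O(\<tau>\<^sup>s)\<close> in \<open>L\<^sup>q\<close> by Jensen's inequality, where \<open>q > 1 / a\<close> makes the
  singular kernel integrable to the dual power.
\<close>

section \<open>Riemann-Liouville kernels\<close>

text \<open>\<open>Du\<close> is merely square integrable, so the fractional integral of its norm,
  and the double integral behind the chain inequality, need not be finite at every time; this is why
  the energy estimate is first made at almost every time. The residual \<open>f - F\<close> is
  paired with the unknown error \<open>e\<close>. It is estimated against the maximum m of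
  \<open>norm e\<close>, which gives m^2 <= a^2 + A + 2 B m; solving this keeps the coefficient 1 in
  front of \<open>norm (u0 - U 0)\<close>. The rates of the two residuals agree: the square of the
  gap \<open>Uh - Ub\<close> is of order \<tau>^(2 \<alpha>), so concavity with exponent (1 +
  \<beta>)/2 and one square root give \<tau>^(\<alpha> (\<beta> + 1)/2) and the power (\<beta> +
  1)/4 of the data, while \<open>f - F\<close> enters linearly with the smoothness exponent of
  \<open>f\<close>. The representation of \<open>u\<close> has to be extracted from a distributional
  definition: smooth cutoffs turn it into I^(1 - \<alpha>) (u - u0) = I^1 Du; applying I^\<alpha>
  and comparing primitives gives it almost everywhere.\<close>

definition pker :: "real \<Rightarrow> real \<Rightarrow> real" where
  "pker a r = (if 0 < r then r powr (a - 1) else 0)"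

text \<open>Here \<open>fint\<close> and \<open>rl\<close> are fractional integrals without the factor \<open>1 / Gamma a\<close>.\<close>

definition fint :: "real \<Rightarrow> (real \<Rightarrow> ennreal) \<Rightarrow> real \<Rightarrow> ennreal" where
  "fint a g t = (\<integral>\<^sup>+s. ennreal (pker a (t - s)) * g s \<partial>lborel)"

definition rl :: "real \<Rightarrow> (real \<Rightarrow> 'h::{banach, second_countable_topology}) \<Rightarrow> real \<Rightarrow> 'h" where
  "rl a g t = (LINT s|lborel. pker a (t - s) *\<^sub>R g s)"

lemma pker_nonneg [simp]: "0 \<le> pker a r"
  by (simp add: pker_def)

text \<open>The zero extension turns every integral over the times before t into a convolution over
  the whole line. The value 0 at r = 0 breaks monotonicity there, so s = t recurs below as an
  exceptional null set.\<close>

lemma pker_nonpos [simp]: "r \<le> 0 \<Longrightarrow> pker a r = 0"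
  by (simp add: pker_def)

lemma pker_measurable [measurable]: "pker a \<in> borel_measurable borel"
  unfolding pker_def by measurable

lemma fint_measurable [measurable]:
  assumes [measurable]: "g \<in> borel_measurable borel"
  shows "fint a g \<in> borel_measurable borel"
  unfolding fint_def by measurable

lemma rl_measurable [measurable]:
  assumes [measurable]: "g \<in> borel_measurable borel"
  shows "rl a g \<in> borel_measurable borel"
  unfolding rl_def by measurable

lemma pker_antimono:
  assumes "a \<le> 1" "0 < r" "r \<le> r'"
  shows "pker a r' \<le> pker a r"
  using assms by (auto simp: pker_def intro: powr_mono2')

lemma nn_integral_has_integral_indicator:
  fixes f :: "real \<Rightarrow> real"
  assumes [measurable]: "f \<in> borel_measurable borel" "S \<in> sets borel"
    and nn: "\<And>x. x \<in> S \<Longrightarrow> 0 \<le> f x" and int: "(f has_integral r) S"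
  shows "(\<integral>\<^sup>+x\<in>S. ennreal (f x) \<partial>lborel) = ennreal r"
proof -
  have "((\<lambda>x. if x \<in> S then f x else 0) has_integral r) UNIV"
    using int by (simp add: has_integral_restrict_UNIV)
  then have "(\<integral>\<^sup>+x. ennreal (if x \<in> S then f x else 0) \<partial>lborel) = ennreal r"
    by (intro nn_integral_has_integral_lborel) (auto simp: nn)
  also have "(\<integral>\<^sup>+x. ennreal (if x \<in> S then f x else 0) \<partial>lborel) = (\<integral>\<^sup>+x\<in>S. ennreal (f x) \<partial>lborel)"
    by (intro nn_integral_cong) (auto simp: indicator_def)
  finally show ?thesis .
qed

text \<open>The antiderivative -(t - s)^a / a is continuous up to s = t, so the singularity at that
  endpoint is harmless. The \<open>max 0\<close> covers t before, inside and after the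
  interval.\<close>

lemma nn_integral_pker:
  assumes "0 < a" "c \<le> d" 
  shows "(\<integral>\<^sup>+s\<in>{c..d}. ennreal (pker a (t - s)) \<partial>lborel)
    = ennreal ((max 0 (t - c) powr a - max 0 (t - d) powr a) / a)"
proof (cases "c < t")
  case False
  have "(\<integral>\<^sup>+s\<in>{c..d}. ennreal (pker a (t - s)) \<partial>lborel) = (\<integral>\<^sup>+s. 0 \<partial>(lborel :: real measure))"
    by (intro nn_integral_cong) (use False in \<open>auto simp: indicator_def\<close>)
  then show ?thesis using False assms by (simp add: max_def)
next
  case True
  define d' where "d' = min d t"
  have d': "c \<le> d'" "d' \<le> t" using True assms by (auto simp: d'_def)
  have "((\<lambda>s. pker a (t - s)) has_integral (- ((t - d') powr a / a) - (- ((t - c) powr a / a)))) {c..d'}"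
  proof (rule fundamental_theorem_of_calculus_interior)
    show "continuous_on {c..d'} (\<lambda>s. - ((t - s) powr a / a))"
      using assms d' by (intro continuous_intros continuous_on_powr') auto
    show "((\<lambda>s. - ((t - s) powr a / a)) has_vector_derivative pker a (t - x)) (at x)" if "x \<in> {c<..<d'}" for x
    proof -
      have "t - x > 0" using that d' by auto
      then show ?thesis
        unfolding has_real_derivative_iff_has_vector_derivative[symmetric]
        using assms by (auto intro!: derivative_eq_intros simp: pker_def)
    qed
  qed (use d' in auto)
  then have "(\<integral>\<^sup>+s\<in>{c..d'}. ennreal (pker a (t - s)) \<partial>lborel) = ennreal ((t - c) powr a / a - (t - d') powr a / a)"
    by (intro nn_integral_has_integral_indicator) auto
  also have "(\<integral>\<^sup>+s\<in>{c..d'}. ennreal (pker a (t - s)) \<partial>lborel) = (\<integral>\<^sup>+s\<in>{c..d}. ennreal (pker a (t - s)) \<partial>lborel)"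
    by (intro nn_integral_cong) (auto simp: indicator_def d'_def)
  finally show ?thesis
    using True assms by (auto simp: d'_def max_def min_def diff_divide_distrib)
qed

lemma nn_integral_pker_line:
  assumes "0 < a" 
  shows "(\<integral>\<^sup>+s. ennreal (pker a (t - s)) * indicator {0..} s \<partial>lborel) = ennreal (max 0 t powr a / a)"
proof -
  have "(\<integral>\<^sup>+s. ennreal (pker a (t - s)) * indicator {0..} s \<partial>lborel)
     = (\<integral>\<^sup>+s\<in>{0..max 0 t}. ennreal (pker a (t - s)) \<partial>lborel)"
    by (intro nn_integral_cong) (auto simp: indicator_def)
  then show ?thesis using assms by (simp add: nn_integral_pker max_def)
qed

section \<open>Composition of fractional integrals\<close>

lemma pker_scale: "0 < c \<Longrightarrow> pker a (c * r) = c powr (a - 1) * pker a r"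
  by (auto simp: pker_def powr_mult zero_less_mult_iff)

text \<open>The substitution r = s + (t - s) x maps (s, t) to (0, 1); the powers of t - s collect to
  a + b - 1 and the Beta integral remains.\<close>

lemma nn_integral_pker_pker:
  assumes "0 < a" "0 < b"
  shows "(\<integral>\<^sup>+r. ennreal (pker a (t - r)) * ennreal (pker b (r - s)) \<partial>lborel)
    = ennreal (Beta a b * pker (a + b) (t - s))"
proof (cases "s < t")
  case False
  have "(\<integral>\<^sup>+r. ennreal (pker a (t - r)) * ennreal (pker b (r - s)) \<partial>lborel) = (\<integral>\<^sup>+r. 0 \<partial>(lborel :: real measure))"
    by (intro nn_integral_cong) (use False in \<open>auto simp: pker_def\<close>)
  then show ?thesis using False by simp
next
  case True
  define c where "c = t - s"
  have c: "0 < c" using True by (simp add: c_def)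
  have eq: "(\<integral>\<^sup>+r. ennreal (pker a (t - r)) * ennreal (pker b (r - s)) \<partial>lborel)
     = c * (\<integral>\<^sup>+x. ennreal (pker a (c * (1 - x))) * ennreal (pker b (c * x)) \<partial>lborel)"
    using c by (subst nn_integral_real_affine[where c=c and t=s]) (auto simp: c_def algebra_simps)
  have "(\<integral>\<^sup>+x. ennreal (pker a (c * (1 - x))) * ennreal (pker b (c * x)) \<partial>lborel)
     = (\<integral>\<^sup>+x. ennreal (c powr (a + b - 2)) * (ennreal (x powr (b - 1) * (1 - x) powr (a - 1)) * indicator {0..1} x) \<partial>lborel)"
  proof (intro nn_integral_cong)
    fix x :: real
    have *: "c powr (a - 1) * c powr (b - 1) = c powr (a + b - 2)"
      by (simp add: powr_add[symmetric])
    have "pker a (c * (1 - x)) * pker b (c * x) = (c powr (a - 1) * c powr (b - 1)) * (pker b x * pker a (1 - x))"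
      using c by (simp only: pker_scale mult_ac)
    also have "\<dots> = c powr (a + b - 2) * (x powr (b - 1) * (1 - x) powr (a - 1) * indicator {0..1} x)"
      unfolding * by (auto simp: pker_def indicator_def)
    finally show "ennreal (pker a (c * (1 - x))) * ennreal (pker b (c * x)) =
       ennreal (c powr (a + b - 2)) * (ennreal (x powr (b - 1) * (1 - x) powr (a - 1)) * indicator {0..1} x)"
      by (simp add: ennreal_mult[symmetric] indicator_def)
  qed
  also have "\<dots> = ennreal (c powr (a + b - 2)) * ennreal (Beta b a)"
    using has_integral_Beta_real[OF assms(2,1)]
    by (subst nn_integral_cmult) (auto simp: nn_integral_has_integral_indicator)
  finally have "(\<integral>\<^sup>+x. ennreal (pker a (c * (1 - x))) * ennreal (pker b (c * x)) \<partial>lborel)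
      = ennreal (c powr (a + b - 2)) * ennreal (Beta b a)" .
  moreover have B: "0 \<le> Beta b a" using assms by (simp add: Beta_def less_imp_le)
  ultimately have "(\<integral>\<^sup>+r. ennreal (pker a (t - r)) * ennreal (pker b (r - s)) \<partial>lborel)
      = ennreal (c * (c powr (a + b - 2) * Beta b a))"
    using c B unfolding eq by (simp add: ennreal_mult)
  moreover have "c * c powr (a + b - 2) = c powr (a + b - 1)"
    using c by (simp add: powr_mult_base)
  then have "c * (c powr (a + b - 2) * Beta b a) = Beta a b * pker (a + b) (t - s)"
    using c by (simp add: pker_def c_def[symmetric] Beta_commute[of a b])
  ultimately show ?thesis by simp
qed

lemma fint_fint:
  assumes "0 < a" "0 < b" and [measurable]: "g \<in> borel_measurable borel"
  shows "fint a (fint b g) t = ennreal (Beta a b) * fint (a + b) g t"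
proof -
  have B: "0 \<le> Beta a b" using assms by (simp add: Beta_def less_imp_le)
  have "fint a (fint b g) t = (\<integral>\<^sup>+r. (\<integral>\<^sup>+s. ennreal (pker a (t - r)) * ennreal (pker b (r - s)) * g s \<partial>lborel) \<partial>lborel)"
    unfolding fint_def by (intro nn_integral_cong) (simp add: nn_integral_cmult[symmetric] mult_ac)
  also have "\<dots> = (\<integral>\<^sup>+s. (\<integral>\<^sup>+r. ennreal (pker a (t - r)) * ennreal (pker b (r - s)) * g s \<partial>lborel) \<partial>lborel)"
    by (rule lborel_pair.Fubini') measurable
  also have "\<dots> = (\<integral>\<^sup>+s. ennreal (Beta a b) * (ennreal (pker (a + b) (t - s)) * g s) \<partial>lborel)"
  proof (intro nn_integral_cong)
    fix s
    show "(\<integral>\<^sup>+r. ennreal (pker a (t - r)) * ennreal (pker b (r - s)) * g s \<partial>lborel)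
        = ennreal (Beta a b) * (ennreal (pker (a + b) (t - s)) * g s)"
      by (subst nn_integral_multc) (use B assms(1,2) in \<open>auto simp: nn_integral_pker_pker ennreal_mult mult_ac\<close>)
  qed
  also have "\<dots> = ennreal (Beta a b) * fint (a + b) g t"
    unfolding fint_def by (subst nn_integral_cmult) auto
  finally show ?thesis .
qed

lemma rl_integrable:
  fixes g :: "real \<Rightarrow> 'h::{banach, second_countable_topology}"
  assumes [measurable]: "g \<in> borel_measurable borel" and "fint a (\<lambda>s. ennreal (norm (g s))) t < \<infinity>"
  shows "integrable lborel (\<lambda>s. pker a (t - s) *\<^sub>R g s)"
proof (rule integrableI_bounded)
  show "(\<integral>\<^sup>+s. ennreal (norm (pker a (t - s) *\<^sub>R g s)) \<partial>lborel) < \<infinity>"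
    using assms(2) by (simp add: fint_def ennreal_mult)
qed measurable

lemma norm_rl_le:
  fixes g :: "real \<Rightarrow> 'h::{banach, second_countable_topology}"
  assumes [measurable]: "g \<in> borel_measurable borel"
  shows "ennreal (norm (rl a g t)) \<le> fint a (\<lambda>s. ennreal (norm (g s))) t"
proof -
  have eq: "fint a (\<lambda>s. ennreal (norm (g s))) t = (\<integral>\<^sup>+s. ennreal (norm (pker a (t - s) *\<^sub>R g s)) \<partial>lborel)"
    by (simp add: fint_def ennreal_mult)
  show ?thesis
  proof (cases "integrable lborel (\<lambda>s. pker a (t - s) *\<^sub>R g s)")
    case True
    then show ?thesis unfolding eq rl_def by (rule integral_norm_bound_ennreal)
  \<comment> \<open>A non-integrable integrand has Bochner integral 0.\<close>
  qed (simp add: rl_def not_integrable_integral_eq)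
qed

text \<open>\<open>fint_fint\<close>, applied to the norm, supplies the absolute integrability for
  Fubini's theorem, and it does so at the single time t in question.\<close>

lemma rl_rl:
  fixes g :: "real \<Rightarrow> 'h::{banach, second_countable_topology}"
  assumes "0 < a" "0 < b" and [measurable]: "g \<in> borel_measurable borel"
    and fin: "fint (a + b) (\<lambda>s. ennreal (norm (g s))) t < \<infinity>"
  shows "rl a (rl b g) t = Beta a b *\<^sub>R rl (a + b) g t"
proof -
  have B: "0 \<le> Beta a b" using assms by (simp add: Beta_def less_imp_le)
  let ?F = "\<lambda>r s. (pker a (t - r) * pker b (r - s)) *\<^sub>R g s"
  have int: "integrable (lborel \<Otimes>\<^sub>M lborel) (case_prod ?F)"
  proof (rule integrableI_bounded)
    have "(\<integral>\<^sup>+p. ennreal (norm (case_prod ?F p)) \<partial>(lborel \<Otimes>\<^sub>M lborel))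
      = (\<integral>\<^sup>+r. (\<integral>\<^sup>+s. ennreal (norm (?F r s)) \<partial>lborel) \<partial>lborel)"
      by (subst lborel.nn_integral_fst[symmetric]) auto
    also have "\<dots> = fint a (fint b (\<lambda>s. ennreal (norm (g s)))) t"
      unfolding fint_def by (intro nn_integral_cong) (simp add: nn_integral_cmult[symmetric] mult_ac ennreal_mult)
    also have "\<dots> < \<infinity>" using fin assms by (simp add: fint_fint ennreal_mult_less_top)
    finally show "(\<integral>\<^sup>+p. ennreal (norm (case_prod ?F p)) \<partial>(lborel \<Otimes>\<^sub>M lborel)) < \<infinity>" .
  qed measurable
  have "rl a (rl b g) t = (\<integral>r. (\<integral>s. ?F r s \<partial>lborel) \<partial>lborel)"
    unfolding rl_def by (simp flip: integral_scaleR_right)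
  also have "\<dots> = (\<integral>s. (\<integral>r. ?F r s \<partial>lborel) \<partial>lborel)"
    using lborel_pair.Fubini_integral[OF int] by simp
  also have "\<dots> = (\<integral>s. (Beta a b * pker (a + b) (t - s)) *\<^sub>R g s \<partial>lborel)"
  proof (rule Bochner_Integration.integral_cong[OF refl])
    fix s
    have nn: "(\<integral>\<^sup>+r. ennreal (pker a (t - r) * pker b (r - s)) \<partial>lborel) = ennreal (Beta a b * pker (a + b) (t - s))"
      using nn_integral_pker_pker[OF assms(1,2), of t s] by (simp add: ennreal_mult)
    have "integrable lborel (\<lambda>r. pker a (t - r) * pker b (r - s))"
      by (rule integrableI_nn_integral_finite[OF _ _ nn]) (auto simp: B)
    moreover have "(\<integral>r. pker a (t - r) * pker b (r - s) \<partial>lborel) = Beta a b * pker (a + b) (t - s)"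
      by (rule integral_eq_nn_integral[THEN trans]) (auto simp: nn B)
    ultimately show "(\<integral>r. ?F r s \<partial>lborel) = (Beta a b * pker (a + b) (t - s)) *\<^sub>R g s"
      by simp
  qed
  also have "\<dots> = Beta a b *\<^sub>R rl (a + b) g t"
    unfolding rl_def by (simp flip: integral_scaleR_right scaleR_scaleR)
  finally show ?thesis .
qed


text \<open>The relative drop of the kernel over a shift \<tau> is at most 1 and at most \<tau> / x,
  hence at most (\<tau> / x)^a. The factor \<tau>^a is gained at the price of the singularity 1 / x,
  so the bound is useful only away from 0.\<close>

lemma pker_diff_le:
  assumes "0 < a" "a < 1" "0 < \<tau>" "0 < x"
  shows "pker a x - pker a (x + \<tau>) \<le> \<tau> powr a / x"
proof -
  define z where "z = \<tau> / x"
  have z: "0 < z" using assms by (simp add: z_def)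
  have x1: "x + \<tau> = x * (1 + z)" using assms by (simp add: z_def field_simps)
  have "(1 + z) powr (-1) \<le> (1 + z) powr (a - 1)"
    using assms z by (intro powr_mono) auto
  then have "1 - (1 + z) powr (a - 1) \<le> 1 - 1 / (1 + z)"
    using z by (simp add: powr_minus_divide)
  also have "\<dots> \<le> min 1 z"
    using z by (simp add: field_simps)
  also have "\<dots> \<le> z powr a"
  proof (cases "z \<le> 1")
    case True
    then have "z powr 1 \<le> z powr a" using z assms by (intro powr_mono') auto
    then show ?thesis using z True by simp
  next
    case False
    then have "1 \<le> z powr a" using assms by (intro ge_one_powr_ge_zero) auto
    then show ?thesis using False by simp
  qed
  finally have "1 - (1 + z) powr (a - 1) \<le> z powr a" .
  then have "x powr (a - 1) * (1 - (1 + z) powr (a - 1)) \<le> x powr (a - 1) * z powr a"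
    by (intro mult_left_mono) auto
  also have "x powr (a - 1) * z powr a = \<tau> powr a / x"
    using assms by (simp add: z_def powr_divide powr_diff)
  finally show ?thesis
    using assms z powr_mult[of x "1 + z" "a - 1"] by (simp add: pker_def x1 zero_less_mult_iff right_diff_distrib)
qed

text \<open>The integral is split at h = R / 2. On (0, h] the first kernel is at most
  \<open>pker a h\<close> and the difference has integral at most \<tau>^a / a by telescoping; on
  [h, R] the difference is at most \<tau>^a / h and the first kernel has mass h^a / a. Each half
  contributes \<open>pker a h\<close> times \<tau>^a / a, and \<open>pker a h\<close> is at most
  twice \<open>pker a R\<close>, whence the 4.\<close>

lemma nn_integral_pker_pker_diff_le:
  assumes a: "0 < a" "a < 1" and \<tau>: "0 < \<tau>"
  shows "(\<integral>\<^sup>+x. ennreal (pker a (R - x)) * ennreal (pker a x - pker a (x + \<tau>)) \<partial>lborel)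
    \<le> ennreal (4 / a * \<tau> powr a * pker a R)"
proof (cases "0 < R")
  case False
  have "(\<integral>\<^sup>+x. ennreal (pker a (R - x)) * ennreal (pker a x - pker a (x + \<tau>)) \<partial>lborel) = (\<integral>\<^sup>+x. 0 \<partial>(lborel :: real measure))"
    by (intro nn_integral_cong) (use False in \<open>auto simp: pker_def ennreal_neg\<close>)
  then show ?thesis by simp
next
  case True
  define h where "h = R / 2"
  have h: "0 < h" "R = 2 * h" using True by (auto simp: h_def)
  let ?d = "\<lambda>x. pker a x - pker a (x + \<tau>)"
  have "((\<lambda>x. ?d x) has_integral ((h powr a - (h + \<tau>) powr a) / a - (0 powr a - (0 + \<tau>) powr a) / a)) {0..h}"
  proof (rule fundamental_theorem_of_calculus_interior)
    show "continuous_on {0..h} (\<lambda>x. (x powr a - (x + \<tau>) powr a) / a)"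
      using a h \<tau> by (intro continuous_intros continuous_on_powr') auto
    show "((\<lambda>x. (x powr a - (x + \<tau>) powr a) / a) has_vector_derivative ?d x) (at x)" if "x \<in> {0<..<h}" for x
      unfolding has_real_derivative_iff_has_vector_derivative[symmetric]
      using a \<tau> that by (auto intro!: derivative_eq_intros simp: pker_def field_simps)
  qed (use h in auto)
  moreover have "(h powr a - (h + \<tau>) powr a) / a - (0 powr a - (0 + \<tau>) powr a) / a = (h powr a - (h + \<tau>) powr a + \<tau> powr a) / a"
    using a by (simp add: diff_divide_distrib add_divide_distrib)
  ultimately have "((\<lambda>x. if x \<in> {0..h} then ?d x else 0) has_integral ((h powr a - (h + \<tau>) powr a + \<tau> powr a) / a)) UNIV"
    by (simp only: has_integral_restrict_UNIV)
  \<comment> \<open>The point 0 is removed because the difference is negative there: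
    \<open>pker a 0\<close> is 0.\<close>
  then have *: "((\<lambda>x. indicator {0<..h} x *\<^sub>R ?d x) has_integral ((h powr a - (h + \<tau>) powr a + \<tau> powr a) / a)) UNIV"
    by (rule has_integral_spike[where S="{0}", rotated 2]) (auto simp: indicator_def)
  have "(\<integral>\<^sup>+x. ennreal (indicator {0<..h} x *\<^sub>R ?d x) \<partial>lborel) = ennreal ((h powr a - (h + \<tau>) powr a + \<tau> powr a) / a)"
    using a \<tau> by (intro nn_integral_has_integral_lborel[OF _ _ *]) (auto simp: indicator_def pker_antimono)
  also have "\<dots> \<le> ennreal (\<tau> powr a / a)"
    using a \<tau> h by (intro ennreal_leI divide_right_mono) (auto intro!: powr_mono2)
  finally have fst: "(\<integral>\<^sup>+x. ennreal (indicator {0<..h} x *\<^sub>R ?d x) \<partial>lborel) \<le> ennreal (\<tau> powr a / a)" .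
  have "(\<integral>\<^sup>+x. ennreal (pker a (R - x)) * ennreal (?d x) \<partial>lborel)
    \<le> (\<integral>\<^sup>+x. ennreal (pker a h) * ennreal (indicator {0<..h} x *\<^sub>R ?d x)
       + ennreal (\<tau> powr a / h) * (ennreal (pker a (R - x)) * indicator {h..R} x) \<partial>lborel)"
  proof (intro nn_integral_mono)
    fix x
    consider "x \<le> 0" | "0 < x" "x \<le> h" | "h < x" "x < R" | "R \<le> x" by linarith
    then show "ennreal (pker a (R - x)) * ennreal (?d x) \<le> ennreal (pker a h) * ennreal (indicator {0<..h} x *\<^sub>R ?d x)
       + ennreal (\<tau> powr a / h) * (ennreal (pker a (R - x)) * indicator {h..R} x)"
    proof cases
      case 1
      then show ?thesis by (simp add: ennreal_neg)
    next
      case 2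
      then have "pker a (R - x) \<le> pker a h" using a h by (intro pker_antimono) auto
      then show ?thesis using 2 by (auto intro!: add_increasing2 mult_right_mono ennreal_leI)
    next
      case 3
      then have "?d x \<le> \<tau> powr a / x" using pker_diff_le[OF a \<tau>, of x] h by simp
      also have "\<dots> \<le> \<tau> powr a / h" using 3 h by (intro divide_left_mono) auto
      finally have "ennreal (?d x) * ennreal (pker a (R - x)) \<le> ennreal (\<tau> powr a / h) * ennreal (pker a (R - x))"
        by (intro mult_right_mono ennreal_leI) auto
      then show ?thesis using 3 by (simp add: mult.commute)
    qed simp
  qed
  also have "\<dots> = ennreal (pker a h) * (\<integral>\<^sup>+x. ennreal (indicator {0<..h} x *\<^sub>R ?d x) \<partial>lborel)
      + ennreal (\<tau> powr a / h) * (\<integral>\<^sup>+x\<in>{h..R}. ennreal (pker a (R - x)) \<partial>lborel)"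
    by (subst nn_integral_add) (auto simp: nn_integral_cmult)
  also have "\<dots> \<le> ennreal (pker a h) * ennreal (\<tau> powr a / a) + ennreal (\<tau> powr a / h) * ennreal (h powr a / a)"
    using a h by (intro add_mono mult_left_mono fst) (auto simp: nn_integral_pker)
  also have "\<dots> = ennreal (2 / a * \<tau> powr a * pker a h)"
  proof -
    have "h powr a = h * pker a h" using h by (simp add: pker_def powr_mult_base)
    then have "pker a h * (\<tau> powr a / a) + \<tau> powr a / h * (h powr a / a) = 2 / a * \<tau> powr a * pker a h"
      using h(1) a by (simp add: field_simps)
    then show ?thesis using a h(1) by (simp add: ennreal_mult[symmetric] ennreal_plus[symmetric] del: ennreal_plus)
  qed
  also have "ennreal (2 / a * \<tau> powr a * pker a h) \<le> ennreal (4 / a * \<tau> powr a * pker a R)"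
  proof -
  have "pker a h \<le> 2 * pker a R"
  proof -
    have "(1/2) powr (a - 1) \<le> ((1/2) powr (-1) :: real)" using a by (intro powr_mono') auto
    then have "(1/2) powr (a - 1) \<le> (2 :: real)" by (simp add: powr_minus_divide)
    moreover have "pker a h = (1/2) powr (a - 1) * pker a R"
      unfolding h_def using pker_scale[of "1/2" a R] by simp
    ultimately show ?thesis by (simp add: mult_right_mono)
  qed
  from mult_left_mono[OF this, of "2 / a * \<tau> powr a"] 
  have "ennreal (2 / a * \<tau> powr a * pker a h) \<le> ennreal (4 / a * \<tau> powr a * pker a R)"
    using a by (intro ennreal_leI) auto
  then show ?thesis .
  qed
  finally show ?thesis .
qed

section \<open>The chain inequality for the Caputo derivative\<close>

lemma integrable_prod_mult:
  fixes f g :: "real \<Rightarrow> real"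
  assumes f: "integrable lborel f" and g: "integrable lborel g"
  shows "integrable (lborel \<Otimes>\<^sub>M lborel) (\<lambda>p. f (fst p) * g (snd p))"
proof (rule integrableI_bounded)
  have [measurable]: "f \<in> borel_measurable borel" "g \<in> borel_measurable borel"
    using f g by (auto dest: borel_measurable_integrable)
  show "(\<lambda>p. f (fst p) * g (snd p)) \<in> borel_measurable (lborel \<Otimes>\<^sub>M lborel)" by measurable
  have "(\<integral>\<^sup>+p. ennreal (norm (f (fst p) * g (snd p))) \<partial>(lborel \<Otimes>\<^sub>M lborel))
    = (\<integral>\<^sup>+x. (\<integral>\<^sup>+y. ennreal (norm (f x)) * ennreal (norm (g y)) \<partial>lborel) \<partial>lborel)"
    by (subst lborel.nn_integral_fst[symmetric]) (auto simp: abs_mult ennreal_mult)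
  also have "\<dots> = (\<integral>\<^sup>+x. ennreal (norm (f x)) \<partial>lborel) * (\<integral>\<^sup>+y. ennreal (norm (g y)) \<partial>lborel)"
    by (simp add: nn_integral_cmult nn_integral_multc)
  also have "\<dots> < \<infinity>"
    using f g by (simp add: integrable_iff_bounded ennreal_mult_less_top)
  finally show "(\<integral>\<^sup>+p. ennreal (norm (f (fst p) * g (snd p))) \<partial>(lborel \<Otimes>\<^sub>M lborel)) < \<infinity>" .
qed

lemma integrable_prod_inner:
  fixes f g :: "real \<Rightarrow> 'h::{real_inner, banach, second_countable_topology}"
  assumes f: "integrable lborel f" and g: "integrable lborel g"
  shows "integrable (lborel \<Otimes>\<^sub>M lborel) (\<lambda>p. f (fst p) \<bullet> g (snd p))"
proof (rule Bochner_Integration.integrable_bound)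
  have [measurable]: "f \<in> borel_measurable borel" "g \<in> borel_measurable borel"
    using f g by (auto dest: borel_measurable_integrable)
  show "integrable (lborel \<Otimes>\<^sub>M lborel) (\<lambda>p. norm (f (fst p)) * norm (g (snd p)))"
    using f g by (intro integrable_prod_mult) auto
  show "(\<lambda>p. f (fst p) \<bullet> g (snd p)) \<in> borel_measurable (lborel \<Otimes>\<^sub>M lborel)" by measurable
qed (auto intro!: AE_I2 simp: Cauchy_Schwarz_ineq2)

lemma AE_prod_neq: "AE p in (lborel \<Otimes>\<^sub>M lborel). fst p \<noteq> (snd p :: real)"
proof (rule lborel_pair.AE_pair_measure)
  show "{p \<in> space (lborel \<Otimes>\<^sub>M lborel). fst p \<noteq> (snd p :: real)} \<in> sets (lborel \<Otimes>\<^sub>M lborel)"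
    by measurable
  show "AE x in lborel. AE y in lborel. fst (x, y) \<noteq> (snd (x, y) :: real)"
  proof (rule AE_I2)
    fix x :: real
    show "AE y in lborel. fst (x, y) \<noteq> snd (x, y)"
      using AE_lborel_singleton[of x] by (rule AE_mp) auto
  qed
qed

text \<open>Swapping the variables exchanges the two triangles, the diagonal is null, and over the
  full square the form is the squared norm of the integral.\<close>

lemma integral_triangle_inner_self:
  fixes c :: "real \<Rightarrow> 'h::{real_inner, banach, second_countable_topology}"
  assumes c: "integrable lborel c"
  shows "(\<integral>p. (if snd p < fst p then c (fst p) \<bullet> c (snd p) else 0) \<partial>(lborel \<Otimes>\<^sub>M lborel))
      = (norm (\<integral>s. c s \<partial>lborel))\<^sup>2 / 2"
proof -
  have [measurable]: "c \<in> borel_measurable borel"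
    using c by (auto dest: borel_measurable_integrable)
  let ?P = "lborel \<Otimes>\<^sub>M (lborel :: real measure)"
  let ?lt = "\<lambda>p. if snd p < fst p then c (fst p) \<bullet> c (snd p) else 0"
  let ?gt = "\<lambda>p. if fst p < snd p then c (fst p) \<bullet> c (snd p) else 0"
  note I = integrable_prod_inner[OF c c]
  have lt: "integrable ?P ?lt" and gt: "integrable ?P ?gt"
    by (rule Bochner_Integration.integrable_bound[OF I]; auto)+
  have "(\<integral>p. c (fst p) \<bullet> c (snd p) \<partial>?P) = (\<integral>p. ?lt p + ?gt p \<partial>?P)"
    using AE_prod_neq by (intro integral_cong_AE) (auto elim!: AE_mp)
  also have "\<dots> = (\<integral>p. ?lt p \<partial>?P) + (\<integral>p. ?gt p \<partial>?P)"
    using lt gt by simp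
  also have "(\<integral>p. ?gt p \<partial>?P) = (\<integral>p. ?lt p \<partial>?P)"
  proof -
    have "(\<integral>p. ?gt p \<partial>?P) = (\<integral>(x, y). ?lt (y, x) \<partial>?P)"
      by (intro Bochner_Integration.integral_cong) (auto simp: inner_commute)
    also have "\<dots> = (\<integral>p. ?lt p \<partial>?P)"
      by (rule lborel_pair.integral_product_swap) measurable
    finally show ?thesis .
  qed
  finally have 1: "(\<integral>p. c (fst p) \<bullet> c (snd p) \<partial>?P) = 2 * (\<integral>p. ?lt p \<partial>?P)" by simp
  have "(\<integral>p. c (fst p) \<bullet> c (snd p) \<partial>?P) = (\<integral>x. (\<integral>y. c x \<bullet> c y \<partial>lborel) \<partial>lborel)"
    using lborel_pair.integral_fst'[OF I] by simp
  also have "\<dots> = (\<integral>s. c s \<partial>lborel) \<bullet> (\<integral>s. c s \<partial>lborel)"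
    using c by simp
  finally show ?thesis using 1 by (simp add: power2_norm_eq_inner)
qed

lemma nn_integral_power_tail:
  fixes s t :: real
  assumes "s < t" "0 < m"
  shows "(\<integral>\<^sup>+r\<in>{s..t}. ennreal (real m * (t - r) ^ (m - 1)) \<partial>lborel) = ennreal ((t - s) ^ m)"
proof -
  have "((\<lambda>r. real m * (t - r) ^ (m - 1)) has_integral (- ((t - t) ^ m) - (- ((t - s) ^ m)))) {s..t}" (is "(_ has_integral ?v) _")
    using assms
    by (intro fundamental_theorem_of_calculus)
       (auto intro!: derivative_eq_intros simp: has_real_derivative_iff_has_vector_derivative[symmetric])
  also have "?v = (t - s) ^ m" using assms by simp
  finally show ?thesis
    using assms by (intro nn_integral_has_integral_indicator) auto
qed

text \<open>Writing \<open>(t - s)\<^bsup>2 k\<^esup>\<close> as \<open>2 k\<close> times the integral of \<open>(t - r)\<^bsup>2 k - 1\<^esup>\<close> over \<open>r \<in> (s, t)\<close> turns the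
  form into an integral over \<open>r\<close> of half the squared norm of the integral of \<open>(t - s)\<^bsup>-k\<^esup> B s\<close> over \<open>s < r\<close>.\<close>

lemma integral_triangle_ratio_power_nonneg:
  fixes B :: "real \<Rightarrow> 'h::{real_inner, banach, second_countable_topology}"
  assumes B: "integrable lborel B" and B0: "\<And>s. t \<le> s \<Longrightarrow> B s = 0" and k: "0 < k"
  shows "0 \<le> (\<integral>p. (if snd p < fst p then ((t - fst p) / (t - snd p)) ^ k * (B (fst p) \<bullet> B (snd p)) else 0)
      \<partial>(lborel \<Otimes>\<^sub>M lborel))"
proof -
  have [measurable]: "B \<in> borel_measurable borel"
    using B by (auto dest: borel_measurable_integrable)
  let ?P = "lborel \<Otimes>\<^sub>M (lborel :: real measure)"
  define m where "m = 2 * k"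
  have m: "0 < m" using k by (simp add: m_def)
  define b where "b s = (1 / (t - s) ^ k) *\<^sub>R B s" for s
  have [measurable]: "b \<in> borel_measurable borel" unfolding b_def by measurable
  define w where "w r = (if r < t then real m * (t - r) ^ (m - 1) else 0)" for r
  have [measurable]: "w \<in> borel_measurable borel" unfolding w_def by measurable
  have w0: "0 \<le> w r" for r by (simp add: w_def)
  define F where "F p r = (if snd p < fst p \<and> fst p < r then w r * (b (fst p) \<bullet> b (snd p)) else 0)" for p r
  have [measurable]: "case_prod F \<in> borel_measurable (?P \<Otimes>\<^sub>M lborel)"
    unfolding F_def by measurable
  interpret T: pair_sigma_finite ?P lborel
    by (intro pair_sigma_finite.intro) (rule lborel_pair.sigma_finite_measure_axioms, rule lborel.sigma_finite_measure_axioms)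
  define q where "q p = (if snd p < fst p then ((t - fst p) / (t - snd p)) ^ k * (B (fst p) \<bullet> B (snd p)) else 0)" for p
  have wint: "(\<integral>\<^sup>+r. ennreal (if s < r then w r else 0) \<partial>lborel) = ennreal ((t - s) ^ m)" if "s < t" for s
  proof -
    have "(\<integral>\<^sup>+r. ennreal (if s < r then w r else 0) \<partial>lborel)
       = (\<integral>\<^sup>+r\<in>{s..t}. ennreal (real m * (t - r) ^ (m - 1)) \<partial>lborel)"
    proof (intro nn_integral_cong_AE)
      show "AE r in lborel. ennreal (if s < r then w r else 0) = ennreal (real m * (t - r) ^ (m - 1)) * indicator {s..t} r"
        using AE_lborel_singleton[of s] AE_lborel_singleton[of t]
        by eventually_elim (auto simp: w_def indicator_def)
    qed
    then show ?thesis using nn_integral_power_tail[OF that m] by simp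
  qed
  have qb: "q p = (t - fst p) ^ m * (b (fst p) \<bullet> b (snd p))" if "snd p < fst p" "fst p < t" for p
    using that by (simp add: q_def b_def m_def power_mult power2_eq_square power_divide power_mult_distrib mult_2 power_add field_simps)
  \<comment> \<open>Integrating out r undoes the factorisation and leaves a ratio power of at most
    1, so the triple integral is dominated by a product of two integrable functions.\<close>
  have Fnn: "(\<integral>\<^sup>+r. ennreal (norm (F p r)) \<partial>lborel) \<le> ennreal (norm (B (fst p)) * norm (B (snd p)))" for p
  proof (cases "snd p < fst p \<and> fst p < t")
    case True
    have "(\<integral>\<^sup>+r. ennreal (norm (F p r)) \<partial>lborel)
        = (\<integral>\<^sup>+r. ennreal (if fst p < r then w r else 0) * ennreal (norm (b (fst p) \<bullet> b (snd p))) \<partial>lborel)"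
      using True by (intro nn_integral_cong) (simp add: F_def abs_mult w0 ennreal_mult)
    also have "\<dots> = ennreal (norm (q p))"
      using True by (simp add: nn_integral_multc wint ennreal_mult[symmetric] qb abs_mult)
    also have "\<dots> \<le> ennreal (1 * (norm (B (fst p)) * norm (B (snd p))))"
    proof (intro ennreal_leI)
      have "((t - fst p) / (t - snd p)) ^ k \<le> 1" using True by (intro power_le_one) auto
      from mult_mono[OF this Cauchy_Schwarz_ineq2[of "B (fst p)" "B (snd p)"]]
      show "norm (q p) \<le> 1 * (norm (B (fst p)) * norm (B (snd p)))"
        using True unfolding q_def by (simp add: abs_mult)
    qed
    finally show ?thesis by simp
  next
    case False
    then have "norm (F p r) = 0" for r by (auto simp: F_def w_def)
    then show ?thesis by simp
  qed
  have int: "integrable (?P \<Otimes>\<^sub>M lborel) (case_prod F)"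
  proof (rule integrableI_bounded)
    have "(\<integral>\<^sup>+z. ennreal (norm (case_prod F z)) \<partial>(?P \<Otimes>\<^sub>M lborel)) = (\<integral>\<^sup>+p. (\<integral>\<^sup>+r. ennreal (norm (F p r)) \<partial>lborel) \<partial>?P)"
      by (subst lborel.nn_integral_fst[symmetric]) auto
    also have "\<dots> \<le> (\<integral>\<^sup>+p. ennreal (norm (B (fst p)) * norm (B (snd p))) \<partial>?P)"
      by (intro nn_integral_mono Fnn)
    also have "\<dots> < \<infinity>"
      using integrable_prod_mult[of "\<lambda>s. norm (B s)" "\<lambda>s. norm (B s)"] B
      by (simp add: integrable_iff_bounded)
    finally show "(\<integral>\<^sup>+z. ennreal (norm (case_prod F z)) \<partial>(?P \<Otimes>\<^sub>M lborel)) < \<infinity>" .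
  qed measurable
  have "0 \<le> (\<integral>p. F p r \<partial>?P)" for r
  proof (cases "r < t")
    case True
    \<comment> \<open>Restricting to s < r keeps the weight (t - s)^(-k) below (t - r)^(-k); this
      makes \<open>c\<close> integrable although \<open>b\<close> is singular at t.\<close>
    define c where "c s = indicator {..<r} s *\<^sub>R b s" for s
    have c: "integrable lborel c"
    proof (rule Bochner_Integration.integrable_bound)
      show "integrable lborel (\<lambda>s. (1 / (t - r) ^ k) *\<^sub>R B s)" using B by simp
      show "c \<in> borel_measurable lborel" unfolding c_def by measurable
      show "AE s in lborel. norm (c s) \<le> norm ((1 / (t - r) ^ k) *\<^sub>R B s)"
        using True by (intro AE_I2) (auto simp: c_def b_def indicator_def intro!: divide_left_mono mult_right_mono power_mono)
    qed
    have "(\<integral>p. F p r \<partial>?P) = (\<integral>p. w r * (if snd p < fst p then c (fst p) \<bullet> c (snd p) else 0) \<partial>?P)"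
      by (intro Bochner_Integration.integral_cong) (auto simp: F_def c_def indicator_def)
    also have "\<dots> = w r * ((norm (\<integral>s. c s \<partial>lborel))\<^sup>2 / 2)"
      using integral_triangle_inner_self[OF c] by simp
    also have "\<dots> \<ge> 0" using w0 by simp
    finally show ?thesis .
  next
    case False
    then have "F p r = 0" for p by (simp add: F_def w_def)
    then show ?thesis by simp
  qed
  then have "0 \<le> (\<integral>r. (\<integral>p. F p r \<partial>?P) \<partial>lborel)" by (rule Bochner_Integration.integral_nonneg)
  also have "\<dots> = (\<integral>p. (\<integral>r. F p r \<partial>lborel) \<partial>?P)"
    using T.Fubini_integral[OF int] by simp
  also have "\<dots> = (\<integral>p. q p \<partial>?P)"
  proof (rule Bochner_Integration.integral_cong[OF refl])
    fix p
    show "(\<integral>r. F p r \<partial>lborel) = q p"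
    proof (cases "snd p < fst p \<and> fst p < t")
      case True
      have "(\<integral>r. (if fst p < r then w r else 0) \<partial>lborel) = (t - fst p) ^ m"
        by (rule integral_eq_nn_integral[THEN trans]) (use True in \<open>auto simp: wint w0\<close>)
      moreover have "(\<integral>r. F p r \<partial>lborel) = (\<integral>r. (if fst p < r then w r else 0) * (b (fst p) \<bullet> b (snd p)) \<partial>lborel)"
        using True by (intro Bochner_Integration.integral_cong) (auto simp: F_def)
      ultimately show ?thesis using True qb[of p] by simp
    next
      case False
      then have "F p r = 0" for r by (auto simp: F_def w_def)
      moreover have "q p = 0" using False B0 by (auto simp: q_def)
      ultimately show ?thesis by simp
    qed
  qed
  finally show ?thesis unfolding q_def .
qed


text \<open>The sign (-1)^k of the generalised binomial coefficient cancels against that of (-x)^k.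
  The remaining coefficients are nonnegative for a < 1, which is the sign the chain inequality rests
  on.\<close>

lemma binomial_series_neg_power:
  fixes a x :: real
  assumes "a < 1" "\<bar>x\<bar> < 1"
  shows "(\<lambda>k. (pochhammer (1 - a) k / fact k) * x ^ k) sums (1 - x) powr (a - 1)"
proof -
  have "(\<lambda>k. ((a - 1) gchoose k) * (- x) ^ k) sums (1 + (- x)) powr (a - 1)"
    using assms by (intro gen_binomial_real) auto
  moreover have "((a - 1) gchoose k) * (- x) ^ k = (pochhammer (1 - a) k / fact k) * x ^ k" for k
  proof -
    have "(- 1) ^ k * (- x) ^ k = x ^ k" by (simp flip: power_mult_distrib)
    then show ?thesis by (simp add: gbinomial_pochhammer mult_ac)
  qed
  ultimately show ?thesis by simp
qed

text \<open>With \<open>B s = (t - s)\<^bsup>a - 1\<^esup> D s\<close> the two sides differ by \<open>2 c\<^sup>2\<close> times the integral over \<open>s' < s\<close> of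
  \<open>((1 - x)\<^bsup>a - 1\<^esup> - 1) (B s \<bullet> B s')\<close>, where \<open>x = (t - s) / (t - s')\<close>.\<close>

lemma fractional_chain_inequality:
  fixes D e :: "real \<Rightarrow> 'h::{real_inner, banach, second_countable_topology}"
  assumes a: "0 < a" "a < 1" and c: "0 \<le> c"
    and D [measurable]: "D \<in> borel_measurable borel"
    and fin1: "fint a (\<lambda>s. ennreal (norm (D s))) t < \<infinity>"
    and fin2: "fint a (\<lambda>s. ennreal (norm (D s)) * fint a (\<lambda>s. ennreal (norm (D s))) s) t < \<infinity>"
    and e [measurable]: "e \<in> borel_measurable borel"
    and e_eq: "AE s in lborel. D s \<noteq> 0 \<longrightarrow> s < t \<longrightarrow> e s = e0 + c *\<^sub>R rl a D s"
  shows "(norm (e0 + c *\<^sub>R rl a D t))\<^sup>2 \<le> (norm e0)\<^sup>2 + 2 * c * (LINT s|lborel. pker a (t - s) * (D s \<bullet> e s))"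
    and "integrable lborel (\<lambda>s. pker a (t - s) * (D s \<bullet> e s))"
proof -
  let ?P = "lborel \<Otimes>\<^sub>M (lborel :: real measure)"
  define B where "B s = pker a (t - s) *\<^sub>R D s" for s
  have [measurable]: "B \<in> borel_measurable borel" unfolding B_def by measurable
  have B: "integrable lborel B" unfolding B_def by (rule rl_integrable[OF D fin1])
  have B0: "B s = 0" if "t \<le> s" for s using that by (simp add: B_def)
  define E where "E p = (pker a (t - fst p) * pker a (fst p - snd p)) * (D (fst p) \<bullet> D (snd p))" for p
  have [measurable]: "E \<in> borel_measurable ?P" unfolding E_def by measurable
  have E: "integrable ?P E"
  proof (rule Bochner_Integration.integrable_bound)
    let ?N = "\<lambda>p. (pker a (t - fst p) * pker a (fst p - snd p)) * (norm (D (fst p)) * norm (D (snd p)))"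
    show "integrable ?P ?N"
    proof (rule integrableI_bounded)
      have "(\<integral>\<^sup>+p. ennreal (norm (?N p)) \<partial>?P)
          = fint a (\<lambda>s. ennreal (norm (D s)) * fint a (\<lambda>s. ennreal (norm (D s))) s) t"
        unfolding fint_def
        by (subst lborel.nn_integral_fst[symmetric]) (auto simp: nn_integral_cmult[symmetric] ennreal_mult mult_ac)
      then show "(\<integral>\<^sup>+p. ennreal (norm (?N p)) \<partial>?P) < \<infinity>" using fin2 by simp
    qed measurable
  qed (auto simp: E_def abs_mult Cauchy_Schwarz_ineq2 intro!: mult_left_mono)
  define E2 where "E2 p = (if snd p < fst p then B (fst p) \<bullet> B (snd p) else 0)" for p
  have E2: "integrable ?P E2"
    unfolding E2_def by (rule Bochner_Integration.integrable_bound[OF integrable_prod_inner[OF B B]]) auto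
  define x where "x p = (t - fst p) / (t - snd p)" for p
  define co where "co k = pochhammer (1 - a) k / fact k" for k
  have co: "0 \<le> co k" for k using a by (simp add: co_def pochhammer_nonneg)
  have co0: "co 0 = 1" by (simp add: co_def)
  define G where "G k p = (if snd p < fst p then x p ^ k * (B (fst p) \<bullet> B (snd p)) else 0)" for k p
  have [measurable]: "G k \<in> borel_measurable ?P" for k unfolding G_def x_def by measurable
  have EW: "E p = (1 - x p) powr (a - 1) * (B (fst p) \<bullet> B (snd p))" if "snd p < fst p" "fst p < t" for p
  proof -
    have "1 - x p = (fst p - snd p) / (t - snd p)" using that by (simp add: x_def field_simps)
    then have "pker a (fst p - snd p) = (1 - x p) powr (a - 1) * pker a (t - snd p)"
      using that by (simp add: pker_def powr_divide)
    then show ?thesis by (simp add: E_def B_def)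
  qed
  have x01: "0 \<le> x p" "x p < 1" if "snd p < fst p" "fst p < t" for p
    using that by (auto simp: x_def)
  have outside: "E p = 0" "E2 p = 0" "G k p = 0" if "\<not> (snd p < fst p \<and> fst p < t)" for p k
    using that B0 by (auto simp: E_def E2_def G_def pker_def)
  \<comment> \<open>The term k = 0 of the binomial series is \<open>E2\<close> itself, hence the
    shift by one.\<close>
  have sums: "(\<lambda>k. co (Suc k) * G (Suc k) p) sums (E p - E2 p)" for p
  proof (cases "snd p < fst p \<and> fst p < t")
    case True
    then have "(\<lambda>k. co k * x p ^ k) sums (1 - x p) powr (a - 1)"
      unfolding co_def using a x01[of p] by (intro binomial_series_neg_power) auto
    then have "(\<lambda>k. co (Suc k) * x p ^ (Suc k)) sums ((1 - x p) powr (a - 1) - 1)"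
      by (subst sums_Suc_iff) (simp add: co0)
    then have "(\<lambda>k. (co (Suc k) * x p ^ (Suc k)) * (B (fst p) \<bullet> B (snd p))) sums
        (((1 - x p) powr (a - 1) - 1) * (B (fst p) \<bullet> B (snd p)))"
      by (rule sums_mult2)
    then show ?thesis using True EW[of p] by (simp add: G_def E2_def left_diff_distrib mult.assoc)
  next
    case False
    then show ?thesis by (simp add: outside)
  qed
  define S where "S n p = (\<Sum>k<n. co (Suc k) * G (Suc k) p)" for n p
  \<comment> \<open>All coefficients are nonnegative, so every partial sum stays below the full
    series and \<open>norm (E p)\<close> is an integrable dominating function.\<close>
  have bound: "norm (S n p) \<le> norm (E p)" for n p
  proof (cases "snd p < fst p \<and> fst p < t")
    case True
    have s: "(\<lambda>k. co k * x p ^ k) sums (1 - x p) powr (a - 1)"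
      unfolding co_def using a x01[of p] True by (intro binomial_series_neg_power) auto
    then have "(\<lambda>k. co (Suc k) * x p ^ (Suc k)) sums ((1 - x p) powr (a - 1) - 1)"
      by (subst sums_Suc_iff) (simp add: co0)
    then have le: "(\<Sum>k<n. co (Suc k) * x p ^ (Suc k)) \<le> (1 - x p) powr (a - 1) - 1"
      using x01[of p] True co by (subst sums_unique[of _ "(1 - x p) powr (a - 1) - 1"]) 
        (auto intro!: sum_le_suminf mult_nonneg_nonneg simp: sums_iff simp del: power_Suc)
    have "S n p = (\<Sum>k<n. co (Suc k) * x p ^ (Suc k)) * (B (fst p) \<bullet> B (snd p))"
      using True unfolding S_def sum_distrib_right by (intro sum.cong) (auto simp: G_def)
    then have "norm (S n p) = (\<Sum>k<n. co (Suc k) * x p ^ (Suc k)) * \<bar>B (fst p) \<bullet> B (snd p)\<bar>"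
      using x01[of p] True co by (simp add: abs_mult sum_nonneg)
    also have "\<dots> \<le> (1 - x p) powr (a - 1) * \<bar>B (fst p) \<bullet> B (snd p)\<bar>"
      using le by (intro mult_right_mono) auto
    finally show ?thesis using True EW[of p] by (simp add: abs_mult)
  next
    case False
    then show ?thesis by (simp add: outside S_def)
  qed
  have [measurable]: "E2 \<in> borel_measurable ?P" unfolding E2_def by measurable
  have [measurable]: "S n \<in> borel_measurable ?P" for n unfolding S_def by measurable
  have "(\<lambda>n. (\<integral>p. S n p \<partial>?P)) \<longlonglongrightarrow> (\<integral>p. E p - E2 p \<partial>?P)"
    using sums bound E
    by (intro integral_dominated_convergence[where w="\<lambda>p. norm (E p)"]) (auto simp: sums_def S_def)
  moreover have "0 \<le> (\<integral>p. S n p \<partial>?P)" for n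
  proof -
    have "integrable ?P (G (Suc k))" for k
    proof (rule Bochner_Integration.integrable_bound[OF integrable_prod_inner[OF B B]])
      show "AE p in ?P. norm (G (Suc k) p) \<le> norm (B (fst p) \<bullet> B (snd p))"
      proof (intro AE_I2)
        fix p
        show "norm (G (Suc k) p) \<le> norm (B (fst p) \<bullet> B (snd p))"
        proof (cases "snd p < fst p \<and> fst p < t")
          case True
          then have "x p ^ Suc k \<le> 1" using x01[of p] by (intro power_le_one) auto
          then show ?thesis using True x01[of p] by (simp add: G_def abs_mult mult_left_le_one_le del: power_Suc)
        qed (simp add: outside)
      qed
    qed measurable
    then have "(\<integral>p. S n p \<partial>?P) = (\<Sum>k<n. co (Suc k) * (\<integral>p. G (Suc k) p \<partial>?P))"
      unfolding S_def by simp
    also have "\<dots> \<ge> 0"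
    proof (intro sum_nonneg mult_nonneg_nonneg)
      show "0 \<le> (\<integral>p. G (Suc k) p \<partial>?P)" for k
        unfolding G_def x_def by (rule integral_triangle_ratio_power_nonneg[OF B B0]) auto
    qed (rule co)
    finally show ?thesis .
  qed
  ultimately have "0 \<le> (\<integral>p. E p - E2 p \<partial>?P)"
    by (intro LIMSEQ_le_const) auto
  then have "(\<integral>p. E2 p \<partial>?P) \<le> (\<integral>p. E p \<partial>?P)" using E E2 by simp
  then have main: "(norm (\<integral>s. B s \<partial>lborel))\<^sup>2 / 2 \<le> (\<integral>p. E p \<partial>?P)"
    using integral_triangle_inner_self[OF B] unfolding E2_def by simp
  have eqs: "AE s in lborel. pker a (t - s) * (D s \<bullet> e s) = e0 \<bullet> B s + c * (B s \<bullet> rl a D s)"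
    using e_eq
  proof eventually_elim
    case (elim s)
    then show ?case
      by (cases "D s = 0 \<or> t \<le> s") (auto simp: B_def inner_add_right inner_commute algebra_simps)
  qed
  \<comment> \<open>Finiteness of the iterated integral forces, for almost every s, either
    \<open>B s = 0\<close> or a finite inner integral, through which the inner product can be
    moved.\<close>
  have inner_rl: "AE s in lborel. (\<integral>y. E (s, y) \<partial>lborel) = B s \<bullet> rl a D s"
  proof -
    have "AE s in lborel. ennreal (pker a (t - s)) * (ennreal (norm (D s)) * fint a (\<lambda>s. ennreal (norm (D s))) s) \<noteq> \<infinity>"
      using fin2 unfolding fint_def[of a _ t] by (intro nn_integral_PInf_AE) auto
    then show ?thesis
    proof eventually_elim
      case (elim s)
      show ?case
      proof (cases "B s = 0")
        case True
        then show ?thesis by (auto simp: E_def B_def)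
      next
        case False
        then have "fint a (\<lambda>s. ennreal (norm (D s))) s < \<infinity>"
          using elim by (auto simp: B_def ennreal_mult_eq_top_iff less_top)
        then have "integrable lborel (\<lambda>y. pker a (s - y) *\<^sub>R D y)" by (rule rl_integrable[OF D])
        from integral_inner_right[OF this, of "B s"] show ?thesis
          by (simp add: rl_def E_def B_def mult_ac)
      qed
    qed
  qed
  have Eint: "integrable lborel (\<lambda>s. B s \<bullet> rl a D s)" 
    using lborel_pair.integrable_fst'[OF E] inner_rl
    by (subst integrable_cong_AE[OF _ _ inner_rl, symmetric]) auto
  have EE: "(\<integral>p. E p \<partial>?P) = (\<integral>s. B s \<bullet> rl a D s \<partial>lborel)"
    using lborel_pair.integral_fst'[OF E] inner_rl
    by (subst integral_cong_AE[OF _ _ inner_rl, symmetric]) auto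
  have int2: "integrable lborel (\<lambda>s. e0 \<bullet> B s + c * (B s \<bullet> rl a D s))"
    using B Eint by auto
  show "integrable lborel (\<lambda>s. pker a (t - s) * (D s \<bullet> e s))"
    using int2 by (subst integrable_cong_AE[OF _ _ eqs]) auto
  have "(\<integral>s. pker a (t - s) * (D s \<bullet> e s) \<partial>lborel) = (\<integral>s. e0 \<bullet> B s + c * (B s \<bullet> rl a D s) \<partial>lborel)"
    using eqs by (intro integral_cong_AE) auto
  also have "\<dots> = e0 \<bullet> (\<integral>s. B s \<partial>lborel) + c * (\<integral>p. E p \<partial>?P)"
    using B Eint EE by simp
  finally have I: "(\<integral>s. pker a (t - s) * (D s \<bullet> e s) \<partial>lborel) = e0 \<bullet> (\<integral>s. B s \<partial>lborel) + c * (\<integral>p. E p \<partial>?P)" .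
  have "(norm (e0 + c *\<^sub>R rl a D t))\<^sup>2 = (norm e0)\<^sup>2 + 2 * c * (e0 \<bullet> (\<integral>s. B s \<partial>lborel)) + 2 * c\<^sup>2 * ((norm (\<integral>s. B s \<partial>lborel))\<^sup>2 / 2)"
    unfolding rl_def B_def[symmetric] power2_norm_eq_inner
    by (simp add: inner_add_left inner_add_right inner_commute power2_eq_square algebra_simps)
  also have "\<dots> \<le> (norm e0)\<^sup>2 + 2 * c * (e0 \<bullet> (\<integral>s. B s \<partial>lborel)) + 2 * c\<^sup>2 * (\<integral>p. E p \<partial>?P)"
    using main by (intro add_left_mono mult_left_mono) auto
  also have "\<dots> = (norm e0)\<^sup>2 + 2 * c * (\<integral>s. pker a (t - s) * (D s \<bullet> e s) \<partial>lborel)"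
    unfolding I by (simp add: power2_eq_square algebra_simps)
  finally show "(norm (e0 + c *\<^sub>R rl a D t))\<^sup>2 \<le> (norm e0)\<^sup>2 + 2 * c * (\<integral>s. pker a (t - s) * (D s \<bullet> e s) \<partial>lborel)" .
qed

section \<open>Regularity of fractional integrals\<close>

text \<open>On [0, t] the difference has one sign and its mass telescopes to at most (t' - t)^a / a;
  on [t, t'] only the later kernel is nonzero, with mass exactly (t' - t)^a / a.\<close>

lemma nn_integral_pker_abs_diff_le:
  assumes a: "0 < a" "a \<le> 1" and t: "0 \<le> t" "t \<le> t'"
  shows "(\<integral>\<^sup>+s. ennreal \<bar>pker a (t' - s) - pker a (t - s)\<bar> * indicator {0..} s \<partial>lborel)
    \<le> ennreal (2 * (t' - t) powr a / a)"
proof -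
  let ?A = "\<integral>\<^sup>+s\<in>{0..t}. ennreal (pker a (t - s) - pker a (t' - s)) \<partial>lborel"
  have "?A + (\<integral>\<^sup>+s\<in>{0..t}. ennreal (pker a (t' - s)) \<partial>lborel)
      = (\<integral>\<^sup>+s. (ennreal (pker a (t - s) - pker a (t' - s)) + ennreal (pker a (t' - s))) * indicator {0..t} s \<partial>lborel)"
    by (subst nn_integral_add[symmetric]) (auto simp: distrib_right)
  also have "\<dots> = (\<integral>\<^sup>+s\<in>{0..t}. ennreal (pker a (t - s)) \<partial>lborel)"
  proof (rule nn_integral_cong_AE)
    show "AE s in lborel. (ennreal (pker a (t - s) - pker a (t' - s)) + ennreal (pker a (t' - s))) * indicator {0..t} s
        = ennreal (pker a (t - s)) * indicator {0..t} s"
      using AE_lborel_singleton[of t]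
    proof eventually_elim
      case (elim s)
      have "pker a (t' - s) \<le> pker a (t - s)" if "s \<le> t"
        using that elim a t by (intro pker_antimono) auto
      then show ?case by (auto simp: indicator_def ennreal_plus[symmetric] simp del: ennreal_plus)
    qed
  qed
  finally have "?A + ennreal ((t' powr a - (t' - t) powr a) / a) = ennreal (t powr a / a)"
    using a t by (simp add: nn_integral_pker max_def)
  then have "?A = ennreal (t powr a / a) - ennreal ((t' powr a - (t' - t) powr a) / a)"
    by (metis ennreal_add_diff_cancel_right ennreal_neq_top)
  also have "\<dots> = ennreal (t powr a / a - (t' powr a - (t' - t) powr a) / a)"
    using a t by (intro ennreal_minus) (auto intro!: divide_nonneg_pos powr_mono2)
  also have "\<dots> \<le> ennreal ((t' - t) powr a / a)"
  proof (intro ennreal_leI)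
    have "t powr a \<le> t' powr a" using a t by (intro powr_mono2) auto
    then show "t powr a / a - (t' powr a - (t' - t) powr a) / a \<le> (t' - t) powr a / a"
      using a by (simp add: diff_divide_distrib[symmetric] divide_right_mono)
  qed
  finally have A: "?A \<le> ennreal ((t' - t) powr a / a)" .
  have "(\<integral>\<^sup>+s. ennreal \<bar>pker a (t' - s) - pker a (t - s)\<bar> * indicator {0..} s \<partial>lborel)
    \<le> (\<integral>\<^sup>+s. ennreal (pker a (t - s) - pker a (t' - s)) * indicator {0..t} s
        + ennreal (pker a (t' - s)) * indicator {t..t'} s \<partial>lborel)"
  proof (intro nn_integral_mono)
    fix s
    consider "s < t" | "t \<le> s" "s \<le> t'" | "t' < s" by linarith
    then show "ennreal \<bar>pker a (t' - s) - pker a (t - s)\<bar> * indicator {0..} s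
      \<le> ennreal (pker a (t - s) - pker a (t' - s)) * indicator {0..t} s
        + ennreal (pker a (t' - s)) * indicator {t..t'} s"
    proof cases
      case 1
      then have "pker a (t' - s) \<le> pker a (t - s)" using a t by (intro pker_antimono) auto
      then show ?thesis using 1 by (auto simp: indicator_def)
    next
      case 2
      then show ?thesis by (auto simp: indicator_def)
    next
      case 3
      then show ?thesis using t by (auto simp: indicator_def)
    qed
  qed
  also have "\<dots> = ?A + (\<integral>\<^sup>+s\<in>{t..t'}. ennreal (pker a (t' - s)) \<partial>lborel)"
    by (rule nn_integral_add) auto
  also have "\<dots> \<le> ennreal ((t' - t) powr a / a) + ennreal ((t' - t) powr a / a)"
    using a t by (intro add_mono A) (simp add: nn_integral_pker max_def)
  also have "\<dots> = ennreal (2 * (t' - t) powr a / a)"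
    using a by (simp add: ennreal_plus[symmetric] del: ennreal_plus)
  finally show ?thesis .
qed

text \<open>For exponents at least 1 the kernel is increasing in its argument, so over s >= 0 it is
  largest at s = 0.\<close>

lemma fint_ge_1_le:
  assumes b: "1 \<le> b" and [measurable]: "g \<in> borel_measurable borel" and g0: "\<And>s. s < 0 \<Longrightarrow> g s = 0"
  shows "fint b g t \<le> ennreal (max 0 t powr (b - 1)) * (\<integral>\<^sup>+s. g s \<partial>lborel)"
proof -
  have "fint b g t \<le> (\<integral>\<^sup>+s. ennreal (max 0 t powr (b - 1)) * g s \<partial>lborel)"
    unfolding fint_def
  proof (intro nn_integral_mono)
    fix s
    show "ennreal (pker b (t - s)) * g s \<le> ennreal (max 0 t powr (b - 1)) * g s"
    proof (cases "s < 0")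
      case False
      then have "pker b (t - s) \<le> max 0 t powr (b - 1)"
        using b by (auto simp: pker_def intro!: powr_mono2)
      then show ?thesis by (intro mult_right_mono ennreal_leI) auto
    qed (simp add: g0)
  qed
  then show ?thesis by (simp add: nn_integral_cmult)
qed

lemma fint_bounded_finite:
  assumes a: "0 < a" and M: "\<And>s. g s \<le> ennreal M * indicator {0..} s" and "0 \<le> M"
  shows "fint a g t \<le> ennreal (M * (max 0 t powr a / a))"
proof -
  have "fint a g t \<le> (\<integral>\<^sup>+s. ennreal M * (ennreal (pker a (t - s)) * indicator {0..} s) \<partial>lborel)"
    unfolding fint_def
  proof (intro nn_integral_mono)
    fix s show "ennreal (pker a (t - s)) * g s \<le> ennreal M * (ennreal (pker a (t - s)) * indicator {0..} s)"
      using mult_left_mono[OF M[of s], of "ennreal (pker a (t - s))"] by (simp add: mult_ac)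
  qed
  also have "\<dots> = ennreal M * ennreal (max 0 t powr a / a)"
    using a by (simp add: nn_integral_cmult nn_integral_pker_line)
  finally show ?thesis
    using a \<open>0 \<le> M\<close> by (subst ennreal_mult) auto
qed

lemma rl_integrable_bounded:
  fixes v :: "real \<Rightarrow> 'h::{banach, second_countable_topology}"
  assumes a: "0 < a" and [measurable]: "v \<in> borel_measurable borel"
    and M: "\<And>s. norm (v s) \<le> M" and v0: "\<And>s. s < 0 \<Longrightarrow> v s = 0"
  shows "integrable lborel (\<lambda>s. pker a (t - s) *\<^sub>R v s)"
proof (rule rl_integrable)
  have M0: "0 \<le> M" using M[of 0] norm_ge_zero order_trans by blast
  have "fint a (\<lambda>s. ennreal (norm (v s))) t \<le> ennreal (M * (max 0 t powr a / a))"
    using a M M0 v0 by (intro fint_bounded_finite) (auto simp: indicator_def)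
  then show "fint a (\<lambda>s. ennreal (norm (v s))) t < \<infinity>" by (simp add: le_less_trans)
qed measurable

text \<open>The L1 distance of the two kernels times the supremum of \<open>v\<close>. It yields the
  continuity of the fractional interpolant, on which the passage from almost all times to all times
  relies.\<close>

lemma rl_holder:
  fixes v :: "real \<Rightarrow> 'h::{banach, second_countable_topology}"
  assumes a: "0 < a" "a \<le> 1" and [measurable]: "v \<in> borel_measurable borel"
    and M: "\<And>s. norm (v s) \<le> M" and v0: "\<And>s. s < 0 \<Longrightarrow> v s = 0" and t: "0 \<le> t" "t \<le> t'"
  shows "norm (rl a v t' - rl a v t) \<le> M * (2 * (t' - t) powr a / a)"
proof -
  have M0: "0 \<le> M" using M[of 0] norm_ge_zero order_trans by blast
  have I: "integrable lborel (\<lambda>s. pker a (r - s) *\<^sub>R v s)" for r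
    using a M v0 by (intro rl_integrable_bounded) auto
  have "rl a v t' - rl a v t = (\<integral>s. (pker a (t' - s) - pker a (t - s)) *\<^sub>R v s \<partial>lborel)"
    unfolding rl_def using I by (simp add: scaleR_left_diff_distrib)
  also have "ennreal (norm \<dots>) \<le> (\<integral>\<^sup>+s. ennreal (norm ((pker a (t' - s) - pker a (t - s)) *\<^sub>R v s)) \<partial>lborel)"
    using I[of t] I[of t'] by (intro integral_norm_bound_ennreal) (simp add: scaleR_left_diff_distrib)
  also have "\<dots> \<le> (\<integral>\<^sup>+s. ennreal M * (ennreal \<bar>pker a (t' - s) - pker a (t - s)\<bar> * indicator {0..} s) \<partial>lborel)"
  proof (intro nn_integral_mono)
    fix s
    show "ennreal (norm ((pker a (t' - s) - pker a (t - s)) *\<^sub>R v s))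
        \<le> ennreal M * (ennreal \<bar>pker a (t' - s) - pker a (t - s)\<bar> * indicator {0..} s)"
      using M[of s] v0[of s] M0
      by (cases "s < 0") (auto simp: ennreal_mult[symmetric] mult.commute intro!: ennreal_leI mult_left_mono mult_right_mono)
  qed
  also have "\<dots> \<le> ennreal M * ennreal (2 * (t' - t) powr a / a)"
    using nn_integral_pker_abs_diff_le[OF a t] by (simp add: nn_integral_cmult mult_left_mono)
  finally show ?thesis using M0 a by (simp add: ennreal_mult[symmetric])
qed

lemma continuous_on_rl:
  fixes v :: "real \<Rightarrow> 'h::{banach, second_countable_topology}"
  assumes a: "0 < a" "a \<le> 1" and v: "v \<in> borel_measurable borel"
    and M: "\<And>s. norm (v s) \<le> M" and v0: "\<And>s. s < 0 \<Longrightarrow> v s = 0"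
  shows "continuous_on {0..} (rl a v)"
proof -
  have M0: "0 \<le> M" using M[of 0] norm_ge_zero order_trans by blast
  have "((rl a v) \<longlongrightarrow> rl a v t) (at t within {0..})" if "t \<in> {0..}" for t
  proof (rule Lim_null[THEN iffD2], rule Lim_null_comparison)
    show "\<forall>\<^sub>F x in at t within {0..}. norm (rl a v x - rl a v t) \<le> M * (2 * \<bar>x - t\<bar> powr a / a)"
      unfolding eventually_at_filter
    proof (intro always_eventually allI impI)
      fix x :: real assume "x \<in> {0..}"
      then show "norm (rl a v x - rl a v t) \<le> M * (2 * \<bar>x - t\<bar> powr a / a)"
        using rl_holder[OF a v M v0, of t x] rl_holder[OF a v M v0, of x t] that
        by (cases "t \<le> x") (auto simp: norm_minus_commute)
    qed
    have "((\<lambda>x. M * (2 * \<bar>x - t\<bar> powr a / a)) \<longlongrightarrow> M * (2 * \<bar>t - t\<bar> powr a / a)) (at t within {0..})"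
      using a by (intro tendsto_intros tendsto_powr2) (auto intro!: always_eventually)
    then show "((\<lambda>x. M * (2 * \<bar>x - t\<bar> powr a / a)) \<longlongrightarrow> 0) (at t within {0..})" using a by simp
  qed
  then show ?thesis by (simp add: continuous_on_def)
qed

text \<open>The half lines are stable under intersection and generate the Borel sets, so by a Dynkin
  argument the integral of \<open>w\<close> vanishes over every Borel set.\<close>

lemma AE_zero_of_primitive_zero:
  fixes w :: "real \<Rightarrow> 'h::{banach, second_countable_topology}"
  assumes w: "integrable lborel w" and prim: "\<And>t. t < T \<Longrightarrow> rl 1 w t = 0"
    and w0: "\<And>s. T \<le> s \<Longrightarrow> w s = 0"
  shows "AE s in lborel. w s = 0"
proof (rule sigma_finite_measure.density_zero[OF lborel.sigma_finite_measure_axioms w])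
  have [measurable]: "w \<in> borel_measurable borel" using w by (auto dest: borel_measurable_integrable)
  have wA: "set_integrable lborel A w" if "A \<in> sets borel" for A
    unfolding set_integrable_def using w that by (intro integrable_mult_indicator) auto
  have less: "set_lebesgue_integral lborel {..<t} w = 0" if "t < T" for t
  proof -
    have "set_lebesgue_integral lborel {..<t} w = rl 1 w t"
      unfolding set_lebesgue_integral_def rl_def
      by (intro Bochner_Integration.integral_cong) (auto simp: indicator_def pker_def)
    then show ?thesis using prim[OF that] by simp
  qed
  \<comment> \<open>The hypothesis reaches only t < T; the half line up to T itself is obtained as a
    limit, and beyond T nothing is added.\<close>
  have lessT: "set_lebesgue_integral lborel {..<T} w = 0"
  proof -
    have "(\<lambda>n. set_lebesgue_integral lborel {..<T - 1 / Suc n} w) \<longlonglongrightarrow> set_lebesgue_integral lborel {..<T} w"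
      unfolding set_lebesgue_integral_def
    proof (rule integral_dominated_convergence[where w="\<lambda>s. norm (w s)"])
      show "AE x in lborel. (\<lambda>n. indicator {..<T - 1 / Suc n} x *\<^sub>R w x) \<longlonglongrightarrow> indicator {..<T} x *\<^sub>R w x"
      proof (intro AE_I2)
        fix x
        show "(\<lambda>n. indicator {..<T - 1 / Suc n} x *\<^sub>R w x) \<longlonglongrightarrow> indicator {..<T} x *\<^sub>R w x"
        proof (cases "x < T")
          case True
          have "\<forall>\<^sub>F n in sequentially. 1 / Suc n < T - x"
            using True by (intro order_tendstoD(2)[OF lim_1_over_n[THEN LIMSEQ_Suc]]) auto
          then have "\<forall>\<^sub>F n in sequentially. indicator {..<T - 1 / Suc n} x *\<^sub>R w x = indicator {..<T} x *\<^sub>R w x"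
            by eventually_elim (use True in \<open>auto simp: indicator_def\<close>)
          then show ?thesis by (rule tendsto_eventually)
        next
          case False
          then show ?thesis by (simp add: w0)
        qed
      qed
    qed (use w in \<open>auto simp: indicator_def\<close>)
    moreover have "set_lebesgue_integral lborel {..<T - 1 / Suc n} w = 0" for n
      by (intro less) auto
    ultimately show ?thesis by (simp add: LIMSEQ_const_iff)
  qed
  have all: "set_lebesgue_integral lborel {..<t} w = 0" for t
  proof (cases "t < T")
    case False
    then have "set_lebesgue_integral lborel {..<t} w = set_lebesgue_integral lborel {..<T} w"
      unfolding set_lebesgue_integral_def
      by (intro Bochner_Integration.integral_cong) (auto simp: indicator_def w0)
    then show ?thesis using lessT by simp
  qed (rule less)
  have UN: "set_lebesgue_integral lborel UNIV w = 0"
    using lessT unfolding set_lebesgue_integral_def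
    by (subst Bochner_Integration.integral_cong[OF refl, of _ _ "\<lambda>s. indicator {..<T} s *\<^sub>R w s"])
       (auto simp: indicator_def w0)
  fix A :: "real set" assume "A \<in> sets lborel"
  then have sig: "A \<in> sigma_sets UNIV (range lessThan)"
    by (simp add: borel_Iio sets_measure_of)
  have sub: "range (lessThan :: real \<Rightarrow> _) \<subseteq> Pow UNIV" by simp
  have stable: "Int_stable (range (lessThan :: real \<Rightarrow> _))"
    unfolding Int_stable_def
  proof (intro ballI)
    fix a b :: "real set" assume "a \<in> range lessThan" "b \<in> range lessThan"
    then obtain x y where "a = {..<x}" "b = {..<y}" by auto
    then have "a \<inter> b = {..<min x y}" by auto
    then show "a \<inter> b \<in> range lessThan" by auto
  qed
  from stable sub sig show "set_lebesgue_integral lborel A w = 0"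
  proof (induction A rule: sigma_sets_induct_disjoint)
    case (basic A)
    then show ?case using all by auto
  next
    case empty
    then show ?case by (simp add: set_lebesgue_integral_def)
  next
    case (compl A)
    then have A: "A \<in> sets borel" by (simp add: borel_Iio sets_measure_of)
    have "set_lebesgue_integral lborel UNIV w = set_lebesgue_integral lborel A w + set_lebesgue_integral lborel (UNIV - A) w"
      using A wA by (subst set_integral_Un[symmetric]) auto
    then show ?case using compl UN by simp
  next
    case (union A)
    then have A: "A i \<in> sets borel" for i by (auto simp: borel_Iio sets_measure_of)
    have "set_lebesgue_integral lborel (\<Union>i. A i) w = (\<Sum>i. set_lebesgue_integral lborel (A i) w)"
      using A wA union by (intro lebesgue_integral_countable_add) (auto simp: disjoint_family_on_def)
    then show ?case using union by simp
  qed
qed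

text \<open>A countable basis leaves only countably many preimages to correct. Each differs from a
  set of \<open>M\<close> by part of a null set, and on the union of these null sets the function is
  replaced by the constant \<open>undefined\<close>.\<close>

lemma completion_ex_borel_measurable_metric:
  fixes f :: "'a \<Rightarrow> 'h::{second_countable_topology}"
  assumes f: "f \<in> borel_measurable (completion M)"
  shows "\<exists>f'\<in>borel_measurable M. AE x in M. f x = f' x"
proof -
  obtain \<B> :: "'h set set" where \<B>: "countable \<B>" "topological_basis \<B>"
    using ex_countable_basis by auto
  have sets: "f -` b \<inter> space M \<in> sets (completion M)" if "b \<in> \<B>" for b
    using measurable_sets[OF f borel_open[OF topological_basis_open[OF \<B>(2) that]]] by simp
  have "\<exists>N. N \<in> null_sets M \<and> null_part M (f -` b \<inter> space M) \<subseteq> N" if "b \<in> \<B>" for b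
    using null_part[OF sets[OF that]] by blast
  then obtain N where N: "\<And>b. b \<in> \<B> \<Longrightarrow> N b \<in> null_sets M \<and> null_part M (f -` b \<inter> space M) \<subseteq> N b"
    by metis
  define N' where "N' = (\<Union>b\<in>\<B>. N b)"
  have N': "N' \<in> null_sets M" unfolding N'_def using \<B> N by (intro null_sets_UN') auto
  define f' where "f' x = (if x \<in> N' then undefined else f x)" for x
  have "f' \<in> measurable M (sigma UNIV \<B>)"
  proof (rule measurable_measure_of)
    fix b assume b: "b \<in> \<B>"
    let ?S = "f -` b \<inter> space M"
    have "?S = main_part M ?S \<union> null_part M ?S" using main_part_null_part_Un[OF sets[OF b]] by simp
    then have "?S - N' = main_part M ?S - N'" using N[OF b] b by (auto simp: N'_def)
    moreover have "main_part M ?S - N' \<in> sets M" using sets[OF b] N' by auto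
    ultimately have "?S - N' \<in> sets M" by simp
    moreover have "f' -` b \<inter> space M = (?S - N') \<union> (if undefined \<in> b then N' else {})"
      using N' sets.sets_into_space[of N' M] by (auto simp: f'_def split: if_splits)
    ultimately show "f' -` b \<inter> space M \<in> sets M"
      using null_setsD2[OF N'] sets.Un sets.empty_sets by (simp del: Un_Diff_cancel2)
  qed auto
  then have "f' \<in> borel_measurable M" using borel_eq_countable_basis[OF \<B>] by simp
  moreover have "AE x in M. f x = f' x" using AE_not_in[OF N'] by eventually_elim (simp add: f'_def)
  ultimately show ?thesis by blast
qed

section \<open>A smooth step function\<close>

text \<open>A class closed under differentiation, so that one induction covers all the iterated
  derivatives demanded by \<open>test_fun\<close>. The rule \<open>flat\<close> carries a polynomial
  because differentiating exp(-1/x) produces one; \<open>primitive\<close> admits the smooth step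
  itself.\<close>

inductive smooth_gen :: "(real \<Rightarrow> real) \<Rightarrow> bool" where
  flat: "smooth_gen (\<lambda>x. if 0 < x then poly p (1 / x) * exp (- (1 / x)) else 0)"
| const: "smooth_gen (\<lambda>x. c)"
| add: "smooth_gen f \<Longrightarrow> smooth_gen g \<Longrightarrow> smooth_gen (\<lambda>x. f x + g x)"
| mult: "smooth_gen f \<Longrightarrow> smooth_gen g \<Longrightarrow> smooth_gen (\<lambda>x. f x * g x)"
| affine: "smooth_gen f \<Longrightarrow> smooth_gen (\<lambda>x. f (a * x + b))"
| primitive: "smooth_gen f \<Longrightarrow> (\<And>x. (F has_real_derivative f x) (at x)) \<Longrightarrow> smooth_gen F"

lemma poly_exp_minus_tendsto_0: "((\<lambda>y. poly p y * exp (- y)) \<longlongrightarrow> 0) (at_top :: real filter)"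
proof -
  have "((\<lambda>y. \<Sum>i\<le>degree p. coeff p i * (y ^ i / exp y)) \<longlongrightarrow> (\<Sum>i\<le>degree p. coeff p i * 0)) (at_top :: real filter)"
    by (intro tendsto_sum tendsto_mult tendsto_const tendsto_power_div_exp_0)
  then show ?thesis
    by (simp add: poly_altdef exp_minus sum_distrib_left sum_distrib_right divide_inverse mult_ac)
qed

text \<open>With y = 1/x the chain rule gives y^2 (p(y) - p'(y)) exp(-y); the factor y^2 is
  \<open>[:0, 0, 1:]\<close>.\<close>

lemma flat_has_derivative:
  fixes p :: "real poly"
  shows "((\<lambda>x. if 0 < x then poly p (1 / x) * exp (- (1 / x)) else 0) has_real_derivative
    (if 0 < x then poly ([:0, 0, 1:] * (p - pderiv p)) (1 / x) * exp (- (1 / x)) else 0)) (at x)"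
    (is "(?f has_real_derivative ?d) _")
proof (cases x "0 :: real" rule: linorder_cases)
  case less
  have "((\<lambda>_. 0) has_real_derivative 0) (at x)" by simp
  then have "(?f has_real_derivative 0) (at x)"
    by (rule has_field_derivative_transform_within_open[of _ _ _ "{..<0}"]) (use less in auto)
  then show ?thesis using less by simp
next
  case greater
  have "((\<lambda>x. poly p (1 / x) * exp (- (1 / x))) has_real_derivative
      poly ([:0, 0, 1:] * (p - pderiv p)) (1 / x) * exp (- (1 / x))) (at x)"
    using greater by (auto intro!: derivative_eq_intros simp: field_simps power2_eq_square)
  then have "(?f has_real_derivative poly ([:0, 0, 1:] * (p - pderiv p)) (1 / x) * exp (- (1 / x))) (at x)"
    by (rule has_field_derivative_transform_within_open[of _ _ _ "{0<..}"]) (use greater in auto)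
  then show ?thesis using greater by simp
next
  case equal
  \<comment> \<open>At 0 the right difference quotient is again of the flat form, with polynomial
    \<open>[:0, 1:] * p\<close>; the left one is identically 0.\<close>
  have "((\<lambda>h. ?f h / h) \<longlongrightarrow> 0) (at_right 0)"
  proof -
    have "filterlim (\<lambda>h :: real. 1 / h) at_top (at_right 0)"
      using filterlim_inverse_at_top_right by (simp add: inverse_eq_divide)
    from filterlim_compose[OF poly_exp_minus_tendsto_0[of "[:0, 1:] * p"] this]
    have "((\<lambda>h. poly ([:0, 1:] * p) (1 / h) * exp (- (1 / h))) \<longlongrightarrow> 0) (at_right 0)" .
    then show ?thesis
      by (rule Lim_transform_eventually) (auto simp: eventually_at_right_field intro!: exI[of _ 1])
  qed
  moreover have "((\<lambda>h. ?f h / h) \<longlongrightarrow> 0) (at_left 0)"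
    by (rule Lim_transform_eventually[OF tendsto_const]) (auto simp: eventually_at_left_field intro!: exI[of _ "-1"])
  ultimately have "((\<lambda>h. ?f h / h) \<longlongrightarrow> 0) (at 0)" by (simp add: filterlim_split_at)
  then have "(?f has_real_derivative 0) (at 0)" by (simp add: DERIV_def cong: if_cong)
  then show ?thesis using equal by simp
qed

lemma smooth_gen_derivative:
  assumes "smooth_gen f"
  shows "\<exists>f'. smooth_gen f' \<and> (\<forall>x. (f has_real_derivative f' x) (at x))"
  using assms
proof induction
  case (flat p)
  show ?case
    using flat_has_derivative[of p] smooth_gen.flat[of "[:0, 0, 1:] * (p - pderiv p)"] by blast
next
  case (const c)
  then show ?case by (intro exI[of _ "\<lambda>_. 0"]) (auto intro: smooth_gen.const)
next
  case (add f g)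
  then obtain f' g' where "smooth_gen f'" "\<forall>x. (f has_real_derivative f' x) (at x)"
      "smooth_gen g'" "\<forall>x. (g has_real_derivative g' x) (at x)" by auto
  then show ?case
    by (intro exI[of _ "\<lambda>x. f' x + g' x"]) (auto intro: smooth_gen.add DERIV_add)
next
  case (mult f g)
  then obtain f' g' where *: "smooth_gen f'" "\<forall>x. (f has_real_derivative f' x) (at x)"
      "smooth_gen g'" "\<forall>x. (g has_real_derivative g' x) (at x)" by auto
  then have "smooth_gen (\<lambda>x. f' x * g x + g' x * f x)"
    using mult by (intro smooth_gen.add smooth_gen.mult) auto
  moreover have "((\<lambda>x. f x * g x) has_real_derivative f' x * g x + g' x * f x) (at x)" for x
    by (rule DERIV_mult[OF *(2)[rule_format] *(4)[rule_format]])
  ultimately show ?case by (intro exI[of _ "\<lambda>x. f' x * g x + g' x * f x"]) simp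
next
  case (affine f a b)
  then obtain f' where *: "smooth_gen f'" "\<forall>x. (f has_real_derivative f' x) (at x)" by auto
  have "smooth_gen (\<lambda>x. f' (a * x + b) * a)"
    by (rule smooth_gen.mult[OF smooth_gen.affine[OF *(1)] smooth_gen.const])
  moreover have "((\<lambda>x. f (a * x + b)) has_real_derivative f' (a * x + b) * a) (at x)" for x
  proof (rule DERIV_chain2[of f])
    show "(f has_real_derivative f' (a * x + b)) (at (a * x + b))" using * by simp
    show "((\<lambda>x. a * x + b) has_real_derivative a) (at x)" by (auto intro!: derivative_eq_intros)
  qed
  ultimately show ?case by (intro exI[of _ "\<lambda>x. f' (a * x + b) * a"]) simp
next
  case (primitive f F)
  then show ?case by blast
qed

lemma smooth_gen_differentiable:
  assumes "smooth_gen f"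
  shows "((deriv ^^ k) f) differentiable (at x)"
  using assms
proof (induction k arbitrary: f)
  case 0
  then show ?case using smooth_gen_derivative[OF 0] by (auto simp: real_differentiable_def)
next
  case (Suc k)
  from smooth_gen_derivative[OF Suc.prems] obtain f' where
    f': "smooth_gen f'" "\<forall>x. (f has_real_derivative f' x) (at x)" by blast
  then have "deriv f = f'" by (auto intro!: DERIV_imp_deriv)
  then show ?case using Suc.IH[OF f'(1)] by (simp add: funpow_Suc_right del: funpow.simps)
qed

text \<open>The antiderivative of the bump h(x) h(1 - x), normalised to rise from 0 to 1. Later
  \<open>S\<close> serves as a cutoff and its derivative \<open>\<eta>\<close> as a mollifier of
  mass 1.\<close>

lemma smooth_step_exists:
  "\<exists>S \<eta>. smooth_gen S \<and> (\<forall>x. (S has_real_derivative \<eta> x) (at x)) \<and> continuous_on UNIV \<eta> \<and>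
     (\<forall>x. 0 \<le> \<eta> x) \<and> (\<forall>x. x \<notin> {0..1} \<longrightarrow> \<eta> x = 0) \<and>
     (\<forall>x\<le>0. S x = 0) \<and> (\<forall>x\<ge>1. S x = 1) \<and> (\<forall>x. 0 \<le> S x \<and> S x \<le> (1 :: real))"
proof -
  define h where "h x = (if 0 < x then exp (- (1 / x)) else 0)" for x :: real
  have h: "smooth_gen h" using smooth_gen.flat[of 1] by (simp add: h_def[abs_def] cong: if_cong)
  \<comment> \<open>The reflected argument is written in the shape required by the rule
    \<open>affine\<close>.\<close>
  define b where "b x = h x * h (- 1 * x + 1)" for x
  have b: "smooth_gen b" unfolding b_def by (rule smooth_gen.mult[OF h smooth_gen.affine[OF h]])
  have b_nonneg: "0 \<le> b x" for x by (simp add: b_def h_def)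
  have b_pos: "0 < b x" if "0 < x" "x < 1" for x using that by (simp add: b_def h_def)
  have b_out: "b x = 0" if "x \<le> 0 \<or> 1 \<le> x" for x using that by (auto simp: b_def h_def)
  obtain b' where "\<forall>x. (b has_real_derivative b' x) (at x)" using smooth_gen_derivative[OF b] by blast
  then have b_cont: "isCont b x" for x by (blast intro: DERIV_isCont)
  obtain F where F: "\<And>x. (F has_real_derivative b x) (at x)"
    using einterval_antiderivative[of "-\<infinity>" "\<infinity>" b] b_cont
    by (auto simp: has_real_derivative_iff_has_vector_derivative)
  have mono: "F x \<le> F y" if "x \<le> y" for x y
    using that F b_nonneg by (intro DERIV_nonneg_imp_nondecreasing[of x y F]) blast+
  have left: "F x = F 0" if "x \<le> 0" for x
  proof (cases "x = 0")
    case False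
    then show ?thesis
      using that F b_out
      by (intro DERIV_isconst_end[of x 0 F, symmetric]) (auto intro!: DERIV_continuous_on continuous_at_imp_continuous_on DERIV_isCont, metis less_imp_le)
  qed simp
  have right: "F x = F 1" if "1 \<le> x" for x
  proof (cases "x = 1")
    case False
    then show ?thesis
      using that F b_out
      by (intro DERIV_isconst_end[of 1 x F]) (auto intro!: continuous_at_imp_continuous_on DERIV_isCont, metis less_imp_le)
  qed simp
  have lt: "F 0 < F 1"
    using F b_pos
    by (intro DERIV_pos_imp_increasing_open[of 0 1 F]) (auto intro!: continuous_at_imp_continuous_on DERIV_isCont)
  define S where "S x = (1 / (F 1 - F 0)) * (F x + - F 0)" for x
  define \<eta> where "\<eta> x = (1 / (F 1 - F 0)) * b x" for x
  have "smooth_gen S" unfolding S_def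
    by (rule smooth_gen.mult[OF smooth_gen.const smooth_gen.add[OF smooth_gen.primitive[OF b F] smooth_gen.const]])
  moreover have "(S has_real_derivative \<eta> x) (at x)" for x
    unfolding S_def \<eta>_def using F lt by (auto intro!: derivative_eq_intros)
  moreover have "continuous_on UNIV \<eta>" unfolding \<eta>_def
    using b_cont by (intro continuous_intros continuous_at_imp_continuous_on) auto
  moreover have "0 \<le> \<eta> x" for x using b_nonneg lt by (simp add: \<eta>_def)
  moreover have "\<eta> x = 0" if "x \<notin> {0..1}" for x using b_out[of x] that by (auto simp: \<eta>_def)
  moreover have "S x = 0" if "x \<le> 0" for x using left[OF that] by (simp add: S_def)
  moreover have "S x = 1" if "1 \<le> x" for x using right[OF that] lt by (simp add: S_def)
  moreover have "0 \<le> S x \<and> S x \<le> 1" for x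
  proof -
    have "F 0 \<le> F x" using mono[of 0 x] left[of x] by (cases "0 \<le> x") auto
    moreover have "F x \<le> F 1" using mono[of x 1] right[of x] by (cases "x \<le> 1") auto
    ultimately show ?thesis using lt by (simp add: S_def)
  qed
  ultimately show ?thesis by blast
qed

section \<open>Fractional integral representation of energy solutions\<close>

text \<open>The test functions approximate the indicator of [0, c). On [0, c] their derivatives are
  minus an approximate identity concentrated just left of c, so by continuity one side tends to
  \<open>- g c\<close>, while dominated convergence turns the other into minus the integral of
  \<open>h\<close> up to c.\<close>

lemma weak_derivative_integral:
  fixes g h :: "real \<Rightarrow> 'h::{banach, second_countable_topology}"
  assumes c: "0 < c" "c < T" and g_cont: "continuous_on {0..c} g" and g_neg: "\<And>t. t < 0 \<Longrightarrow> g t = 0"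
    and h: "set_integrable lebesgue {0..c} h"
    and weak: "\<And>\<phi>. test_fun T \<phi> \<Longrightarrow> (LINT t:{..<T}|lebesgue. deriv \<phi> t *\<^sub>R g t)
        = - (LINT t:{0..<T}|lebesgue. \<phi> t *\<^sub>R h t)"
  shows "g c = (LINT t:{0..c}|lebesgue. h t)"
proof -
  obtain S \<eta> :: "real \<Rightarrow> real" where S: "smooth_gen S" and S': "\<And>x. (S has_real_derivative \<eta> x) (at x)"
    and \<eta>_cont: "continuous_on UNIV \<eta>" and \<eta>_nonneg: "\<And>x. 0 \<le> \<eta> x"
    and \<eta>_out: "\<And>x. x \<notin> {0..1} \<Longrightarrow> \<eta> x = 0" and S0: "\<And>x. x \<le> 0 \<Longrightarrow> S x = 0"
    and S1: "\<And>x. 1 \<le> x \<Longrightarrow> S x = 1" and S01: "\<And>x. 0 \<le> S x \<and> S x \<le> 1"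
    using smooth_step_exists by blast
  have [measurable]: "\<eta> \<in> borel_measurable borel"
    using \<eta>_cont by (rule borel_measurable_continuous_onI)
  have Scont: "continuous_on UNIV S"
    using S' by (intro continuous_at_imp_continuous_on) (auto intro: DERIV_isCont)
  then have [measurable]: "S \<in> borel_measurable borel"
    by (rule borel_measurable_continuous_onI)
  define k where "k n = real (Suc n)" for n
  have k: "0 < k n" for n by (simp add: k_def)
  \<comment> \<open>The first factor falls from 1 to 0 on [c - 1 / k n, c]. The second rises on
    [-2, -1], where \<open>g\<close> vanishes, and only serves to make the support compact.\<close>
  define \<phi> where "\<phi> n t = S ((- k n) * t + k n * c) * S (1 * t + 2)" for n t
  have \<phi>': "(\<phi> n has_real_derivative \<eta> ((- k n) * t + k n * c) * (- k n) * S (1 * t + 2) + \<eta> (1 * t + 2) * 1 * S ((- k n) * t + k n * c)) (at t)" for n t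
    unfolding \<phi>_def
    by (rule DERIV_mult; rule DERIV_chain2[OF S']; (auto intro!: derivative_eq_intros)[1])
  have \<phi>_out: "\<phi> n t = 0" if "t < -2 \<or> c \<le> t" for n t
  proof -
    have "- k n * t + k n * c \<le> 0" if "c \<le> t" using that k[of n] by simp
    then show ?thesis using that S0 by (auto simp: \<phi>_def)
  qed
  have test: "test_fun T (\<phi> n)" for n
    unfolding test_fun_def
  proof (intro conjI allI)
    have "smooth_gen (\<phi> n)" unfolding \<phi>_def
      by (rule smooth_gen.mult[OF smooth_gen.affine[OF S] smooth_gen.affine[OF S]])
    then show "((deriv ^^ j) (\<phi> n)) differentiable (at x)" for j x by (rule smooth_gen_differentiable)
    show "\<exists>a b. b < T \<and> (\<forall>x. x \<notin> {a..b} \<longrightarrow> \<phi> n x = 0)"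
      using c \<phi>_out by (intro exI[of _ "-2"] exI[of _ c]) auto
  qed
  \<comment> \<open>The truncation to [0, c] loses nothing, since \<open>g\<close> vanishes before 0
    and the derivative of the test function after c. It is Borel measurable and bounded, so
    integration can move from \<open>lebesgue\<close> to \<open>lborel\<close>.\<close>
  define G where "G t = indicator {0..c} t *\<^sub>R g t" for t
  have [measurable]: "G \<in> borel_measurable borel"
    unfolding G_def[abs_def] using g_cont by (intro borel_measurable_continuous_on_indicator) auto
  have "compact (g ` {0..c})" using g_cont by (intro compact_continuous_image) auto
  then obtain M where M: "\<And>t. t \<in> {0..c} \<Longrightarrow> norm (g t) \<le> M"
    by (metis compact_imp_bounded bounded_iff image_eqI)
  have GM: "norm (G t) \<le> \<bar>M\<bar>" for t
    using M[of t] by (auto simp: G_def indicator_def)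
  have \<eta>_ind: "indicator {0..1} x * \<eta> x = \<eta> x" for x using \<eta>_out[of x] by (auto simp: indicator_def)
  have \<eta>_int: "integrable lborel \<eta>"
    using borel_integrable_compact[of "{0..1}" \<eta>] continuous_on_subset[OF \<eta>_cont]
    by (simp add: \<eta>_ind)
  have \<eta>_one: "(\<integral>x. \<eta> x \<partial>lborel) = 1"
    using integral_FTC_Icc_real[of 0 1 S \<eta>] S' \<eta>_cont S0[of 0] S1[of 1]
    by (simp add: \<eta>_ind mult.commute[of _ "indicator _ _"] continuous_on_eq_continuous_at)
  have lhs: "(LINT t:{..<T}|lebesgue. deriv (\<phi> n) t *\<^sub>R g t) = - (\<integral>x. \<eta> x *\<^sub>R G (c - x / k n) \<partial>lborel)" for n
  proof -
    have "indicator {..<T} t *\<^sub>R (deriv (\<phi> n) t *\<^sub>R g t) = - ((k n * \<eta> (- k n * t + k n * c)) *\<^sub>R G t)" for t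
    proof -
      have d: "deriv (\<phi> n) t = \<eta> ((- k n) * t + k n * c) * (- k n) * S (1 * t + 2) + \<eta> (1 * t + 2) * 1 * S ((- k n) * t + k n * c)"
        using \<phi>' by (rule DERIV_imp_deriv)
      consider "t < 0" | "0 \<le> t" "t \<le> c" | "c < t" by linarith
      then show ?thesis
      proof cases
        case 1
        then show ?thesis by (simp add: g_neg G_def)
      next
        case 2
        then show ?thesis unfolding d using c S1[of "1 * t + 2"] \<eta>_out[of "1 * t + 2"] by (simp add: G_def)
      next
        case 3
        then have "- k n * t + k n * c < 0" using k[of n] by simp
        then have "S (- k n * t + k n * c) = 0" "\<eta> (- k n * t + k n * c) = 0" using S0 \<eta>_out by auto
        then show ?thesis unfolding d by simp
      qed
    qed
    then have "(LINT t:{..<T}|lebesgue. deriv (\<phi> n) t *\<^sub>R g t)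
       = (\<integral>t. - ((k n * \<eta> (- k n * t + k n * c)) *\<^sub>R G t) \<partial>lebesgue)"
      unfolding set_lebesgue_integral_def by simp
    also have "\<dots> = (\<integral>t. - ((k n * \<eta> (- k n * t + k n * c)) *\<^sub>R G t) \<partial>lborel)"
      by (rule integral_completion) measurable
    also have "\<dots> = - (\<integral>t. (k n * \<eta> (- k n * t + k n * c)) *\<^sub>R G t \<partial>lborel)" by simp
    also have "(\<integral>t. (k n * \<eta> (- k n * t + k n * c)) *\<^sub>R G t \<partial>lborel)
      = \<bar>- (1 / k n)\<bar> *\<^sub>R (\<integral>x. (k n * \<eta> (- k n * (c + - (1 / k n) * x) + k n * c)) *\<^sub>R G (c + - (1 / k n) * x) \<partial>lborel)"
      using k[of n] by (intro lborel_integral_real_affine) auto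
    also have "\<dots> = (\<integral>x. \<eta> x *\<^sub>R G (c - x / k n) \<partial>lborel)"
    proof -
      have "- k n * (c + - (1 / k n) * x) + k n * c = x" for x using k[of n] by (simp add: field_simps)
      then have eq: "(k n * \<eta> (- k n * (c + - (1 / k n) * x) + k n * c)) *\<^sub>R G (c + - (1 / k n) * x) = k n *\<^sub>R (\<eta> x *\<^sub>R G (c - x / k n))" for x
        by simp
      show ?thesis unfolding eq integral_scaleR_right using k[of n] by simp
    qed
    finally show ?thesis .
  qed
  have inv_k: "(\<lambda>n. x / k n) \<longlonglongrightarrow> 0" for x
    unfolding k_def using LIMSEQ_Suc[OF lim_const_over_n[of x]] by simp
  have lim1: "(\<lambda>n. (\<integral>x. \<eta> x *\<^sub>R G (c - x / k n) \<partial>lborel)) \<longlonglongrightarrow> (\<integral>x. \<eta> x *\<^sub>R g c \<partial>lborel)"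
  proof (rule integral_dominated_convergence[where w="\<lambda>x. \<eta> x * \<bar>M\<bar>"])
    show "AE x in lborel. (\<lambda>n. \<eta> x *\<^sub>R G (c - x / k n)) \<longlonglongrightarrow> \<eta> x *\<^sub>R g c"
    proof (intro AE_I2)
      fix x
      show "(\<lambda>n. \<eta> x *\<^sub>R G (c - x / k n)) \<longlonglongrightarrow> \<eta> x *\<^sub>R g c"
      proof (cases "x \<in> {0..1}")
        case True
        have "\<forall>\<^sub>F n in sequentially. x / k n < c"
          using c by (intro order_tendstoD(2)[OF inv_k])
        then have ev: "\<forall>\<^sub>F n in sequentially. c - x / k n \<in> {0..c}"
          by eventually_elim (use True k in \<open>auto intro: divide_nonneg_pos\<close>)
        have "(\<lambda>n. c - x / k n) \<longlonglongrightarrow> c - 0" by (intro tendsto_intros inv_k)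
        then have "(\<lambda>n. g (c - x / k n)) \<longlonglongrightarrow> g c"
          using c ev by (intro continuous_on_tendsto_compose[OF g_cont]) auto
        then have "(\<lambda>n. G (c - x / k n)) \<longlonglongrightarrow> g c"
          by (rule Lim_transform_eventually) (use ev in \<open>eventually_elim, simp add: G_def\<close>)
        then show ?thesis by (intro tendsto_intros)
      qed (simp add: \<eta>_out)
    qed
    show "AE x in lborel. norm (\<eta> x *\<^sub>R G (c - x / k n)) \<le> \<eta> x * \<bar>M\<bar>" for n
      using \<eta>_nonneg GM by (intro AE_I2) (auto intro!: mult_mono)
  qed (use \<eta>_int in auto)
  have lim2: "(\<lambda>n. (LINT t:{0..<T}|lebesgue. \<phi> n t *\<^sub>R h t)) \<longlonglongrightarrow> (LINT t:{0..c}|lebesgue. h t)"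
    unfolding set_lebesgue_integral_def
  proof (rule integral_dominated_convergence[where w="\<lambda>t. norm (indicator {0..c} t *\<^sub>R h t)"])
    have hm: "(\<lambda>t. indicator {0..c} t *\<^sub>R h t) \<in> borel_measurable lebesgue"
      using h unfolding set_integrable_def by (rule borel_measurable_integrable)
    then show "(\<lambda>t. indicator {0..c} t *\<^sub>R h t) \<in> borel_measurable lebesgue" .
    have eq: "indicator {0..<T} t *\<^sub>R \<phi> n t *\<^sub>R h t = \<phi> n t *\<^sub>R (indicator {0..c} t *\<^sub>R h t)" for n t
      using c \<phi>_out[of t n] by (auto simp: indicator_def)
    have \<phi>m: "\<phi> n \<in> borel_measurable lebesgue" for n
      unfolding \<phi>_def by (rule measurable_completion) measurable
    show "(\<lambda>t. indicator {0..<T} t *\<^sub>R \<phi> n t *\<^sub>R h t) \<in> borel_measurable lebesgue" for n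
      unfolding eq by (intro borel_measurable_scaleR \<phi>m hm)
    show "integrable lebesgue (\<lambda>t. norm (indicator {0..c} t *\<^sub>R h t))"
      using h unfolding set_integrable_def by (rule integrable_norm)
    show "AE t in lebesgue. norm (indicator {0..<T} t *\<^sub>R \<phi> n t *\<^sub>R h t) \<le> norm (indicator {0..c} t *\<^sub>R h t)" for n
    proof (intro AE_I2)
      fix t
      have "\<bar>\<phi> n t\<bar> \<le> 1" using S01 by (simp add: \<phi>_def abs_mult mult_le_one)
      then show "norm (indicator {0..<T} t *\<^sub>R \<phi> n t *\<^sub>R h t) \<le> norm (indicator {0..c} t *\<^sub>R h t)"
        unfolding eq norm_scaleR[of "\<phi> n t"] by (rule mult_left_le_one_le[OF norm_ge_zero abs_ge_zero])
    qed
    have "AE t in lebesgue. t \<noteq> c" by (rule AE_completion) (rule AE_lborel_singleton)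
    then show "AE t in lebesgue. (\<lambda>n. indicator {0..<T} t *\<^sub>R \<phi> n t *\<^sub>R h t) \<longlonglongrightarrow> indicator {0..c} t *\<^sub>R h t"
    proof eventually_elim
      case (elim t)
      show ?case
      proof (cases "0 \<le> t \<and> t < c")
        case True
        have "\<forall>\<^sub>F n in sequentially. 1 / k n < c - t"
          using True by (intro order_tendstoD(2)[OF inv_k]) auto
        then have "\<forall>\<^sub>F n in sequentially. \<phi> n t = 1"
        proof eventually_elim
          case (elim n)
          then have "1 < (c - t) * k n" using k[of n] by (simp add: field_simps)
          then have "S (- k n * t + k n * c) = 1" by (intro S1) (simp add: algebra_simps)
          then show ?case using True S1[of "1 * t + 2"] by (simp add: \<phi>_def)
        qed
        then have "\<forall>\<^sub>F n in sequentially. indicator {0..<T} t *\<^sub>R \<phi> n t *\<^sub>R h t = indicator {0..c} t *\<^sub>R h t"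
          by eventually_elim (use True c in \<open>auto simp: indicator_def\<close>)
        then show ?thesis by (rule tendsto_eventually)
      next
        case False
        then have "t \<notin> {0..c}" using elim by auto
        then show ?thesis unfolding eq by simp
      qed
    qed
  qed
  have "(\<lambda>n. - (\<integral>x. \<eta> x *\<^sub>R G (c - x / k n) \<partial>lborel)) \<longlonglongrightarrow> - (LINT t:{0..c}|lebesgue. h t)"
    using tendsto_minus[OF lim2] weak[OF test] lhs by simp
  moreover have "(\<lambda>n. - (\<integral>x. \<eta> x *\<^sub>R G (c - x / k n) \<partial>lborel)) \<longlonglongrightarrow> - g c"
    using tendsto_minus[OF lim1] \<eta>_int \<eta>_one by simp
  ultimately show ?thesis using LIMSEQ_unique by fastforce
qed

lemma rl_eq_0:
  assumes "\<And>s. s < 0 \<Longrightarrow> v s = 0" "t \<le> 0"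
  shows "rl a v t = 0"
proof -
  have "pker a (t - s) *\<^sub>R v s = 0" for s using assms by (cases "s < 0") auto
  note eq = this
  show ?thesis unfolding rl_def eq by simp
qed

lemma fint_finite_of_integrable:
  fixes D :: "real \<Rightarrow> 'h::{banach, second_countable_topology}"
  assumes a: "1 \<le> a" and D: "integrable lborel D" and D0: "\<And>s. s < 0 \<Longrightarrow> D s = 0"
  shows "fint a (\<lambda>s. ennreal (norm (D s))) t < \<infinity>"
proof -
  have [measurable]: "D \<in> borel_measurable borel" using D by (auto dest: borel_measurable_integrable)
  have "fint a (\<lambda>s. ennreal (norm (D s))) t \<le> ennreal (max 0 t powr (a - 1)) * (\<integral>\<^sup>+s. ennreal (norm (D s)) \<partial>lborel)"
    using a D0 by (intro fint_ge_1_le) auto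
  also have "\<dots> < \<infinity>" using D by (simp add: integrable_iff_bounded ennreal_mult_less_top)
  finally show ?thesis .
qed

lemma caputo_primitive_eq_rl:
  fixes u :: "real \<Rightarrow> 'h::{banach, second_countable_topology}"
  assumes [measurable]: "v \<in> borel_measurable borel" and v: "\<And>s. s \<in> {0..T} \<Longrightarrow> v s = u s - u0"
    "\<And>s. s < 0 \<Longrightarrow> v s = 0" and t: "t \<le> T"
  shows "caputo_primitive \<alpha> u u0 t = (1 / Gamma (1 - \<alpha>)) *\<^sub>R rl (1 - \<alpha>) v t"
proof (cases "t < 0")
  case True
  then show ?thesis using rl_eq_0[of v t "1 - \<alpha>"] v by (simp add: caputo_primitive_def)
next
  case False
  have eq: "indicator {0..t} s *\<^sub>R (t - s) powr (- \<alpha>) *\<^sub>R (u s - u0) = pker (1 - \<alpha>) (t - s) *\<^sub>R v s" for s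
    using v t by (cases "s < 0") (auto simp: indicator_def pker_def)
  show ?thesis
    using False unfolding caputo_primitive_def set_lebesgue_integral_def eq rl_def
    by (subst integral_completion) auto
qed

lemma pker_1: "pker 1 (t - s) = indicator {..<t} s"
  by (simp add: pker_def indicator_def)

text \<open>Testing the distributional identity gives \<open>rl 1 D\<close> as the Caputo primitive.
  Applying the integral of order \<alpha> to both sides turns the left one into a multiple of
  \<open>rl 1 v\<close>; the right one is the order-one integral of \<open>rl \<alpha> D\<close> by
  commutation. Equal primitives then force equality almost everywhere.\<close>

lemma caputo_representation:
  fixes u Du :: "real \<Rightarrow> 'h::{banach, second_countable_topology}"
  assumes T: "0 < T" and \<alpha>: "0 < \<alpha>" "\<alpha> < 1" and u_cont: "continuous_on {0..T} u"
    and cap: "has_caputo_derivative \<alpha> T u u0 Du"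
    and D: "integrable lborel D" and D_eq: "AE t in lborel. t \<in> {0..T} \<longrightarrow> D t = Du t"
    and D0: "\<And>t. t < 0 \<Longrightarrow> D t = 0"
  shows "AE t in lborel. t \<in> {0..T} \<longrightarrow> u t = u0 + (1 / Gamma \<alpha>) *\<^sub>R rl \<alpha> D t"
proof -
  have [measurable]: "D \<in> borel_measurable borel" using D by (auto dest: borel_measurable_integrable)
  define v where "v s = indicator {0..T} s *\<^sub>R (u s - u0)" for s
  have [measurable]: "v \<in> borel_measurable borel"
    unfolding v_def[abs_def] using u_cont by (intro borel_measurable_continuous_on_indicator continuous_intros) auto
  have "compact ((\<lambda>s. u s - u0) ` {0..T})" using u_cont by (intro compact_continuous_image continuous_intros) auto
  then obtain M where "\<And>t. t \<in> {0..T} \<Longrightarrow> norm (u t - u0) \<le> M"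
    by (metis (no_types, lifting) compact_imp_bounded bounded_iff image_eqI)
  then have M: "norm (v s) \<le> \<bar>M\<bar>" for s by (fastforce simp: v_def indicator_def)
  have v0: "v s = 0" if "s < 0" for s using that by (simp add: v_def)
  have v_int: "integrable lborel v"
  proof (rule Bochner_Integration.integrable_bound)
    show "integrable lborel (\<lambda>s. indicator {0..T} s *\<^sub>R \<bar>M\<bar>)" using T by (intro integrable_scaleR_left integrable_real_indicator) auto
    show "AE s in lborel. norm (v s) \<le> norm (indicator {0..T} s *\<^sub>R \<bar>M\<bar>)"
    proof (intro AE_I2)
      fix s
      show "norm (v s) \<le> norm (indicator {0..T} s *\<^sub>R \<bar>M\<bar>)"
        using M[of s] by (cases "s \<in> {0..T}") (auto simp: v_def)
    qed
  qed measurable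
  define c1 where "c1 = 1 / Gamma (1 - \<alpha>)"
  have prim: "c1 *\<^sub>R rl (1 - \<alpha>) v c = rl 1 D c" if "c < T" for c
  proof (cases "0 < c")
    case False
    then show ?thesis using rl_eq_0[of v c] rl_eq_0[of D c] v0 D0 by simp
  next
    case True
    have "caputo_primitive \<alpha> u u0 c = (LINT t:{0..c}|lebesgue. Du t)"
    proof (rule weak_derivative_integral[OF True that])
      have "continuous_on {0..c} (\<lambda>t. c1 *\<^sub>R rl (1 - \<alpha>) v t)"
        using \<alpha> by (intro continuous_intros continuous_on_subset[OF continuous_on_rl[OF _ _ _ M v0]]) auto
      then show "continuous_on {0..c} (caputo_primitive \<alpha> u u0)"
        using that by (subst continuous_on_cong[OF refl caputo_primitive_eq_rl[of v T]]) (auto simp: v_def c1_def)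
      show "caputo_primitive \<alpha> u u0 t = 0" if "t < 0" for t using that by (simp add: caputo_primitive_def)
      show "set_integrable lebesgue {0..c} Du"
        using cap True that unfolding has_caputo_derivative_def by simp
    qed (use cap in \<open>auto simp: has_caputo_derivative_def\<close>)
    moreover have "(LINT t:{0..c}|lebesgue. Du t) = rl 1 D c"
    proof -
      have "(LINT t:{0..c}|lebesgue. Du t) = (\<integral>s. pker 1 (c - s) *\<^sub>R D s \<partial>lebesgue)"
        unfolding set_lebesgue_integral_def
      proof (rule integral_cong_AE)
        have "set_integrable lebesgue {0..c} Du"
          using cap True that unfolding has_caputo_derivative_def by simp
        then show "(\<lambda>s. indicator {0..c} s *\<^sub>R Du s) \<in> borel_measurable lebesgue"
          unfolding set_integrable_def by (rule borel_measurable_integrable)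
        show "(\<lambda>s. pker 1 (c - s) *\<^sub>R D s) \<in> borel_measurable lebesgue"
          by (rule measurable_completion) measurable
        have "AE s in lborel. indicator {0..c} s *\<^sub>R Du s = pker 1 (c - s) *\<^sub>R D s"
          using D_eq AE_lborel_singleton[of c]
        proof eventually_elim
          case (elim s)
          then show ?case using that D0[of s] by (cases "s < 0") (auto simp: pker_1 indicator_def)
        qed
        then show "AE s in lebesgue. indicator {0..c} s *\<^sub>R Du s = pker 1 (c - s) *\<^sub>R D s"
          by (rule AE_completion)
      qed
      also have "\<dots> = rl 1 D c" unfolding rl_def by (rule integral_completion) measurable
      finally show ?thesis .
    qed
    ultimately show ?thesis using caputo_primitive_eq_rl[of v T u u0 c \<alpha>] that v0 by (simp add: v_def c1_def)
  qed
  have fin_v: "fint a (\<lambda>s. ennreal (norm (v s))) t < \<infinity>" and fin_D: "fint a (\<lambda>s. ennreal (norm (D s))) t < \<infinity>" if "1 \<le> a" for a t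
    using fint_finite_of_integrable[OF that v_int v0] fint_finite_of_integrable[OF that D D0] by auto
  have G: "0 < Gamma \<alpha>" "0 < Gamma (1 - \<alpha>)" using \<alpha> by auto
  \<comment> \<open>The constant is \<open>Beta \<alpha> (1 - \<alpha>) / Gamma (1 - \<alpha>) =
    Gamma \<alpha>\<close>, and symmetry of the Beta function interchanges the orders \<alpha> and
    1.\<close>
  have key: "Gamma \<alpha> *\<^sub>R rl 1 v t = rl 1 (rl \<alpha> D) t" if "t < T" for t
  proof -
    have "rl \<alpha> (\<lambda>c. c1 *\<^sub>R rl (1 - \<alpha>) v c) t = rl \<alpha> (rl 1 D) t"
      unfolding rl_def[of \<alpha>]
    proof (rule Bochner_Integration.integral_cong[OF refl])
      fix s show "pker \<alpha> (t - s) *\<^sub>R c1 *\<^sub>R rl (1 - \<alpha>) v s = pker \<alpha> (t - s) *\<^sub>R rl 1 D s"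
        using prim[of s] that by (cases "s < t") auto
    qed
    moreover have "rl \<alpha> (\<lambda>c. c1 *\<^sub>R rl (1 - \<alpha>) v c) t = c1 *\<^sub>R rl \<alpha> (rl (1 - \<alpha>) v) t"
      unfolding rl_def[of \<alpha>] scaleR_left_commute[of _ c1] by (rule integral_scaleR_right)
    moreover have "rl \<alpha> (rl (1 - \<alpha>) v) t = Beta \<alpha> (1 - \<alpha>) *\<^sub>R rl (\<alpha> + (1 - \<alpha>)) v t"
      using \<alpha> fin_v by (intro rl_rl) auto
    moreover have "rl \<alpha> (rl 1 D) t = Beta \<alpha> 1 *\<^sub>R rl (\<alpha> + 1) D t"
      using \<alpha> fin_D by (intro rl_rl) auto
    moreover have "rl 1 (rl \<alpha> D) t = Beta 1 \<alpha> *\<^sub>R rl (1 + \<alpha>) D t"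
      using \<alpha> fin_D by (intro rl_rl) auto
    moreover have "c1 * Beta \<alpha> (1 - \<alpha>) = Gamma \<alpha>"
      using G by (simp add: c1_def Beta_def)
    ultimately show ?thesis by (simp add: Beta_commute[of 1] add.commute)
  qed
  have rlD_int: "integrable lborel (\<lambda>s. pker 1 (T - s) *\<^sub>R rl \<alpha> D s)"
  proof (rule rl_integrable)
    have "fint 1 (\<lambda>s. ennreal (norm (rl \<alpha> D s))) T \<le> fint 1 (fint \<alpha> (\<lambda>s. ennreal (norm (D s)))) T"
      unfolding fint_def[of 1] by (intro nn_integral_mono mult_left_mono norm_rl_le) auto
    also have "\<dots> = ennreal (Beta 1 \<alpha>) * fint (1 + \<alpha>) (\<lambda>s. ennreal (norm (D s))) T"
      using \<alpha> by (intro fint_fint) auto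
    also have "\<dots> < \<infinity>" using fin_D[of "1 + \<alpha>" T] \<alpha> by (simp add: ennreal_mult_less_top)
    finally show "fint 1 (\<lambda>s. ennreal (norm (rl \<alpha> D s))) T < \<infinity>" .
  qed measurable
  have pv_int: "integrable lborel (\<lambda>s. pker 1 (t - s) *\<^sub>R v s)" for t
    using fin_v[of 1 t] by (intro rl_integrable) auto
  \<comment> \<open>The factor \<open>pker 1 (T - s)\<close> is the indicator of s < T: it makes
    \<open>w\<close> vanish from T on and \<open>rl \<alpha> D\<close> integrable.\<close>
  define w where "w s = Gamma \<alpha> *\<^sub>R (pker 1 (T - s) *\<^sub>R v s) - pker 1 (T - s) *\<^sub>R rl \<alpha> D s" for s
  have "AE s in lborel. w s = 0"
  proof (rule AE_zero_of_primitive_zero)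
    show "integrable lborel w" unfolding w_def by (intro Bochner_Integration.integrable_diff integrable_scaleR_right pv_int rlD_int)
    show "w s = 0" if "T \<le> s" for s using that by (simp add: w_def)
    show "rl 1 w t = 0" if "t < T" for t
    proof -
      have eq: "pker 1 (t - s) *\<^sub>R w s = Gamma \<alpha> *\<^sub>R (pker 1 (t - s) *\<^sub>R v s) - pker 1 (t - s) *\<^sub>R (pker 1 (T - s) *\<^sub>R rl \<alpha> D s)" for s
        using that by (auto simp: w_def pker_1 indicator_def)
      have i2: "integrable lborel (\<lambda>s. pker 1 (t - s) *\<^sub>R (pker 1 (T - s) *\<^sub>R rl \<alpha> D s))"
        unfolding pker_1[of t] by (intro integrable_mult_indicator rlD_int) auto
      have "rl 1 w t = Gamma \<alpha> *\<^sub>R rl 1 v t - (\<integral>s. pker 1 (t - s) *\<^sub>R (pker 1 (T - s) *\<^sub>R rl \<alpha> D s) \<partial>lborel)"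
        unfolding rl_def[of 1] eq
        by (subst Bochner_Integration.integral_diff)
           (simp_all only: integrable_scaleR_right[OF pv_int] i2 integral_scaleR_right)
      also have "(\<integral>s. pker 1 (t - s) *\<^sub>R (pker 1 (T - s) *\<^sub>R rl \<alpha> D s) \<partial>lborel) = rl 1 (rl \<alpha> D) t"
        unfolding rl_def[of 1] using that
        by (intro Bochner_Integration.integral_cong) (auto simp: pker_1 indicator_def)
      finally show ?thesis using key[OF that] by simp
    qed
  qed
  then show ?thesis using AE_lborel_singleton[of T]
  proof eventually_elim
    case (elim s)
    show ?case
    proof
      assume s: "s \<in> {0..T}"
      then have "Gamma \<alpha> *\<^sub>R (u s - u0) = rl \<alpha> D s"
        using elim by (simp add: w_def pker_1 v_def)
      then have "(1 / Gamma \<alpha>) *\<^sub>R rl \<alpha> D s = (1 / Gamma \<alpha> * Gamma \<alpha>) *\<^sub>R (u s - u0)"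
        by (metis scaleR_scaleR)
      then have "(1 / Gamma \<alpha>) *\<^sub>R rl \<alpha> D s = u s - u0" using G(1) by simp
      then show "u s = u0 + (1 / Gamma \<alpha>) *\<^sub>R rl \<alpha> D s" by simp
    qed
  qed
qed

section \<open>The discrete Caputo derivative\<close>

text \<open>Row n of the equation A B = I solved for the entry of B, given the earlier rows. The sum
  starts at 1 because matrix indices do.\<close>

function forward_subst :: "(nat \<Rightarrow> nat \<Rightarrow> real) \<Rightarrow> nat \<Rightarrow> nat \<Rightarrow> real" where
  "forward_subst A n i = ((if n = i then 1 else 0) - (\<Sum>j\<in>{1..<n}. A n j * forward_subst A j i)) / A n n"
  by pat_completeness auto
termination by (relation "Wellfounded.measure (\<lambda>(A, n, i). n)") auto

declare forward_subst.simps [simp del]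

definition mat_mult :: "nat \<Rightarrow> (nat \<Rightarrow> nat \<Rightarrow> real) \<Rightarrow> (nat \<Rightarrow> nat \<Rightarrow> real) \<Rightarrow> nat \<Rightarrow> nat \<Rightarrow> real" where
  "mat_mult N A B n i = (\<Sum>j=1..N. A n j * B j i)"

lemma mat_mult_assoc: "mat_mult N (mat_mult N A B) C n i = mat_mult N A (mat_mult N B C) n i"
proof -
  have "mat_mult N (mat_mult N A B) C n i = (\<Sum>j=1..N. \<Sum>k=1..N. A n k * B k j * C j i)"
    by (simp add: mat_mult_def sum_distrib_right)
  also have "\<dots> = (\<Sum>k=1..N. \<Sum>j=1..N. A n k * B k j * C j i)" by (rule sum.swap)
  finally show ?thesis by (simp add: mat_mult_def sum_distrib_left mult.assoc)
qed

lemma forward_subst_lower: "n < i \<Longrightarrow> forward_subst A n i = 0"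
proof (induction n rule: less_induct)
  case (less n)
  then have "(\<Sum>j\<in>{1..<n}. A n j * forward_subst A j i) = 0" by (intro sum.neutral) auto
  then show ?case using less by (simp add: forward_subst.simps[of A n])
qed

lemma forward_subst_diag: "forward_subst A n n = 1 / A n n"
proof -
  have "(\<Sum>j\<in>{1..<n}. A n j * forward_subst A j n) = 0"
    by (intro sum.neutral) (auto simp: forward_subst_lower)
  then show ?thesis by (simp add: forward_subst.simps[of A n])
qed

lemma lower_triangular_right_inverse:
  assumes low: "\<And>n i. n < i \<Longrightarrow> A n i = 0" and diag: "\<And>n. n \<in> {1..N} \<Longrightarrow> A n n \<noteq> 0"
    and n: "n \<in> {1..N}"
  shows "mat_mult N A (forward_subst A) n i = (if n = i then 1 else 0)"
proof -
  have "mat_mult N A (forward_subst A) n i = (\<Sum>j\<in>{1..n}. A n j * forward_subst A j i)"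
    unfolding mat_mult_def using n low by (intro sum.mono_neutral_right) (auto simp: not_le)
  also have "{1..n} = insert n {1..<n}" using n by auto
  also have "(\<Sum>j\<in>insert n {1..<n}. A n j * forward_subst A j i) = (if n = i then 1 else 0)"
    using diag[OF n] by (simp add: forward_subst.simps[of A n i])
  finally show ?thesis .
qed

text \<open>A right inverse \<open>B\<close> of \<open>A\<close> that is lower triangular has a right inverse \<open>C\<close> itself, so
  \<open>B A = B A (B C) = B (A B) C = B C\<close> is the identity.\<close>

lemma inverse_matrix_lower_triangular:
  assumes low: "\<And>n i. n < i \<Longrightarrow> A n i = 0" and diag: "\<And>n. n \<in> {1..N} \<Longrightarrow> A n n \<noteq> 0"
  shows "inverse_matrix N A = (\<lambda>n i. if n \<in> {1..N} \<and> i \<in> {1..N} then forward_subst A n i else 0)"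
proof -
  let ?B = "forward_subst A"
  let ?Z = "\<lambda>n i. if n \<in> {1..N} \<and> i \<in> {1..N} then ?B n i else 0"
  let ?C = "forward_subst ?B"
  let ?I = "\<lambda>n i :: nat. if n = i then 1 else (0 :: real)"
  have AB: "mat_mult N A ?B n i = ?I n i" if "n \<in> {1..N}" for n i
    using low diag that by (rule lower_triangular_right_inverse)
  have BC: "mat_mult N ?B ?C n i = ?I n i" if "n \<in> {1..N}" for n i
    using that diag by (intro lower_triangular_right_inverse) (auto simp: forward_subst_lower forward_subst_diag)
  have right_I: "mat_mult N X ?I n i = X n i" if "i \<in> {1..N}" for X n i
    using that by (simp add: mat_mult_def if_distrib sum.delta cong: if_cong)
  have left_I: "mat_mult N ?I X n i = X n i" if "n \<in> {1..N}" for X n i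
  proof -
    have "mat_mult N ?I X n i = (\<Sum>j=1..N. if n = j then X j i else 0)"
      unfolding mat_mult_def by (intro sum.cong) auto
    then show ?thesis using that by simp
  qed
  have cong: "mat_mult N X Y n i = mat_mult N X' Y' n i"
    if "\<And>j. j \<in> {1..N} \<Longrightarrow> X n j = X' n j" "\<And>j. j \<in> {1..N} \<Longrightarrow> Y j i = Y' j i" for X Y X' Y' n i
    unfolding mat_mult_def using that by (intro sum.cong) auto
  have BA: "mat_mult N ?B A n i = ?I n i" if ni: "n \<in> {1..N}" "i \<in> {1..N}" for n i
  proof -
    have "mat_mult N ?B A n i = mat_mult N (mat_mult N ?B A) ?I n i"
      using right_I[OF ni(2)] by simp
    also have "\<dots> = mat_mult N (mat_mult N ?B A) (mat_mult N ?B ?C) n i"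
      using BC by (intro cong) auto
    also have "\<dots> = mat_mult N ?B (mat_mult N A (mat_mult N ?B ?C)) n i" by (rule mat_mult_assoc)
    also have "\<dots> = mat_mult N ?B (mat_mult N (mat_mult N A ?B) ?C) n i"
      by (rule cong) (simp_all add: mat_mult_assoc)
    also have "\<dots> = mat_mult N ?B (mat_mult N ?I ?C) n i"
      using AB by (intro cong) auto
    also have "\<dots> = mat_mult N ?B ?C n i" by (rule cong) (simp_all add: left_I)
    finally show ?thesis using BC ni by simp
  qed
  show ?thesis unfolding inverse_matrix_def
  proof (rule the_equality)
    have "mat_mult N A ?Z n i = ?I n i \<and> mat_mult N ?Z A n i = ?I n i" if "n \<in> {1..N}" "i \<in> {1..N}" for n i
      using AB[of n i] BA[of n i] that cong[of A n A ?Z i ?B] cong[of ?Z n ?B A i A] by simp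
    then show "(\<forall>n i. n \<notin> {1..N} \<or> i \<notin> {1..N} \<longrightarrow> ?Z n i = 0) \<and>
      (\<forall>n\<in>{1..N}. \<forall>i\<in>{1..N}. (\<Sum>j=1..N. A n j * ?Z j i) = (if n = i then 1 else 0) \<and>
        (\<Sum>j=1..N. ?Z n j * A j i) = (if n = i then 1 else 0))"
      unfolding mat_mult_def by auto
  next
    fix B'
    assume B': "(\<forall>n i. n \<notin> {1..N} \<or> i \<notin> {1..N} \<longrightarrow> B' n i = 0) \<and>
      (\<forall>n\<in>{1..N}. \<forall>i\<in>{1..N}. (\<Sum>j=1..N. A n j * B' j i) = (if n = i then 1 else 0) \<and>
        (\<Sum>j=1..N. B' n j * A j i) = (if n = i then 1 else 0))"
    show "B' = ?Z"
    proof (intro ext)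
      fix n i
      show "B' n i = ?Z n i"
      proof (cases "n \<in> {1..N} \<and> i \<in> {1..N}")
        case True
        have "B' n i = mat_mult N B' ?I n i" using True right_I by simp
        also have "\<dots> = mat_mult N B' (mat_mult N A ?B) n i" using AB by (intro cong) auto
        also have "\<dots> = mat_mult N (mat_mult N B' A) ?B n i" by (simp add: mat_mult_assoc)
        also have "\<dots> = mat_mult N ?I ?B n i" using B' True by (intro cong) (auto simp: mat_mult_def)
        also have "\<dots> = ?B n i" using True left_I by simp
        finally show ?thesis using True by simp
      next
        case False
        then show ?thesis using B' by auto
      qed
    qed
  qed
qed

text \<open>The entry of \<open>K_matrix\<close> with the node replaced by an arbitrary time:
  \<open>1 / Gamma a\<close> times the kernel mass of cell j seen from t. The \<open>max 0\<close>
  allows t before or inside the cell.\<close>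

definition cker :: "real \<Rightarrow> (nat \<Rightarrow> real) \<Rightarrow> nat \<Rightarrow> real \<Rightarrow> real" where
  "cker a tt j t = (max 0 (t - tt (j - 1)) powr a - max 0 (t - tt j) powr a) / Gamma (a + 1)"

section \<open>Partitions and the convolution form of the discrete derivative\<close>

lemma partition_mono:
  assumes "is_partition T N tt" "i \<le> j" "j \<le> N"
  shows "tt i \<le> tt j"
  using assms(2,3)
proof (induction j rule: dec_induct)
  case (step n)
  have "tt n \<le> tt (Suc n)" using assms(1) step by (auto simp: is_partition_def intro!: less_imp_le)
  moreover have "tt i \<le> tt n" using step by simp
  ultimately show ?case by simp
qed simp

lemma partition_strict_mono:
  assumes P: "is_partition T N tt" and "i < j" "j \<le> N"
  shows "tt i < tt j"
proof -
  have "tt i < tt (Suc i)" using assms by (auto simp: is_partition_def)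
  also have "\<dots> \<le> tt j" using assms by (intro partition_mono[OF P]) auto
  finally show ?thesis .
qed

lemma partition_bounds:
  assumes P: "is_partition T N tt" and "n \<le> N"
  shows "0 \<le> tt n" "tt n \<le> T"
  using partition_mono[OF P, of 0 n] partition_mono[OF P, of n N] assms by (auto simp: is_partition_def)

lemma K_matrix_eq_cker:
  assumes P: "is_partition T N tt" and "1 \<le> j" "j \<le> n" "n \<le> N"
  shows "K_matrix \<alpha> tt n j = cker \<alpha> tt j (tt n)"
  using partition_mono[OF P, of j n] partition_mono[OF P, of "j - 1" n] assms
  by (simp add: K_matrix_def cker_def)

text \<open>Applying K to the product of its inverse with W - W 0 gives back W - W 0. Later
  arguments use this convolution relation only, never the inverse matrix.\<close>

lemma sum_K_matrix_discrete_caputo: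
  fixes W :: "nat \<Rightarrow> 'h::real_vector"
  assumes P: "is_partition T N tt" and a: "0 < \<alpha>" and n: "n \<le> N"
  shows "W n = W 0 + (\<Sum>j=1..n. cker \<alpha> tt j (tt n) *\<^sub>R discrete_caputo \<alpha> N tt W j)"
proof (cases "n = 0")
  case False
  define A where "A = K_matrix \<alpha> tt"
  have low: "A m i = 0" if "m < i" for m i using that by (simp add: A_def K_matrix_def)
  have diag: "A m m \<noteq> 0" if "m \<in> {1..N}" for m
    using that partition_strict_mono[OF P, of "m - 1" m] a by (auto simp: A_def K_matrix_def Gamma_eq_zero_iff)
  have nn: "n \<in> {1..N}" using False n by auto
  define X where "X i = W i - W 0" for i
  have inv: "inverse_matrix N A = (\<lambda>n i. if n \<in> {1..N} \<and> i \<in> {1..N} then forward_subst A n i else 0)"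
    by (rule inverse_matrix_lower_triangular) (use low diag in auto)
  have dc: "discrete_caputo \<alpha> N tt W j = (\<Sum>i=1..N. forward_subst A j i *\<^sub>R X i)" if "j \<in> {1..N}" for j
  proof -
    have "discrete_caputo \<alpha> N tt W j = (\<Sum>i=1..j. forward_subst A j i *\<^sub>R X i)"
      unfolding discrete_caputo_def A_def[symmetric] inv
      using that by (intro sum.cong) (auto simp: X_def)
    also have "\<dots> = (\<Sum>i=1..N. forward_subst A j i *\<^sub>R X i)"
      using that by (intro sum.mono_neutral_left) (auto simp: forward_subst_lower)
    finally show ?thesis .
  qed
  have "(\<Sum>j=1..n. cker \<alpha> tt j (tt n) *\<^sub>R discrete_caputo \<alpha> N tt W j) = (\<Sum>j=1..n. A n j *\<^sub>R discrete_caputo \<alpha> N tt W j)"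
    using n by (intro sum.cong) (auto simp: A_def K_matrix_eq_cker[OF P])
  also have "\<dots> = (\<Sum>j=1..N. A n j *\<^sub>R discrete_caputo \<alpha> N tt W j)"
    using n by (intro sum.mono_neutral_left) (auto simp: low)
  also have "\<dots> = (\<Sum>j=1..N. \<Sum>i=1..N. (A n j * forward_subst A j i) *\<^sub>R X i)"
    by (intro sum.cong) (auto simp: dc scaleR_sum_right)
  also have "\<dots> = (\<Sum>i=1..N. mat_mult N A (forward_subst A) n i *\<^sub>R X i)"
    by (subst sum.swap) (simp add: mat_mult_def scaleR_sum_left)
  also have "\<dots> = (\<Sum>i=1..N. (if n = i then X i else 0))"
  proof (intro sum.cong refl)
    fix i
    have "mat_mult N A (forward_subst A) n i = (if n = i then 1 else 0)"
      by (rule lower_triangular_right_inverse) (use low diag nn in auto)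
    then show "mat_mult N A (forward_subst A) n i *\<^sub>R X i = (if n = i then X i else 0)" by simp
  qed
  also have "\<dots> = X n" using nn by simp
  finally show ?thesis by (simp add: X_def)
qed simp

section \<open>Discrete chain inequality and stability\<close>

lemma nn_integral_cell_pker:
  assumes "is_partition T N tt" "0 < a" "1 \<le> j" "j \<le> N"
  shows "(\<integral>\<^sup>+s\<in>{tt (j - 1)..tt j}. ennreal (pker a (t - s)) \<partial>lborel) = ennreal (Gamma a * cker a tt j t)"
proof -
  have "Gamma (a + 1) = a * Gamma a" using assms(2) by (subst Gamma_plus1) (auto elim!: nonpos_Ints_cases)
  moreover have "Gamma a \<noteq> 0" using assms(2) Gamma_real_pos[of a] by linarith
  ultimately have "Gamma a * cker a tt j t = (max 0 (t - tt (j - 1)) powr a - max 0 (t - tt j) powr a) / a"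
    using assms(2) by (simp add: cker_def)
  then show ?thesis
    using partition_mono[OF assms(1), of "j - 1" j] assms by (simp add: nn_integral_pker)
qed

lemma cker_nonneg:
  assumes P: "is_partition T N tt" and a: "0 < a" and j: "1 \<le> j" "j \<le> N"
  shows "0 \<le> cker a tt j t"
proof -
  have "max 0 (t - tt j) powr a \<le> max 0 (t - tt (j - 1)) powr a"
    using partition_mono[OF P, of "j - 1" j] a j by (intro powr_mono2) auto
  then show ?thesis using a by (simp add: cker_def)
qed

lemma cker_pos:
  assumes P: "is_partition T N tt" and a: "0 < a" and j: "1 \<le> j" "j \<le> N" and t: "tt j \<le> t"
  shows "0 < cker a tt j t"
proof -
  have "tt (j - 1) < tt j" using partition_strict_mono[OF P, of "j - 1" j] j by simp
  then have "max 0 (t - tt j) powr a < max 0 (t - tt (j - 1)) powr a"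
    using a t by (intro powr_less_mono2) auto
  then show ?thesis using a by (simp add: cker_def)
qed

lemma cker_antimono:
  assumes P: "is_partition T N tt" and a: "0 < a" "a \<le> 1" and j: "1 \<le> j" "j \<le> N" and t: "tt j \<le> t" "t \<le> t'"
  shows "cker a tt j t' \<le> cker a tt j t"
proof -
  have "ennreal (Gamma a * cker a tt j t') \<le> ennreal (Gamma a * cker a tt j t)"
    unfolding nn_integral_cell_pker[OF P a(1) j, symmetric]
  proof (rule nn_integral_mono_AE)
    show "AE s in lborel. ennreal (pker a (t' - s)) * indicator {tt (j - 1)..tt j} s
        \<le> ennreal (pker a (t - s)) * indicator {tt (j - 1)..tt j} s"
      using AE_lborel_singleton[of "tt j"]
    proof eventually_elim
      case (elim s)
      then show ?case using t a by (auto simp: indicator_def intro!: ennreal_leI pker_antimono)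
    qed
  qed
  then show ?thesis using a cker_nonneg[OF P a(1) j] by simp
qed

text \<open>The products satisfy (t - s)(t' - s') - (t' - s)(t - s') = (s' - s)(t' - t) >= 0, and
  the exponent a - 1 <= 0 reverses the order.\<close>

lemma pker_ratio_mono:
  assumes a: "a \<le> 1" and s: "s \<le> s'" "s' < t" "t \<le> t'"
  shows "pker a (t - s) * pker a (t' - s') \<le> pker a (t' - s) * pker a (t - s')"
proof -
  have "(t' - s) * (t - s') \<le> (t - s) * (t' - s')"
    using mult_right_mono[of s s' "t' - t"] s by (simp add: algebra_simps)
  then have "((t - s) * (t' - s')) powr (a - 1) \<le> ((t' - s) * (t - s')) powr (a - 1)"
    using a s by (intro powr_mono2') auto
  then show ?thesis using s by (simp add: pker_def powr_mult)
qed

text \<open>\<open>pker_ratio_mono\<close> integrated over the product of two adjacent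
  cells.\<close>

lemma cker_ratio_mono:
  assumes P: "is_partition T N tt" and a: "0 < a" "a \<le> 1" and j: "1 \<le> j" "Suc j \<le> N"
    and t: "tt (Suc j) \<le> t" "t \<le> t'"
  shows "cker a tt j t * cker a tt (Suc j) t' \<le> cker a tt j t' * cker a tt (Suc j) t"
proof -
  have prod: "ennreal (Gamma a * cker a tt j x) * ennreal (Gamma a * cker a tt (Suc j) y)
    = (\<integral>\<^sup>+s. \<integral>\<^sup>+s'. ennreal (pker a (x - s) * pker a (y - s')) * indicator {tt (j - 1)..tt j} s * indicator {tt j..tt (Suc j)} s' \<partial>lborel \<partial>lborel)"
    (is "_ = ?I x y") for x y
  proof -
    have "?I x y = (\<integral>\<^sup>+s. (ennreal (pker a (x - s)) * indicator {tt (j - 1)..tt j} s) *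
        (\<integral>\<^sup>+s'. ennreal (pker a (y - s')) * indicator {tt j..tt (Suc j)} s' \<partial>lborel) \<partial>lborel)"
      by (intro nn_integral_cong) (simp add: nn_integral_cmult[symmetric] ennreal_mult mult_ac)
    also have "\<dots> = (\<integral>\<^sup>+s\<in>{tt (j - 1)..tt j}. ennreal (pker a (x - s)) \<partial>lborel) *
        (\<integral>\<^sup>+s'\<in>{tt j..tt (Suc j)}. ennreal (pker a (y - s')) \<partial>lborel)"
      by (rule nn_integral_multc) measurable
    finally show ?thesis
      using nn_integral_cell_pker[OF P a(1), of j x] nn_integral_cell_pker[OF P a(1), of "Suc j" y] j by simp
  qed
  have "ennreal (Gamma a * cker a tt j t) * ennreal (Gamma a * cker a tt (Suc j) t')
      \<le> ennreal (Gamma a * cker a tt j t') * ennreal (Gamma a * cker a tt (Suc j) t)"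
    unfolding prod
  proof (rule nn_integral_mono, rule nn_integral_mono_AE)
    fix s
    show "AE s' in lborel. ennreal (pker a (t - s) * pker a (t' - s')) * indicator {tt (j - 1)..tt j} s * indicator {tt j..tt (Suc j)} s'
      \<le> ennreal (pker a (t' - s) * pker a (t - s')) * indicator {tt (j - 1)..tt j} s * indicator {tt j..tt (Suc j)} s'"
      using AE_lborel_singleton[of "tt (Suc j)"]
    proof eventually_elim
      case (elim s')
      then show ?case using t a by (auto simp: indicator_def intro!: ennreal_leI pker_ratio_mono)
    qed
  qed
  then have "(Gamma a * cker a tt j t) * (Gamma a * cker a tt (Suc j) t') \<le> (Gamma a * cker a tt j t') * (Gamma a * cker a tt (Suc j) t)"
    using a j cker_nonneg[OF P a(1)] by (simp add: ennreal_mult[symmetric])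
  moreover have "0 < Gamma a" using a by simp
  ultimately show ?thesis by (simp add: mult_ac)
qed

text \<open>The weight of X i in the value at t of the function X 0 + sum of
  \<open>cker a tt j t\<close> times D j, with j up to m, that takes the values X 0, ..., X m at the
  nodes. As in Newton interpolation, a new node adds its kernel, normalised to 1 at that node, times
  the defect of the previous prediction there.\<close>

primrec dweight :: "real \<Rightarrow> (nat \<Rightarrow> real) \<Rightarrow> nat \<Rightarrow> nat \<Rightarrow> real \<Rightarrow> real" where
  "dweight a tt 0 i t = (if i = 0 then 1 else 0)"
| "dweight a tt (Suc m) i t = dweight a tt m i t
     + cker a tt (Suc m) t / cker a tt (Suc m) (tt (Suc m)) * ((if i = Suc m then 1 else 0) - dweight a tt m i (tt (Suc m)))"

lemma dweight_outside: "m < i \<Longrightarrow> dweight a tt m i t = 0"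
  by (induction m arbitrary: t) auto

text \<open>Constant data are predicted exactly, so each correction contributes 1 - 1 = 0 in
  total.\<close>

lemma dweight_sum: "(\<Sum>i\<le>m. dweight a tt m i t) = 1"
proof (induction m arbitrary: t)
  case (Suc m)
  have *: "(\<Sum>i\<le>Suc m. dweight a tt m i s) = 1" for s
    using Suc by (simp add: dweight_outside)
  have "(\<Sum>i\<le>Suc m. dweight a tt (Suc m) i t) = (\<Sum>i\<le>Suc m. dweight a tt m i t)
     + cker a tt (Suc m) t / cker a tt (Suc m) (tt (Suc m)) * ((\<Sum>i\<le>Suc m. if i = Suc m then 1 else 0) - (\<Sum>i\<le>Suc m. dweight a tt m i (tt (Suc m))))"
    unfolding dweight.simps sum.distrib sum_distrib_left[symmetric] sum_subtractf ..
  then show ?case unfolding * by simp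
qed simp

text \<open>For nonnegativity one has to know in addition that each weight decays in \<open>t\<close> more slowly than
  the kernel of the next cell; for the kernels themselves this is log-convexity of \<open>r \<mapsto> r\<^bsup>a - 1\<^esup>\<close>.\<close>

lemma dweight_nonneg_and_ratio:
  assumes P: "is_partition T N tt" and a: "0 < a" "a \<le> 1"
  shows "m \<le> N \<Longrightarrow> tt m \<le> t \<Longrightarrow> 0 \<le> dweight a tt m i t"
    and "Suc m \<le> N \<Longrightarrow> tt (Suc m) \<le> t \<Longrightarrow> t \<le> t' \<Longrightarrow>
      dweight a tt m i t * cker a tt (Suc m) t' \<le> dweight a tt m i t' * cker a tt (Suc m) t"
proof (induction m arbitrary: t t')
  case 0
  {
    case 1
    then show ?case by simp
  next
    case 2
    then show ?case using cker_antimono[OF P a, of "Suc 0" t t'] by simp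
  }
next
  case (Suc m)
  define k where "k = cker a tt (Suc m)"
  define \<theta> where "\<theta> = tt (Suc m)"
  define w where "w = dweight a tt m i"
  define \<delta> where "\<delta> = (if i = Suc m then 1 else 0 :: real)"
  have kpos: "0 < k x" if "Suc m \<le> N" "\<theta> \<le> x" for x
    using that cker_pos[OF P a(1), of "Suc m" x] by (simp add: k_def \<theta>_def)
  \<comment> \<open>With the kernel factored out, both claims reduce to the monotonicity of
    \<open>w x / k x\<close> in x from the node on.\<close>
  have w': "dweight a tt (Suc m) i x = k x * (w x / k x - w \<theta> / k \<theta> + \<delta> / k \<theta>)" if "Suc m \<le> N" "\<theta> \<le> x" for x
    using kpos[OF that] by (simp add: k_def[symmetric] \<theta>_def[symmetric] w_def[symmetric] \<delta>_def[symmetric] distrib_left right_diff_distrib diff_divide_distrib)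
  have \<delta>: "0 \<le> \<delta>" by (simp add: \<delta>_def)
  have mono: "w x / k x \<le> w y / k y" if "Suc m \<le> N" "\<theta> \<le> x" "x \<le> y" for x y
    using Suc.IH(2)[of x y] that kpos[of x] kpos[of y]
    by (simp add: k_def[symmetric] \<theta>_def[symmetric] w_def[symmetric] divide_le_eq pos_le_divide_eq field_simps)
  {
    case 1
    then have "w \<theta> / k \<theta> \<le> w t / k t" by (intro mono) (auto simp: \<theta>_def)
    then show ?case
      using 1 kpos[of t] kpos[of \<theta>] \<delta> by (subst w') (auto simp: \<theta>_def[symmetric] intro!: mult_nonneg_nonneg)
  next
    case 2
    let ?k2 = "cker a tt (Suc (Suc m))"
    have m: "Suc m \<le> N" "\<theta> \<le> t" "\<theta> \<le> t'"
      using 2 partition_mono[OF P, of "Suc m" "Suc (Suc m)"] by (auto simp: \<theta>_def)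
    define B where "B x = w x / k x - w \<theta> / k \<theta> + \<delta> / k \<theta>" for x
    have B: "0 \<le> B t" "B t \<le> B t'"
      using mono[OF m(1) _ m(2)] mono[OF m(1,2) 2(3)] kpos[OF m(1), of \<theta>] \<delta> by (auto simp: B_def)
    have R: "k t * ?k2 t' \<le> k t' * ?k2 t"
      unfolding k_def using 2 by (intro cker_ratio_mono[OF P a]) auto
    have k2: "0 \<le> ?k2 t" using 2 by (intro cker_nonneg[OF P a(1)]) auto
    have "k t * B t * ?k2 t' = k t * ?k2 t' * B t" by simp
    also have "\<dots> \<le> k t' * ?k2 t * B t'"
      by (rule mult_mono[OF R B(2)]) (use B k2 kpos[OF m(1,3)] in auto)
    finally show ?case using w'[OF m(1,2)] w'[OF m(1,3)] by (simp add: B_def mult_ac)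
  }
qed

lemmas dweight_nonneg = dweight_nonneg_and_ratio(1)

lemma dweight_representation:
  fixes X D :: "nat \<Rightarrow> 'h::real_vector"
  assumes D: "\<And>m. Suc m \<le> N \<Longrightarrow> D (Suc m) = (1 / cker a tt (Suc m) (tt (Suc m))) *\<^sub>R
        (X (Suc m) - (\<Sum>i\<le>m. dweight a tt m i (tt (Suc m)) *\<^sub>R X i))"
  shows "m \<le> N \<Longrightarrow> X 0 + (\<Sum>j=1..m. cker a tt j t *\<^sub>R D j) = (\<Sum>i\<le>m. dweight a tt m i t *\<^sub>R X i)"
proof (induction m)
  case (Suc m)
  let ?k = "cker a tt (Suc m)" and ?\<theta> = "tt (Suc m)"
  have "(\<Sum>i\<le>Suc m. dweight a tt (Suc m) i t *\<^sub>R X i)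
     = (\<Sum>i\<le>m. dweight a tt m i t *\<^sub>R X i - (?k t / ?k ?\<theta>) *\<^sub>R (dweight a tt m i ?\<theta> *\<^sub>R X i)) + (?k t / ?k ?\<theta>) *\<^sub>R X (Suc m)"
    by (simp add: dweight_outside algebra_simps)
  also have "\<dots> = (\<Sum>i\<le>m. dweight a tt m i t *\<^sub>R X i) + ?k t *\<^sub>R D (Suc m)"
    unfolding sum_subtractf scaleR_sum_right[symmetric] using Suc.prems by (simp add: D scaleR_diff_right)
  also have "\<dots> = X 0 + (\<Sum>j=1..Suc m. ?k t *\<^sub>R 0 + cker a tt j t *\<^sub>R D j)"
    using Suc by simp
  finally show ?case by simp
qed simp

text \<open>The relation at the new node splits into the prediction from earlier values plus the
  kernel of the last cell times D. Hence D is a positive multiple of the new value minus a weighted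
  mean of the old ones.\<close>

lemma dweight_of_relation:
  fixes X D :: "nat \<Rightarrow> 'h::real_vector"
  assumes P: "is_partition T N tt" and a: "0 < a"
    and X: "\<And>n. n \<le> N \<Longrightarrow> X n = X 0 + (\<Sum>j=1..n. cker a tt j (tt n) *\<^sub>R D j)"
  shows "Suc m \<le> N \<Longrightarrow> D (Suc m) = (1 / cker a tt (Suc m) (tt (Suc m))) *\<^sub>R
        (X (Suc m) - (\<Sum>i\<le>m. dweight a tt m i (tt (Suc m)) *\<^sub>R X i))"
proof (induction m rule: less_induct)
  case (less m)
  let ?k = "cker a tt (Suc m)" and ?\<theta> = "tt (Suc m)"
  have "X 0 + (\<Sum>j=1..m. cker a tt j ?\<theta> *\<^sub>R D j) = (\<Sum>i\<le>m. dweight a tt m i ?\<theta> *\<^sub>R X i)"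
    using less by (intro dweight_representation[where N = m]) auto
  moreover have "X (Suc m) = (X 0 + (\<Sum>j=1..m. cker a tt j ?\<theta> *\<^sub>R D j)) + ?k ?\<theta> *\<^sub>R D (Suc m)"
    using X[OF less.prems] by simp
  moreover have "?k ?\<theta> \<noteq> 0" using cker_pos[OF P a, of "Suc m" ?\<theta>] less.prems by auto
  ultimately show ?case by simp
qed

text \<open>With \<open>g\<close> the discrete derivative of \<open>\<phi>\<close>, both
  \<open>g j\<close> and \<open>V j\<close> are the same nonnegative combination of the differences
  from node j to the earlier nodes. The subgradient inequality compares them term by term, so
  \<open>g j\<close> is at most the inner product of \<open>\<xi> j\<close> and \<open>V j\<close>;
  summing against the nonnegative kernel gives the claim.\<close>

lemma discrete_chain_inequality:
  fixes U V \<xi> :: "nat \<Rightarrow> 'h::real_inner" and \<phi> :: "nat \<Rightarrow> real"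
  assumes P: "is_partition T N tt" and a: "0 < a" "a \<le> 1"
    and U: "\<And>n. n \<le> N \<Longrightarrow> U n = U 0 + (\<Sum>j=1..n. cker a tt j (tt n) *\<^sub>R V j)"
    and \<xi>: "\<And>i n. 1 \<le> n \<Longrightarrow> i < n \<Longrightarrow> n \<le> N \<Longrightarrow> \<xi> n \<bullet> (U i - U n) \<le> \<phi> i - \<phi> n"
    and n: "n \<le> N"
  shows "\<phi> n - \<phi> 0 \<le> (\<Sum>j=1..n. cker a tt j (tt n) * (\<xi> j \<bullet> V j))"
proof -
  define g where "g j = (1 / cker a tt j (tt j)) *\<^sub>R (\<phi> j - (\<Sum>i\<le>j - 1. dweight a tt (j - 1) i (tt j) *\<^sub>R \<phi> i))" for j
  have rep: "\<phi> 0 + (\<Sum>j=1..n. cker a tt j t *\<^sub>R g j) = (\<Sum>i\<le>n. dweight a tt n i t *\<^sub>R \<phi> i)" for t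
    by (rule dweight_representation[OF _ n]) (simp add: g_def)
  have eq: "\<phi> n - \<phi> 0 = (\<Sum>j=1..n. cker a tt j (tt n) * g j)"
  proof (cases n)
    case 0
    then show ?thesis by simp
  next
    case (Suc m)
    have "cker a tt n (tt n) \<noteq> 0" using cker_pos[OF P a(1), of n "tt n"] n Suc by auto
    then have "(\<Sum>i\<le>n. dweight a tt n i (tt n) *\<^sub>R \<phi> i) = (\<Sum>i\<le>n. (if i = n then \<phi> i else 0))"
      using Suc by (intro sum.cong) auto
    then show ?thesis using rep[of "tt n"] by (simp add: sum.delta)
  qed
  have le: "g j \<le> \<xi> j \<bullet> V j" if j: "1 \<le> j" "j \<le> N" for j
  proof -
    obtain m where m: "j = Suc m" using j by (cases j) auto
    let ?w = "\<lambda>i. dweight a tt m i (tt j)"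
    have k: "0 < cker a tt j (tt j)" using cker_pos[OF P a(1)] j by auto
    have V: "V j = (1 / cker a tt j (tt j)) *\<^sub>R (U j - (\<Sum>i\<le>m. ?w i *\<^sub>R U i))"
      using dweight_of_relation[OF P a(1) U, of m] j m by simp
    have split: "Y j - (\<Sum>i\<le>m. ?w i *\<^sub>R Y i) = (\<Sum>i\<le>m. ?w i *\<^sub>R (Y j - Y i))" for Y :: "nat \<Rightarrow> 'v::real_vector"
      by (simp add: scaleR_diff_right sum_subtractf scaleR_sum_left[symmetric] dweight_sum)
    have "(\<Sum>i\<le>m. ?w i * (\<phi> j - \<phi> i)) \<le> (\<Sum>i\<le>m. ?w i * (\<xi> j \<bullet> (U j - U i)))"
    proof (intro sum_mono mult_left_mono)
      fix i assume "i \<in> {..m}"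
      then show "\<phi> j - \<phi> i \<le> \<xi> j \<bullet> (U j - U i)" using \<xi>[of j i] j m by (simp add: inner_diff_right)
      show "0 \<le> ?w i" using j m partition_mono[OF P, of m j] by (intro dweight_nonneg[OF P a]) auto
    qed
    then have "(1 / cker a tt j (tt j)) * (\<Sum>i\<le>m. ?w i * (\<phi> j - \<phi> i)) \<le> (1 / cker a tt j (tt j)) * (\<Sum>i\<le>m. ?w i * (\<xi> j \<bullet> (U j - U i)))"
      using k by (intro mult_left_mono) auto
    then show ?thesis
      unfolding V g_def using m split[of \<phi>] split[of U]
      by (simp add: inner_sum_right)
  qed
  show ?thesis unfolding eq
    using n le cker_nonneg[OF P a(1)] by (intro sum_mono mult_left_mono) auto
qed

text \<open>The chain inequality with \<open>\<xi> = F - V\<close>, where the inner product with V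
  is at most half of \<open>(norm F)^2 - (norm V)^2\<close>.\<close>

lemma discrete_stability:
  fixes U V F :: "nat \<Rightarrow> 'h::real_inner" and \<phi> :: "nat \<Rightarrow> real"
  assumes P: "is_partition T N tt" and a: "0 < a" "a \<le> 1"
    and U: "\<And>n. n \<le> N \<Longrightarrow> U n = U 0 + (\<Sum>j=1..n. cker a tt j (tt n) *\<^sub>R V j)"
    and \<xi>: "\<And>i n. 1 \<le> n \<Longrightarrow> i < n \<Longrightarrow> n \<le> N \<Longrightarrow> (F n - V n) \<bullet> (U i - U n) \<le> \<phi> i - \<phi> n"
    and n: "n \<le> N"
  shows "(\<Sum>j=1..n. cker a tt j (tt n) * (norm (V j))\<^sup>2)
      \<le> (\<Sum>j=1..n. cker a tt j (tt n) * (norm (F j))\<^sup>2) + 2 * (\<phi> 0 - \<phi> n)"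
proof -
  have "\<phi> n - \<phi> 0 \<le> (\<Sum>j=1..n. cker a tt j (tt n) * ((F j - V j) \<bullet> V j))"
    by (rule discrete_chain_inequality[OF P a U \<xi> n])
  also have "\<dots> \<le> (\<Sum>j=1..n. cker a tt j (tt n) * ((norm (F j))\<^sup>2 / 2 - (norm (V j))\<^sup>2 / 2))"
  proof (intro sum_mono mult_left_mono)
    fix j
    have "0 \<le> (norm (F j - V j))\<^sup>2" by simp
    then show "(F j - V j) \<bullet> V j \<le> (norm (F j))\<^sup>2 / 2 - (norm (V j))\<^sup>2 / 2"
      by (simp add: power2_norm_eq_inner inner_diff_left inner_diff_right inner_commute)
  qed (use cker_nonneg[OF P a(1)] n in auto)
  also have "\<dots> = (\<Sum>j=1..n. cker a tt j (tt n) * (norm (F j))\<^sup>2) / 2 - (\<Sum>j=1..n. cker a tt j (tt n) * (norm (V j))\<^sup>2) / 2"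
    by (simp add: right_diff_distrib sum_subtractf sum_divide_distrib)
  finally show ?thesis by simp
qed

section \<open>Interpolants\<close>

text \<open>A sum of indicators in place of a lookup through \<open>interval_index\<close>: it is
  measurable by construction, vanishes outside (0, T] and leads directly to sums over cells.\<close>

definition step_fun :: "nat \<Rightarrow> (nat \<Rightarrow> real) \<Rightarrow> (nat \<Rightarrow> 'a::real_vector) \<Rightarrow> real \<Rightarrow> 'a" where
  "step_fun N tt V s = (\<Sum>n=1..N. indicator {tt (n - 1)<..tt n} s *\<^sub>R V n)"

lemma step_fun_measurable [measurable]:
  fixes V :: "nat \<Rightarrow> 'h::{banach, second_countable_topology}"
  shows "step_fun N tt V \<in> borel_measurable borel"
  unfolding step_fun_def[abs_def] by measurable

lemma cell_unique:
  assumes P: "is_partition T N tt" and "n \<in> {1..N}" "m \<in> {1..N}"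
    and "tt (n - 1) < s" "s \<le> tt n" "tt (m - 1) < s" "s \<le> tt m"
  shows "n = m"
proof (rule ccontr)
  assume "n \<noteq> m"
  then consider "n \<le> m - 1" | "m \<le> n - 1" by linarith
  then show False
  proof cases
    case 1
    then have "tt n \<le> tt (m - 1)" by (rule partition_mono[OF P]) (use assms in auto)
    then show False using assms by linarith
  next
    case 2
    then have "tt m \<le> tt (n - 1)" by (rule partition_mono[OF P]) (use assms in auto)
    then show False using assms by linarith
  qed
qed

lemma interval_index_eq:
  assumes P: "is_partition T N tt" and n: "n \<in> {1..N}" "tt (n - 1) < s" "s \<le> tt n"
  shows "interval_index N tt s = n"
  unfolding interval_index_def using cell_unique[OF P] n by (intro the_equality) blast+

lemma cell_exists:
  assumes P: "is_partition T N tt" and s: "0 < s" "s \<le> T"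
  obtains n where "n \<in> {1..N}" "tt (n - 1) < s" "s \<le> tt n"
proof -
  define n where "n = (LEAST n. s \<le> tt n)"
  have N: "s \<le> tt N" using P s by (simp add: is_partition_def)
  have n: "s \<le> tt n" unfolding n_def by (rule LeastI[of "\<lambda>n. s \<le> tt n", OF N])
  have nN: "n \<le> N" unfolding n_def by (rule Least_le[of "\<lambda>n. s \<le> tt n", OF N])
  have "tt 0 = 0" using P by (simp add: is_partition_def)
  then have "n \<noteq> 0" using n s(1) by (metis not_le)
  then have "n - 1 < (LEAST n. s \<le> tt n)" unfolding n_def[symmetric] by simp
  then have "\<not> s \<le> tt (n - 1)" by (rule not_less_Least)
  then have "tt (n - 1) < s" by simp
  moreover have "n \<in> {1..N}" using nN \<open>n \<noteq> 0\<close> by simp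
  ultimately show ?thesis by (intro that[of n] n)
qed

lemma step_fun_eq:
  assumes P: "is_partition T N tt" and n: "n \<in> {1..N}" "tt (n - 1) < s" "s \<le> tt n"
  shows "step_fun N tt V s = V n"
proof -
  have cell: "indicator {tt (m - 1)<..tt m} s = (if m = n then 1 else 0 :: real)" if "m \<in> {1..N}" for m
  proof (cases "m = n")
    case False
    then have "\<not> (tt (m - 1) < s \<and> s \<le> tt m)" using cell_unique[OF P n(1) that n(2,3)] by blast
    then show ?thesis using False by simp
  qed (use n in simp)
  have "step_fun N tt V s = (\<Sum>m\<in>{1..N}. if m = n then V m else 0)"
    unfolding step_fun_def by (rule sum.cong[OF refl]) (simp only: cell, simp)
  then show ?thesis using n(1) by (simp only: sum.delta finite_atLeastAtMost if_True)
qed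

lemma step_fun_index:
  assumes P: "is_partition T N tt" and s: "0 < s" "s \<le> T"
  shows "step_fun N tt V s = V (interval_index N tt s)"
  using cell_exists[OF P s] step_fun_eq[OF P] interval_index_eq[OF P] by metis

lemma step_fun_outside:
  assumes P: "is_partition T N tt" and s: "s \<le> 0 \<or> T < s"
  shows "step_fun N tt V s = 0"
  unfolding step_fun_def
proof (intro sum.neutral ballI)
  fix n assume "n \<in> {1..N}"
  then have "0 \<le> tt (n - 1)" "tt n \<le> T" by (auto intro!: partition_bounds[OF P])
  then show "indicator {tt (n - 1)<..tt n} s *\<^sub>R V n = 0"
    using s by (auto simp: indicator_def)
qed

lemma step_fun_compose:
  assumes P: "is_partition T N tt" and "g 0 = 0"
  shows "g (step_fun N tt V s) = step_fun N tt (\<lambda>n. g (V n)) s"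
proof (cases "0 < s \<and> s \<le> T")
  case True
  then show ?thesis using step_fun_index[OF P] by metis
next
  case False
  then have "s \<le> 0 \<or> T < s" by auto
  then show ?thesis using assms(2) by (simp add: step_fun_outside[OF P])
qed

lemma norm_step_fun_le:
  fixes V :: "nat \<Rightarrow> 'a::real_normed_vector"
  shows "norm (step_fun N tt V s) \<le> (\<Sum>n=1..N. norm (V n))"
  unfolding step_fun_def by (intro sum_norm_le) (auto simp: indicator_def)

lemma max_step_bound:
  assumes "n \<in> {1..N}"
  shows "tt n - tt (n - 1) \<le> max_step N tt"
  unfolding max_step_def step_size_def[symmetric] using assms by (intro Max_ge) auto

lemma nn_integral_pker_cell:
  assumes P: "is_partition T N tt" and a: "0 < a" and j: "1 \<le> j" "j \<le> N"
  shows "(\<integral>\<^sup>+s. ennreal (pker a (t - s)) * indicator {tt (j - 1)<..tt j} s \<partial>lborel) = ennreal (Gamma a * cker a tt j t)"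
proof -
  have "(\<integral>\<^sup>+s. ennreal (pker a (t - s)) * indicator {tt (j - 1)<..tt j} s \<partial>lborel) = (\<integral>\<^sup>+s\<in>{tt (j - 1)..tt j}. ennreal (pker a (t - s)) \<partial>lborel)"
  proof (rule nn_integral_cong_AE)
    show "AE s in lborel. ennreal (pker a (t - s)) * indicator {tt (j - 1)<..tt j} s = ennreal (pker a (t - s)) * indicator {tt (j - 1)..tt j} s"
      using AE_lborel_singleton[of "tt (j - 1)"] by eventually_elim (auto simp: indicator_def)
  qed
  then show ?thesis using nn_integral_cell_pker[OF P a j] by simp
qed

lemma rl_step_fun:
  fixes V :: "nat \<Rightarrow> 'h::{banach, second_countable_topology}"
  assumes P: "is_partition T N tt" and a: "0 < a"
  shows "rl a (step_fun N tt V) t = (\<Sum>j=1..N. (Gamma a * cker a tt j t) *\<^sub>R V j)"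
proof -
  have nn: "(\<integral>\<^sup>+s. ennreal (pker a (t - s) * indicator {tt (j - 1)<..tt j} s) \<partial>lborel) = ennreal (Gamma a * cker a tt j t)" if "j \<in> {1..N}" for j
    using nn_integral_pker_cell[OF P a, of j t] that by (simp add: ennreal_mult ennreal_indicator)
  have nonneg: "0 \<le> Gamma a * cker a tt j t" if "j \<in> {1..N}" for j
    using that a cker_nonneg[OF P a] by auto
  have int: "integrable lborel (\<lambda>s. pker a (t - s) * indicator {tt (j - 1)<..tt j} s)" if "j \<in> {1..N}" for j
    by (rule integrableI_nn_integral_finite[OF _ _ nn[OF that]]) (auto simp: nonneg[OF that])
  have val: "(\<integral>s. pker a (t - s) * indicator {tt (j - 1)<..tt j} s \<partial>lborel) = Gamma a * cker a tt j t" if "j \<in> {1..N}" for j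
  proof -
    have "(\<integral>s. pker a (t - s) * indicator {tt (j - 1)<..tt j} s \<partial>lborel)
      = enn2real (\<integral>\<^sup>+s. ennreal (pker a (t - s) * indicator {tt (j - 1)<..tt j} s) \<partial>lborel)"
      by (rule integral_eq_nn_integral) auto
    then show ?thesis unfolding nn[OF that] using nonneg[OF that] by simp
  qed
  have "rl a (step_fun N tt V) t = (\<integral>s. (\<Sum>j=1..N. (pker a (t - s) * indicator {tt (j - 1)<..tt j} s) *\<^sub>R V j) \<partial>lborel)"
    unfolding rl_def step_fun_def by (simp only: scaleR_sum_right scaleR_scaleR)
  also have "\<dots> = (\<Sum>j=1..N. (\<integral>s. (pker a (t - s) * indicator {tt (j - 1)<..tt j} s) *\<^sub>R V j \<partial>lborel))"
    using int by (intro Bochner_Integration.integral_sum integrable_scaleR_left) auto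
  also have "\<dots> = (\<Sum>j=1..N. (Gamma a * cker a tt j t) *\<^sub>R V j)"
    using int val by (intro sum.cong) auto
  finally show ?thesis .
qed

lemma fint_step_fun:
  assumes P: "is_partition T N tt" and a: "0 < a" and X: "\<And>n. 0 \<le> X n"
  shows "fint a (\<lambda>s. ennreal (step_fun N tt X s)) t = ennreal (\<Sum>j=1..N. Gamma a * cker a tt j t * X j)"
proof -
  have "fint a (\<lambda>s. ennreal (step_fun N tt X s)) t
     = (\<integral>\<^sup>+s. (\<Sum>j=1..N. ennreal (X j) * (ennreal (pker a (t - s)) * indicator {tt (j - 1)<..tt j} s)) \<partial>lborel)"
    unfolding fint_def
  proof (intro nn_integral_cong)
    fix s
    have "ennreal (step_fun N tt X s) = (\<Sum>j=1..N. ennreal (X j) * indicator {tt (j - 1)<..tt j} s)"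
      unfolding step_fun_def using X by (subst sum_ennreal[symmetric]) (auto intro!: sum.cong simp: indicator_def)
    then show "ennreal (pker a (t - s)) * ennreal (step_fun N tt X s)
       = (\<Sum>j=1..N. ennreal (X j) * (ennreal (pker a (t - s)) * indicator {tt (j - 1)<..tt j} s))"
      by (simp only: sum_distrib_left mult_ac)
  qed
  also have "\<dots> = (\<Sum>j=1..N. ennreal (X j) * ennreal (Gamma a * cker a tt j t))"
  proof (subst nn_integral_sum)
    show "(\<Sum>j=1..N. \<integral>\<^sup>+s. ennreal (X j) * (ennreal (pker a (t - s)) * indicator {tt (j - 1)<..tt j} s) \<partial>lborel)
      = (\<Sum>j=1..N. ennreal (X j) * ennreal (Gamma a * cker a tt j t))"
    proof (intro sum.cong refl)
      fix j assume "j \<in> {1..N}"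
      then have j: "1 \<le> j" "j \<le> N" by auto
      show "(\<integral>\<^sup>+s. ennreal (X j) * (ennreal (pker a (t - s)) * indicator {tt (j - 1)<..tt j} s) \<partial>lborel)
        = ennreal (X j) * ennreal (Gamma a * cker a tt j t)"
        unfolding nn_integral_pker_cell[OF P a j, symmetric] by (rule nn_integral_cmult) measurable
    qed
  qed measurable
  also have "\<dots> = (\<Sum>j=1..N. ennreal (Gamma a * cker a tt j t * X j))"
    using X a cker_nonneg[OF P a] by (intro sum.cong) (auto simp: ennreal_mult[symmetric] mult_ac)
  also have "\<dots> = ennreal (\<Sum>j=1..N. Gamma a * cker a tt j t * X j)"
    using X a cker_nonneg[OF P a] by (intro sum_ennreal) auto
  finally show ?thesis .
qed

lemma cker_eq_0:
  assumes P: "is_partition T N tt" and "n < j" "j \<le> N" "t \<le> tt n"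
  shows "cker a tt j t = 0"
proof -
  have "tt n \<le> tt (j - 1)" "tt n \<le> tt j" using assms by (auto intro!: partition_mono[OF P])
  then show ?thesis using assms by (simp add: cker_def)
qed

text \<open>For t in cell n the weights of the completed cells decrease in t and are compared with
  node n - 1, while the weight of cell n increases and is compared with node n. Each comparison
  costs one S, whence the factor 2.\<close>

lemma fint_step_fun_le:
  assumes P: "is_partition T N tt" and a: "0 < a" "a \<le> 1" and X: "\<And>n. 0 \<le> X n"
    and S: "\<And>n. n \<le> N \<Longrightarrow> (\<Sum>j=1..n. cker a tt j (tt n) * X j) \<le> S" and t: "t \<le> T"
  shows "fint a (\<lambda>s. ennreal (step_fun N tt X s)) t \<le> ennreal (2 * Gamma a * S)"
proof (cases "0 < t")
  case False
  have eq: "ennreal (pker a (t - s)) * ennreal (step_fun N tt X s) = 0" for s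
    using False step_fun_outside[OF P, of s X] by (cases "s \<le> 0") auto
  show ?thesis unfolding fint_def eq by simp
next
  case True
  obtain n where n: "n \<in> {1..N}" "tt (n - 1) < t" "t \<le> tt n" using cell_exists[OF P True t] .
  have "(\<Sum>j=1..N. cker a tt j t * X j) = (\<Sum>j=1..n. cker a tt j t * X j)"
    using n cker_eq_0[OF P, of n _ t a] by (intro sum.mono_neutral_right) auto
  also have "\<dots> = (\<Sum>j=1..n-1. cker a tt j t * X j) + cker a tt n t * X n"
    using n by (cases n) auto
  also have "(\<Sum>j=1..n-1. cker a tt j t * X j) \<le> (\<Sum>j=1..n-1. cker a tt j (tt (n - 1)) * X j)"
  proof (intro sum_mono mult_right_mono X)
    fix j assume "j \<in> {1..n-1}"
    then show "cker a tt j t \<le> cker a tt j (tt (n - 1))"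
      using n partition_mono[OF P, of j "n - 1"] by (intro cker_antimono[OF P a]) auto
  qed
  also have "\<dots> \<le> S" using n by (intro S) auto
  also have "cker a tt n t * X n \<le> cker a tt n (tt n) * X n"
    using n X a unfolding cker_def
    by (intro mult_right_mono divide_right_mono) (auto intro!: powr_mono2)
  also have "\<dots> \<le> (\<Sum>j=1..n. cker a tt j (tt n) * X j)"
    using n X cker_nonneg[OF P a(1)] by (intro member_le_sum) (auto intro!: mult_nonneg_nonneg)
  also have "\<dots> \<le> S" using n by (intro S) auto
  finally have "(\<Sum>j=1..N. cker a tt j t * X j) \<le> 2 * S" by simp
  then have "Gamma a * (\<Sum>j=1..N. cker a tt j t * X j) \<le> Gamma a * (2 * S)"
    using a by (intro mult_left_mono) auto
  then show ?thesis
    unfolding fint_step_fun[OF P a(1) X] by (intro ennreal_leI) (simp add: sum_distrib_left mult_ac)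
qed

lemma interp_frac_eq:
  fixes U :: "nat \<Rightarrow> 'h::{banach, second_countable_topology}"
  assumes P: "is_partition T N tt" and t: "t \<le> T"
  shows "interp_frac \<alpha> N tt U t = U 0 + (1 / Gamma \<alpha>) *\<^sub>R rl \<alpha> (step_fun N tt (discrete_caputo \<alpha> N tt U)) t"
proof -
  let ?V = "step_fun N tt (discrete_caputo \<alpha> N tt U)"
  let ?F = "\<lambda>s. indicator {0..t} s *\<^sub>R (t - s) powr (\<alpha> - 1) *\<^sub>R discrete_caputo \<alpha> N tt U (interval_index N tt s)"
  \<comment> \<open>At s = 0 no cell contains s and \<open>interval_index\<close> is unspecified, so
    the value there is carried along as a term on the null set {0}.\<close>
  let ?G = "\<lambda>s. pker \<alpha> (t - s) *\<^sub>R ?V s + indicator {0} s *\<^sub>R ?F 0"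
  have "?F s = ?G s" for s
  proof -
    consider "s < 0" | "s = 0" | "0 < s" "s < t" | "t \<le> s" "0 < s" by linarith
    then show ?thesis
    proof cases
      case 1
      then show ?thesis by (simp add: step_fun_outside[OF P])
    next
      case 2
      then show ?thesis by (simp add: step_fun_outside[OF P])
    next
      case 3
      then have "s \<le> T" using t by simp
      with 3 show ?thesis by (simp add: pker_def step_fun_index[OF P])
    qed (auto simp: indicator_def)
  qed
  then have "(\<integral>s. ?F s \<partial>lebesgue) = (\<integral>s. ?G s \<partial>lebesgue)" by (rule Bochner_Integration.integral_cong[OF refl])
  also have "\<dots> = (\<integral>s. ?G s \<partial>lborel)" by (rule integral_completion) measurable
  also have "\<dots> = (\<integral>s. pker \<alpha> (t - s) *\<^sub>R ?V s \<partial>lborel)"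
  proof (rule integral_cong_AE)
    show "AE s in lborel. ?G s = pker \<alpha> (t - s) *\<^sub>R ?V s"
      using AE_lborel_singleton[of 0] by eventually_elim simp
  qed measurable
  also have "\<dots> = rl \<alpha> ?V t" unfolding rl_def ..
  finally show ?thesis by (simp add: interp_frac_def set_lebesgue_integral_def)
qed

section \<open>Distance of the two interpolants\<close>

lemma max_step_pos:
  assumes P: "is_partition T N tt" and "0 < T"
  shows "0 < max_step N tt"
proof -
  have "N \<noteq> 0" using assms by (cases N) (auto simp: is_partition_def)
  then have "0 < tt 1 - tt (1 - 1)" "1 \<in> {1..N}" using partition_strict_mono[OF P, of 0 1] by auto
  then show ?thesis using max_step_bound[of 1 N tt] by linarith
qed

text \<open>Cauchy-Schwarz with respect to the kernel difference between \<open>t\<close> and the next node, whose mass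
  is at most \<open>2 \<tau>\<^sup>a / a\<close>.\<close>

lemma interp_error_cell:
  fixes V :: "nat \<Rightarrow> 'h::{banach, second_countable_topology}"
  assumes P: "is_partition T N tt" and a: "0 < a" "a < 1"
    and n: "n \<in> {1..N}" "tt (n - 1) < t" "t \<le> tt n" and \<tau>: "max_step N tt \<le> \<tau>"
  shows "ennreal ((norm (rl a (step_fun N tt V) (tt n) - rl a (step_fun N tt V) t))\<^sup>2)
    \<le> ennreal (2 * \<tau> powr a / a) *
      ((\<integral>\<^sup>+s. ennreal (pker a (t - s) - pker a (t - s + \<tau>)) * ennreal ((norm (step_fun N tt V s))\<^sup>2) \<partial>lborel)
        + ennreal (\<tau> powr a / a) * ennreal ((norm (step_fun N tt V t))\<^sup>2))"
proof -
  define v where "v = step_fun N tt V"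
  have [measurable]: "v \<in> borel_measurable borel" unfolding v_def by measurable
  have M: "norm (v s) \<le> (\<Sum>n=1..N. norm (V n))" for s unfolding v_def by (rule norm_step_fun_le)
  have v0: "v s = 0" if "s < 0" for s using that unfolding v_def by (simp add: step_fun_outside[OF P])
  have "n - 1 \<le> N" using n(1) by (intro le_trans[OF diff_le_self]) simp
  then have "0 \<le> tt (n - 1)" by (rule partition_bounds(1)[OF P])
  then have t0: "0 \<le> t" using n by linarith
  have \<tau>t: "tt n - t \<le> \<tau>" "0 \<le> tt n - t" using max_step_bound[OF n(1), of tt] \<tau> n by auto
  define d where "d s = pker a (tt n - s) - pker a (t - s)" for s
  have [measurable]: "d \<in> borel_measurable borel" unfolding d_def by measurable
  have I: "integrable lborel (\<lambda>s. pker a (r - s) *\<^sub>R v s)" for r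
    using a M v0 by (intro rl_integrable_bounded) auto
  have "rl a v (tt n) - rl a v t = (\<integral>s. d s *\<^sub>R v s \<partial>lborel)"
    unfolding rl_def d_def using I by (simp add: scaleR_left_diff_distrib)
  also have "ennreal (norm \<dots>) \<le> (\<integral>\<^sup>+s. ennreal (norm (d s *\<^sub>R v s)) \<partial>lborel)"
    using I[of "tt n"] I[of t] by (intro integral_norm_bound_ennreal) (simp add: scaleR_left_diff_distrib d_def)
  \<comment> \<open>The kernel difference is split into two square roots, one for its mass and one
    to weight the square of \<open>v\<close>.\<close>
  also have "\<dots> = (\<integral>\<^sup>+s. (ennreal (sqrt \<bar>d s\<bar>) * indicator {0..} s) * ennreal (sqrt \<bar>d s\<bar> * norm (v s)) \<partial>lborel)"
  proof (intro nn_integral_cong)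
    fix s
    have "ennreal (sqrt \<bar>d s\<bar>) * ennreal (sqrt \<bar>d s\<bar> * norm (v s)) = ennreal (norm (d s *\<^sub>R v s))"
      by (simp add: ennreal_mult[symmetric] mult.assoc[symmetric])
    then show "ennreal (norm (d s *\<^sub>R v s)) = (ennreal (sqrt \<bar>d s\<bar>) * indicator {0..} s) * ennreal (sqrt \<bar>d s\<bar> * norm (v s))"
      using v0[of s] by (cases "s < 0") auto
  qed
  finally have "(ennreal (norm (rl a v (tt n) - rl a v t)))\<^sup>2
     \<le> (\<integral>\<^sup>+s. (ennreal (sqrt \<bar>d s\<bar>) * indicator {0..} s) * ennreal (sqrt \<bar>d s\<bar> * norm (v s)) \<partial>lborel)\<^sup>2"
    by (rule power_mono) simp
  also have "\<dots> \<le> (\<integral>\<^sup>+s. (ennreal (sqrt \<bar>d s\<bar>) * indicator {0..} s)\<^sup>2 \<partial>lborel) * (\<integral>\<^sup>+s. (ennreal (sqrt \<bar>d s\<bar> * norm (v s)))\<^sup>2 \<partial>lborel)"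
    by (rule Cauchy_Schwarz_nn_integral) measurable
  also have "(\<integral>\<^sup>+s. (ennreal (sqrt \<bar>d s\<bar>) * indicator {0..} s)\<^sup>2 \<partial>lborel) = (\<integral>\<^sup>+s. ennreal \<bar>d s\<bar> * indicator {0..} s \<partial>lborel)"
    by (intro nn_integral_cong) (auto simp: indicator_def ennreal_power)
  also have "\<dots> \<le> ennreal (2 * (tt n - t) powr a / a)"
    unfolding d_def using a t0 n by (intro nn_integral_pker_abs_diff_le) auto
  also have "\<dots> \<le> ennreal (2 * \<tau> powr a / a)"
    using a \<tau>t by (intro ennreal_leI divide_right_mono mult_left_mono powr_mono2) auto
  also have "(\<integral>\<^sup>+s. (ennreal (sqrt \<bar>d s\<bar> * norm (v s)))\<^sup>2 \<partial>lborel)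
     \<le> (\<integral>\<^sup>+s. ennreal (pker a (t - s) - pker a (t - s + \<tau>)) * ennreal ((norm (v s))\<^sup>2)
        + ennreal ((norm (v t))\<^sup>2) * (ennreal (pker a (tt n - s)) * indicator {t..tt n} s) \<partial>lborel)"
  proof (intro nn_integral_mono)
    fix s
    have sq: "(ennreal (sqrt \<bar>d s\<bar> * norm (v s)))\<^sup>2 = ennreal \<bar>d s\<bar> * ennreal ((norm (v s))\<^sup>2)"
      by (simp add: ennreal_power power_mult_distrib ennreal_mult)
    \<comment> \<open>Before t the distance to the node is enlarged to the shift \<tau>, which no
      longer depends on the cell. Between t and the node \<open>v\<close> is constant with the value
      \<open>v t\<close>; afterwards both kernels vanish.\<close>
    consider "s < t" | "t \<le> s" "s \<le> tt n" | "tt n < s" by linarith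
    then show "(ennreal (sqrt \<bar>d s\<bar> * norm (v s)))\<^sup>2 \<le> ennreal (pker a (t - s) - pker a (t - s + \<tau>)) * ennreal ((norm (v s))\<^sup>2)
        + ennreal ((norm (v t))\<^sup>2) * (ennreal (pker a (tt n - s)) * indicator {t..tt n} s)"
    proof cases
      case 1
      have "pker a (tt n - s) \<le> pker a (t - s)" "pker a (t - s + \<tau>) \<le> pker a (tt n - s)"
        using 1 a n \<tau>t by (auto intro!: pker_antimono)
      then have "\<bar>d s\<bar> \<le> pker a (t - s) - pker a (t - s + \<tau>)" by (simp add: d_def)
      then have "ennreal \<bar>d s\<bar> * ennreal ((norm (v s))\<^sup>2) \<le> ennreal (pker a (t - s) - pker a (t - s + \<tau>)) * ennreal ((norm (v s))\<^sup>2)"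
        by (intro mult_right_mono ennreal_leI) auto
      then show ?thesis unfolding sq by (rule order_trans) simp
    next
      case 2
      then have "v s = V n" "v t = V n"
        using n by (auto simp: v_def intro!: step_fun_eq[OF P n(1)])
      moreover have "\<bar>d s\<bar> = pker a (tt n - s)" using 2 by (simp add: d_def)
      ultimately show ?thesis unfolding sq using 2 by (simp add: mult.commute)
    next
      case 3
      then have "d s = 0" using n by (simp add: d_def)
      then show ?thesis unfolding sq by simp
    qed
  qed
  also have "\<dots> = (\<integral>\<^sup>+s. ennreal (pker a (t - s) - pker a (t - s + \<tau>)) * ennreal ((norm (v s))\<^sup>2) \<partial>lborel)
     + ennreal ((norm (v t))\<^sup>2) * (\<integral>\<^sup>+s\<in>{t..tt n}. ennreal (pker a (tt n - s)) \<partial>lborel)"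
    by (subst nn_integral_add) (auto simp: nn_integral_cmult)
  also have "(\<integral>\<^sup>+s\<in>{t..tt n}. ennreal (pker a (tt n - s)) \<partial>lborel) \<le> ennreal (\<tau> powr a / a)"
  proof -
    have "(\<integral>\<^sup>+s\<in>{t..tt n}. ennreal (pker a (tt n - s)) \<partial>lborel) = ennreal ((tt n - t) powr a / a)"
      using n a by (simp add: nn_integral_pker max_def)
    also have "\<dots> \<le> ennreal (\<tau> powr a / a)"
      using a \<tau>t by (intro ennreal_leI divide_right_mono powr_mono2) auto
    finally show ?thesis .
  qed
  finally show ?thesis
    unfolding v_def[symmetric] by (simp add: ennreal_power mult_left_mono mult_right_mono add_left_mono mult.commute[of "ennreal (\<tau> powr a / a)"])
qed

text \<open>After Tonelli's theorem the kernel is convolved with its own \<tau>-increment, which by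
  \<open>nn_integral_pker_pker_diff_le\<close> gives back the kernel with the factor 4 \<tau>^a / a.
  Together with the local term, 2 \<tau>^a / a times (4 + 1) \<tau>^a / a is the constant.\<close>

lemma fint_interp_error_le:
  fixes V :: "nat \<Rightarrow> 'h::{banach, second_countable_topology}"
  assumes P: "is_partition T N tt" and a: "0 < a" "a < 1" and \<tau>: "max_step N tt \<le> \<tau>" "0 < \<tau>"
    and Y: "\<And>n t. n \<in> {1..N} \<Longrightarrow> tt (n - 1) < t \<Longrightarrow> t \<le> tt n \<Longrightarrow>
      Y t \<le> ennreal ((norm (rl a (step_fun N tt V) (tt n) - rl a (step_fun N tt V) t))\<^sup>2)"
    and Y0: "\<And>t. t \<le> 0 \<Longrightarrow> Y t = 0" and r: "r \<le> T"
  shows "fint a Y r \<le> ennreal (10 / a\<^sup>2 * \<tau> powr (2 * a)) * fint a (\<lambda>s. ennreal ((norm (step_fun N tt V s))\<^sup>2)) r"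
proof -
  define X where "X s = ennreal ((norm (step_fun N tt V s))\<^sup>2)" for s
  have [measurable]: "X \<in> borel_measurable borel" unfolding X_def by measurable
  define Q where "Q t = (\<integral>\<^sup>+s. ennreal (pker a (t - s) - pker a (t - s + \<tau>)) * X s \<partial>lborel)" for t
  have [measurable]: "Q \<in> borel_measurable borel" unfolding Q_def by measurable
  let ?c = "ennreal (2 * \<tau> powr a / a)"
  have "fint a Y r \<le> (\<integral>\<^sup>+t. ?c * (ennreal (pker a (r - t)) * Q t + ennreal (\<tau> powr a / a) * (ennreal (pker a (r - t)) * X t)) \<partial>lborel)"
    unfolding fint_def
  proof (intro nn_integral_mono)
    fix t
    show "ennreal (pker a (r - t)) * Y t \<le> ?c * (ennreal (pker a (r - t)) * Q t + ennreal (\<tau> powr a / a) * (ennreal (pker a (r - t)) * X t))"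
    proof (cases "0 < t \<and> t < r")
      case True
      then obtain n where n: "n \<in> {1..N}" "tt (n - 1) < t" "t \<le> tt n" using cell_exists[OF P, of t] r by auto
      have "Y t \<le> ?c * (Q t + ennreal (\<tau> powr a / a) * X t)"
        using order_trans[OF Y[OF n] interp_error_cell[OF P a n \<tau>(1)]] by (simp add: Q_def X_def)
      then have "ennreal (pker a (r - t)) * Y t \<le> ennreal (pker a (r - t)) * (?c * (Q t + ennreal (\<tau> powr a / a) * X t))"
        by (intro mult_left_mono) auto
      then show ?thesis by (simp add: distrib_left mult_ac)
    next
      case False
      then have "t \<le> 0 \<or> r \<le> t" by auto
      then show ?thesis using Y0[of t] by auto
    qed
  qed
  also have "\<dots> = ?c * ((\<integral>\<^sup>+t. ennreal (pker a (r - t)) * Q t \<partial>lborel) + ennreal (\<tau> powr a / a) * fint a X r)"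
    by (simp add: nn_integral_cmult nn_integral_add fint_def)
  also have "(\<integral>\<^sup>+t. ennreal (pker a (r - t)) * Q t \<partial>lborel)
     = (\<integral>\<^sup>+t. \<integral>\<^sup>+s. ennreal (pker a (r - t)) * ennreal (pker a (t - s) - pker a (t - s + \<tau>)) * X s \<partial>lborel \<partial>lborel)"
    unfolding Q_def by (intro nn_integral_cong) (simp add: nn_integral_cmult[symmetric] mult_ac)
  also have "\<dots> = (\<integral>\<^sup>+s. \<integral>\<^sup>+t. ennreal (pker a (r - t)) * ennreal (pker a (t - s) - pker a (t - s + \<tau>)) * X s \<partial>lborel \<partial>lborel)"
    by (rule lborel_pair.Fubini') measurable
  also have "\<dots> = (\<integral>\<^sup>+s. (\<integral>\<^sup>+t. ennreal (pker a (r - t)) * ennreal (pker a (t - s) - pker a (t - s + \<tau>)) \<partial>lborel) * X s \<partial>lborel)"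
    by (intro nn_integral_cong nn_integral_multc) measurable
  also have "\<dots> \<le> (\<integral>\<^sup>+s. ennreal (4 / a * \<tau> powr a) * (ennreal (pker a (r - s)) * X s) \<partial>lborel)"
  proof (intro nn_integral_mono)
    fix s
    have "(\<integral>\<^sup>+t. ennreal (pker a (r - t)) * ennreal (pker a (t - s) - pker a (t - s + \<tau>)) \<partial>lborel)
      = (\<integral>\<^sup>+x. ennreal (pker a ((r - s) - x)) * ennreal (pker a x - pker a (x + \<tau>)) \<partial>lborel)"
      by (subst nn_integral_real_affine[where c=1 and t=s]) (auto simp: algebra_simps)
    also have "\<dots> \<le> ennreal (4 / a * \<tau> powr a * pker a (r - s))"
      by (rule nn_integral_pker_pker_diff_le[OF a \<tau>(2)])
    also have "\<dots> = ennreal (4 / a * \<tau> powr a) * ennreal (pker a (r - s))"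
      using a by (intro ennreal_mult) auto
    finally show "(\<integral>\<^sup>+t. ennreal (pker a (r - t)) * ennreal (pker a (t - s) - pker a (t - s + \<tau>)) \<partial>lborel) * X s
      \<le> ennreal (4 / a * \<tau> powr a) * (ennreal (pker a (r - s)) * X s)"
      by (subst mult.assoc[symmetric]) (rule mult_right_mono, auto)
  qed
  also have "\<dots> = ennreal (4 / a * \<tau> powr a) * fint a X r"
    unfolding fint_def by (rule nn_integral_cmult) measurable
  finally have "fint a Y r \<le> ?c * (ennreal (4 / a * \<tau> powr a) * fint a X r + ennreal (\<tau> powr a / a) * fint a X r)"
    by (simp add: mult_left_mono add_right_mono)
  also have "\<dots> = (?c * (ennreal (4 / a * \<tau> powr a) + ennreal (\<tau> powr a / a))) * fint a X r"
    by (simp add: distrib_left distrib_right mult_ac)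
  also have "?c * (ennreal (4 / a * \<tau> powr a) + ennreal (\<tau> powr a / a)) = ennreal (10 / a\<^sup>2 * \<tau> powr (2 * a))"
  proof -
    have "2 * \<tau> powr a / a * (4 / a * \<tau> powr a + \<tau> powr a / a) = 10 / a\<^sup>2 * (\<tau> powr a * \<tau> powr a)"
      using a by (simp add: field_simps power2_eq_square)
    also have "\<tau> powr a * \<tau> powr a = \<tau> powr (2 * a)" by (simp add: powr_add[symmetric])
    finally have "2 * \<tau> powr a / a * (4 / a * \<tau> powr a + \<tau> powr a / a) = 10 / a\<^sup>2 * \<tau> powr (2 * a)" .
    moreover have "?c * (ennreal (4 / a * \<tau> powr a) + ennreal (\<tau> powr a / a)) = ennreal (2 * \<tau> powr a / a * (4 / a * \<tau> powr a + \<tau> powr a / a))"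
      using a by (simp add: ennreal_mult[symmetric] ennreal_plus[symmetric] del: ennreal_plus)
    ultimately show ?thesis by simp
  qed
  finally show ?thesis unfolding X_def[abs_def] .
qed

section \<open>Energy solutions satisfy the inclusion pointwise\<close>

lemma Lp_space_2_iff:
  fixes w :: "real \<Rightarrow> 'h::{banach, second_countable_topology}"
  shows "w \<in> Lp_space 2 T \<longleftrightarrow> w \<in> borel_measurable (lebesgue_on {0..T}) \<and>
    integrable (lebesgue_on {0..T}) (\<lambda>t. (norm (w t))\<^sup>2)"
proof -
  have "(\<integral>\<^sup>+t\<in>{0..T}. ennreal (norm (w t) powr 2) \<partial>lebesgue) = (\<integral>\<^sup>+t. ennreal (norm ((norm (w t))\<^sup>2)) \<partial>lebesgue_on {0..T})"
    by (subst nn_integral_restrict_space) (auto simp: powr_numeral)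
  then show ?thesis by (auto simp: Lp_space_def integrable_iff_bounded)
qed

lemma integrable_inner_L2:
  fixes v w :: "'a \<Rightarrow> 'h::{real_inner, banach, second_countable_topology}"
  assumes [measurable]: "v \<in> borel_measurable M" "w \<in> borel_measurable M"
    and v: "integrable M (\<lambda>t. (norm (v t))\<^sup>2)" and w: "integrable M (\<lambda>t. (norm (w t))\<^sup>2)"
  shows "integrable M (\<lambda>t. v t \<bullet> w t)"
proof (rule Bochner_Integration.integrable_bound)
  show "integrable M (\<lambda>t. (norm (v t))\<^sup>2 + (norm (w t))\<^sup>2)" using v w by simp
  show "AE t in M. norm (v t \<bullet> w t) \<le> norm ((norm (v t))\<^sup>2 + (norm (w t))\<^sup>2)"
  proof (intro AE_I2)
    fix t
    have "\<bar>v t \<bullet> w t\<bar> \<le> norm (v t) * norm (w t)" by (rule Cauchy_Schwarz_ineq2)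
    also have "\<dots> \<le> (norm (v t))\<^sup>2 + (norm (w t))\<^sup>2"
    proof -
      have "0 \<le> norm (v t) * norm (w t)" by simp
      then show ?thesis using sum_squares_bound[of "norm (v t)" "norm (w t)"] by linarith
    qed
    finally show "norm (v t \<bullet> w t) \<le> norm ((norm (v t))\<^sup>2 + (norm (w t))\<^sup>2)" by simp
  qed
qed measurable

lemma integrable_diff_L2:
  fixes v w :: "'a \<Rightarrow> 'h::{real_inner, banach, second_countable_topology}"
  assumes [measurable]: "v \<in> borel_measurable M" "w \<in> borel_measurable M"
    and v: "integrable M (\<lambda>t. (norm (v t))\<^sup>2)" and w: "integrable M (\<lambda>t. (norm (w t))\<^sup>2)"
  shows "integrable M (\<lambda>t. (norm (v t - w t))\<^sup>2)"
proof (rule Bochner_Integration.integrable_bound)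
  show "integrable M (\<lambda>t. 2 * (norm (v t))\<^sup>2 + 2 * (norm (w t))\<^sup>2)" using v w by simp
  show "AE t in M. norm ((norm (v t - w t))\<^sup>2) \<le> norm (2 * (norm (v t))\<^sup>2 + 2 * (norm (w t))\<^sup>2)"
  proof (intro AE_I2)
    fix t
    have "0 \<le> (norm (v t + w t))\<^sup>2" by simp
    then have "(norm (v t - w t))\<^sup>2 \<le> 2 * (norm (v t))\<^sup>2 + 2 * (norm (w t))\<^sup>2"
      by (simp add: power2_norm_eq_inner inner_diff_left inner_diff_right inner_add_left inner_add_right inner_commute)
    then show "norm ((norm (v t - w t))\<^sup>2) \<le> norm (2 * (norm (v t))\<^sup>2 + 2 * (norm (w t))\<^sup>2)" by simp
  qed
qed measurable

text \<open>For fixed \<open>v\<close> one tests with \<open>w = v\<close> where the pointwise inequality fails and \<open>w = u\<close> elsewhere.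
  Since \<open>\<Phi>\<close> need not be continuous, the exceptional null set is made independent of \<open>v\<close> by means of a
  countable dense subset of the epigraph.\<close>

lemma AE_subdiff_of_variational_inequality:
  fixes u f Du :: "real \<Rightarrow> 'h::{real_inner, banach, second_countable_topology}"
  assumes gt: "\<forall>w. \<Phi> w \<noteq> -\<infinity>" and u: "u \<in> Lp_space 2 T" and f: "f \<in> Lp_space 2 T"
    and Du: "Du \<in> Lp_space 2 T" and fe: "finite_energy \<Phi> T u"
    and ineq: "\<forall>w\<in>Lp_space 2 T. finite_energy \<Phi> T w \<longrightarrow>
           (LINT t:{0..T}|lebesgue. Du t \<bullet> (u t - w t) + real_of_ereal (\<Phi> (u t)) - real_of_ereal (\<Phi> (w t)))
           \<le> (LINT t:{0..T}|lebesgue. f t \<bullet> (u t - w t))"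
  shows "AE t in lborel. t \<in> {0..T} \<longrightarrow> \<Phi> (u t) < \<infinity> \<and> f t - Du t \<in> subdiff \<Phi> (u t)"
proof -
  define M where "M = lebesgue_on {0..T}"
  have fin: "finite_measure M"
    unfolding M_def by (intro finite_measure_lebesgue_on) (auto simp: fmeasurable_def emeasure_lborel_Icc_eq)
  interpret finite_measure M by fact
  have [measurable]: "u \<in> borel_measurable M" "f \<in> borel_measurable M" "Du \<in> borel_measurable M"
    and u2: "integrable M (\<lambda>t. (norm (u t))\<^sup>2)" and f2: "integrable M (\<lambda>t. (norm (f t))\<^sup>2)"
    and Du2: "integrable M (\<lambda>t. (norm (Du t))\<^sup>2)"
    using u f Du by (auto simp: Lp_space_2_iff M_def)
  define p where "p t = real_of_ereal (\<Phi> (u t))" for t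
  have p: "integrable M p" and dom: "AE t in M. \<Phi> (u t) < \<infinity>"
    using fe unfolding finite_energy_def M_def p_def[abs_def] by auto
  have [measurable]: "p \<in> borel_measurable M" using p by (rule borel_measurable_integrable)
  have lint: "(LINT t:{0..T}|lebesgue. g t) = (\<integral>t. g t \<partial>M)" for g :: "real \<Rightarrow> real"
    unfolding M_def set_lebesgue_integral_def by (subst integral_restrict_space) auto
  have single: "AE t in M. (f t - Du t) \<bullet> (v - u t) \<le> real_of_ereal (\<Phi> v) - p t" if v: "\<Phi> v < \<infinity>" for v
  proof -
    define c where "c = real_of_ereal (\<Phi> v)"
    define g where "g t = (Du t - f t) \<bullet> (u t - v) + p t - c" for t
    have uv2: "integrable M (\<lambda>t. (norm (u t - v))\<^sup>2)" using u2 by (intro integrable_diff_L2) auto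
    have i1: "integrable M (\<lambda>t. Du t \<bullet> (u t - v))" and i2: "integrable M (\<lambda>t. f t \<bullet> (u t - v))"
      using Du2 f2 uv2 by (auto intro!: integrable_inner_L2)
    have g: "integrable M g" unfolding g_def inner_diff_left using i1 i2 p by auto
    have [measurable]: "g \<in> borel_measurable M" using g by (rule borel_measurable_integrable)
    define A where "A = {t \<in> space M. 0 < g t}"
    have [measurable]: "A \<in> sets M" unfolding A_def by measurable
    define w where "w t = (if t \<in> A then v else u t)" for t
    have [measurable]: "w \<in> borel_measurable M" unfolding w_def by measurable
    have "w \<in> Lp_space 2 T"
    proof -
      have "integrable M (\<lambda>t. (norm (w t))\<^sup>2)"
        by (rule Bochner_Integration.integrable_bound[of _ "\<lambda>t. (norm (u t))\<^sup>2 + (norm v)\<^sup>2"])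
           (use u2 in \<open>auto simp: w_def\<close>)
      then show ?thesis by (simp add: Lp_space_2_iff M_def[symmetric])
    qed
    moreover have "finite_energy \<Phi> T w"
    proof -
      have eq: "real_of_ereal (\<Phi> (w t)) = (if t \<in> A then c else p t)" for t
        by (auto simp: w_def c_def p_def)
      have "integrable M (\<lambda>t. real_of_ereal (\<Phi> (w t)))"
        unfolding eq
      proof (rule Bochner_Integration.integrable_bound[of _ "\<lambda>t. \<bar>p t\<bar> + \<bar>c\<bar>"])
        show "integrable M (\<lambda>t. \<bar>p t\<bar> + \<bar>c\<bar>)" using p by simp
      qed auto
      moreover have "AE t in M. \<Phi> (w t) < \<infinity>"
        using dom by eventually_elim (use v in \<open>simp add: w_def\<close>)
      ultimately show ?thesis unfolding finite_energy_def M_def[symmetric] by simp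
    qed
    ultimately have "(\<integral>t. Du t \<bullet> (u t - w t) + p t - real_of_ereal (\<Phi> (w t)) \<partial>M) \<le> (\<integral>t. f t \<bullet> (u t - w t) \<partial>M)"
      using ineq unfolding lint p_def by blast
    moreover have "Du t \<bullet> (u t - w t) + p t - real_of_ereal (\<Phi> (w t)) = indicator A t *\<^sub>R (Du t \<bullet> (u t - v) + p t - c)" for t
      by (auto simp: w_def c_def p_def)
    moreover have "f t \<bullet> (u t - w t) = indicator A t *\<^sub>R (f t \<bullet> (u t - v))" for t
      by (auto simp: w_def)
    ultimately have "(\<integral>t. indicator A t *\<^sub>R (Du t \<bullet> (u t - v) + p t - c) \<partial>M) \<le> (\<integral>t. indicator A t *\<^sub>R (f t \<bullet> (u t - v)) \<partial>M)"
      by simp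
    moreover have "(\<integral>t. indicator A t *\<^sub>R g t \<partial>M) = (\<integral>t. indicator A t *\<^sub>R (Du t \<bullet> (u t - v) + p t - c) - indicator A t *\<^sub>R (f t \<bullet> (u t - v)) \<partial>M)"
      by (intro Bochner_Integration.integral_cong) (auto simp: g_def inner_diff_left algebra_simps)
    moreover have "\<dots> = (\<integral>t. indicator A t *\<^sub>R (Du t \<bullet> (u t - v) + p t - c) \<partial>M) - (\<integral>t. indicator A t *\<^sub>R (f t \<bullet> (u t - v)) \<partial>M)"
      using i1 i2 p by (intro Bochner_Integration.integral_diff integrable_mult_indicator) auto
    ultimately have le0: "(\<integral>t. indicator A t *\<^sub>R g t \<partial>M) \<le> 0" by simp
    have nn: "0 \<le> indicator A t *\<^sub>R g t" for t by (auto simp: A_def indicator_def)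
    have "(\<integral>t. indicator A t *\<^sub>R g t \<partial>M) = 0"
      using le0 Bochner_Integration.integral_nonneg[of M "\<lambda>t. indicator A t *\<^sub>R g t", OF nn] by linarith
    then have "AE t in M. indicator A t *\<^sub>R g t = 0"
      using g nn by (subst (asm) integral_nonneg_eq_0_iff_AE) (auto intro!: integrable_mult_indicator simp del: real_scaleR_def)
    then have "AE t in M. g t \<le> 0"
    proof (rule AE_mp, intro AE_I2 impI)
      fix t assume "t \<in> space M" "indicator A t *\<^sub>R g t = 0"
      then show "g t \<le> 0" by (cases "0 < g t") (auto simp: A_def)
    qed
    then show ?thesis
      by (rule AE_mp) (auto simp: g_def c_def inner_diff_left inner_diff_right intro!: AE_I2)
  qed
  obtain D :: "('h \<times> real) set" where D: "countable D" "D \<subseteq> {(v, r). \<Phi> v \<le> ereal r}"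
    "{(v, r). \<Phi> v \<le> ereal r} \<subseteq> closure D"
    using separable by blast
  have "AE t in M. \<forall>d\<in>D. (f t - Du t) \<bullet> (fst d - u t) \<le> snd d - p t"
  proof (rule AE_ball_countable'[OF _ D(1)])
    fix d assume "d \<in> D"
    then have d: "\<Phi> (fst d) \<le> ereal (snd d)" using D(2) by auto
    then have "\<Phi> (fst d) < \<infinity>" by (cases "\<Phi> (fst d)") auto
    from single[OF this]
    show "AE t in M. (f t - Du t) \<bullet> (fst d - u t) \<le> snd d - p t"
    proof eventually_elim
      case (elim t)
      moreover have "real_of_ereal (\<Phi> (fst d)) \<le> snd d"
        using d gt by (cases "\<Phi> (fst d)") auto
      ultimately show ?case by linarith
    qed
  qed
  then have "AE t in M. \<Phi> (u t) < \<infinity> \<and> f t - Du t \<in> subdiff \<Phi> (u t)"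
    using dom
  proof eventually_elim
    case (elim t)
    have pu: "\<Phi> (u t) = ereal (p t)" using elim gt by (cases "\<Phi> (u t)") (auto simp: p_def)
    have "ereal ((f t - Du t) \<bullet> (v - u t)) \<le> \<Phi> v - \<Phi> (u t)" for v
    proof (cases "\<Phi> v")
      case (real r)
      then have "(v, r) \<in> closure D" using D(3) by auto
      \<comment> \<open>Approximation inside the epigraph controls argument and value at once, so
        the affine inequality passes to the limit without continuity of \<Phi>.\<close>
      then obtain d where d: "\<And>n. d n \<in> D" "d \<longlonglongrightarrow> (v, r)" by (auto simp: closure_sequential)
      have l1: "(\<lambda>n. fst (d n)) \<longlonglongrightarrow> v" and l2: "(\<lambda>n. snd (d n)) \<longlonglongrightarrow> r"
        using tendsto_fst[OF d(2)] tendsto_snd[OF d(2)] by auto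
      have "(f t - Du t) \<bullet> (v - u t) \<le> r - p t"
      proof (rule LIMSEQ_le)
        show "(\<lambda>n. (f t - Du t) \<bullet> (fst (d n) - u t)) \<longlonglongrightarrow> (f t - Du t) \<bullet> (v - u t)"
          by (intro tendsto_intros l1)
        show "(\<lambda>n. snd (d n) - p t) \<longlonglongrightarrow> r - p t" by (intro tendsto_intros l2)
        show "\<exists>N. \<forall>n\<ge>N. (f t - Du t) \<bullet> (fst (d n) - u t) \<le> snd (d n) - p t"
          using elim(1) d(1) by blast
      qed
      then show ?thesis using real pu by simp
    next
      case PInf
      then show ?thesis using pu by simp
    qed (use gt in auto)
    then show ?case using elim by (simp add: subdiff_def)
  qed
  then have "AE t in lebesgue. t \<in> {0..T} \<longrightarrow> \<Phi> (u t) < \<infinity> \<and> f t - Du t \<in> subdiff \<Phi> (u t)"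
    unfolding M_def by (subst (asm) AE_restrict_space_iff) auto
  then show ?thesis by (simp add: AE_completion_iff)
qed

section \<open>Cell averages\<close>

text \<open>The tangent of x^q at m lies below the graph. In this rearranged form it is Young's
  inequality for x and m^(q - 1).\<close>

lemma powr_tangent_le:
  fixes x m :: real
  assumes "1 < q" "0 \<le> x" "0 \<le> m"
  shows "q * (m powr (q - 1) * x) \<le> x powr q + (q - 1) * m powr q"
proof -
  define p where "p = q / (q - 1)"
  have p: "1 < p" "1 / p + 1 / q = 1" using assms(1) by (auto simp: p_def field_simps)
  have "x * m powr (q - 1) \<le> x powr q / q + (m powr (q - 1)) powr p / p"
    using assms p by (intro Youngs_inequality) auto
  also have "(m powr (q - 1)) powr p = m powr q"
    using assms(1) by (simp add: powr_powr p_def)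
  finally have "q * (x * m powr (q - 1)) \<le> q * (x powr q / q + m powr q / p)"
    using assms(1) by (intro mult_left_mono) auto
  also have "\<dots> = x powr q + (q - 1) * m powr q"
    using assms(1) by (simp add: p_def field_simps)
  finally show ?thesis by (simp add: mult_ac)
qed

text \<open>Jensen's inequality by integrating the tangent inequality at the mean m, where the
  linear terms cancel. The cancellation needs a finite right-hand side; the infinite case is
  immediate.\<close>

lemma powr_average_le:
  fixes g :: "real \<Rightarrow> real"
  assumes q: "1 < q" and A: "A \<in> sets lborel" "emeasure lborel A = ennreal \<tau>" "0 < \<tau>"
    and [measurable]: "g \<in> borel_measurable borel" and g: "\<And>x. 0 \<le> g x"
    and fin: "(\<integral>\<^sup>+x\<in>A. ennreal (g x) \<partial>lborel) = ennreal (\<tau> * m)" and m: "0 \<le> m"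
  shows "ennreal \<tau> * ennreal (m powr q) \<le> (\<integral>\<^sup>+x\<in>A. ennreal (g x powr q) \<partial>lborel)"
proof (cases "(\<integral>\<^sup>+x\<in>A. ennreal (g x powr q) \<partial>lborel)")
  case (real i)
  have [measurable]: "A \<in> sets borel" using A by simp
  have "ennreal (q * m powr (q - 1)) * ennreal (\<tau> * m) = (\<integral>\<^sup>+x. ennreal (q * m powr (q - 1)) * (ennreal (g x) * indicator A x) \<partial>lborel)"
    by (subst nn_integral_cmult) (auto simp: fin)
  also have "\<dots> \<le> (\<integral>\<^sup>+x. ennreal (g x powr q) * indicator A x + ennreal ((q - 1) * m powr q) * indicator A x \<partial>lborel)"
  proof (intro nn_integral_mono)
    fix x
    have "q * m powr (q - 1) * g x \<le> g x powr q + (q - 1) * m powr q"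
      using powr_tangent_le[OF q g[of x] m] by (simp add: mult.assoc)
    then have "ennreal (q * m powr (q - 1)) * ennreal (g x) \<le> ennreal (g x powr q) + ennreal ((q - 1) * m powr q)"
      using q g m by (simp add: ennreal_mult[symmetric] ennreal_plus[symmetric] del: ennreal_plus)
    then show "ennreal (q * m powr (q - 1)) * (ennreal (g x) * indicator A x) \<le> ennreal (g x powr q) * indicator A x + ennreal ((q - 1) * m powr q) * indicator A x"
      by (auto simp: indicator_def)
  qed
  also have "\<dots> = ennreal i + ennreal ((q - 1) * m powr q) * ennreal \<tau>"
    using real A by (subst nn_integral_add) (auto simp: nn_integral_cmult_indicator)
  finally have "q * m powr (q - 1) * (\<tau> * m) \<le> i + (q - 1) * m powr q * \<tau>"
    using q m A real by (simp add: ennreal_mult[symmetric] ennreal_plus[symmetric] del: ennreal_plus)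
  moreover have "m powr (q - 1) * m = m powr q"
    using m q powr_mult_base[of m "q - 1"] by (cases "m = 0") (auto simp: mult.commute)
  ultimately have "q * \<tau> * m powr q \<le> i + (q - 1) * m powr q * \<tau>"
    by (metis mult.assoc mult.commute)
  then have "\<tau> * m powr q \<le> i" by (simp add: algebra_simps)
  then show ?thesis using real A by (simp add: ennreal_mult[symmetric])
qed simp

lemma norm_average_powr_le:
  fixes g :: "real \<Rightarrow> 'h::{banach, second_countable_topology}"
  assumes q: "1 < q" and c: "c < d" and [measurable]: "g \<in> borel_measurable borel"
    and int: "set_integrable lborel {c..d} g"
  shows "ennreal (d - c) * ennreal (norm ((1 / (d - c)) *\<^sub>R (LINT x:{c..d}|lborel. g x)) powr q)
    \<le> (\<integral>\<^sup>+x\<in>{c..d}. ennreal (norm (g x) powr q) \<partial>lborel)"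
proof -
  define I where "I = (\<integral>x. norm (indicator {c..d} x *\<^sub>R g x) \<partial>lborel)"
  have I0: "0 \<le> I" unfolding I_def by (rule Bochner_Integration.integral_nonneg) simp
  have "(\<integral>\<^sup>+x. ennreal (norm (indicator {c..d} x *\<^sub>R g x)) \<partial>lborel) = ennreal I"
    unfolding I_def by (intro nn_integral_eq_integral integrable_norm int[unfolded set_integrable_def]) auto
  moreover have "(\<integral>\<^sup>+x. ennreal (norm (indicator {c..d} x *\<^sub>R g x)) \<partial>lborel) = (\<integral>\<^sup>+x\<in>{c..d}. ennreal (norm (g x)) \<partial>lborel)"
    by (intro nn_integral_cong) (auto simp: indicator_def)
  ultimately have nn: "(\<integral>\<^sup>+x\<in>{c..d}. ennreal (norm (g x)) \<partial>lborel) = ennreal ((d - c) * (I / (d - c)))"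
    using c by simp
  have "norm (LINT x:{c..d}|lborel. g x) \<le> I"
    unfolding I_def set_lebesgue_integral_def by (rule integral_norm_bound)
  then have "norm ((1 / (d - c)) *\<^sub>R (LINT x:{c..d}|lborel. g x)) \<le> I / (d - c)"
    using c by (simp add: divide_right_mono)
  then have "ennreal (d - c) * ennreal (norm ((1 / (d - c)) *\<^sub>R (LINT x:{c..d}|lborel. g x)) powr q) \<le> ennreal (d - c) * ennreal ((I / (d - c)) powr q)"
    using q by (intro mult_left_mono ennreal_leI powr_mono2) auto
  also have "\<dots> \<le> (\<integral>\<^sup>+x\<in>{c..d}. ennreal (norm (g x) powr q) \<partial>lborel)"
    using c I0 nn by (intro powr_average_le[OF q]) (auto simp: emeasure_lborel_Icc_eq)
  finally show ?thesis .
qed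

text \<open>For 0 <= y <= x the bound y / x <= (y / x)^a gives x^a - y^a <= (x - y) x^(a - 1). Up to
  a constant the weight of a cell is thus at most its length times the smallest kernel value on
  it.\<close>

lemma cker_le:
  assumes P: "is_partition T N tt" and a: "0 < a" "a \<le> 1" and j: "1 \<le> j" "j \<le> N" and t: "tt j \<le> t"
  shows "cker a tt j t \<le> (tt j - tt (j - 1)) * (t - tt (j - 1)) powr (a - 1) / Gamma (a + 1)"
proof -
  define x y where "x = t - tt (j - 1)" and "y = t - tt j"
  have xy: "0 \<le> y" "y < x" using t partition_strict_mono[OF P, of "j - 1" j] j by (auto simp: x_def y_def)
  have "y / x \<le> (y / x) powr a"
  proof (cases "y = 0")
    case False
    then have "(y / x) powr 1 \<le> (y / x) powr a" using a xy by (intro powr_mono') auto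
    then show ?thesis using xy False by simp
  qed simp
  then have "x powr a * (y / x) \<le> x powr a * (y / x) powr a" by (intro mult_left_mono) auto
  also have "x powr a * (y / x) powr a = y powr a" using xy by (simp add: powr_divide)
  also have "x powr a * (y / x) = x powr (a - 1) * y" using xy by (simp add: powr_diff)
  finally have "x powr a - y powr a \<le> x powr a - x powr (a - 1) * y" by simp
  also have "\<dots> = (x - y) * x powr (a - 1)" using xy by (simp add: powr_diff field_simps)
  finally have "(x powr a - y powr a) / Gamma (a + 1) \<le> (x - y) * x powr (a - 1) / Gamma (a + 1)"
    using a by (intro divide_right_mono) auto
  then show ?thesis using xy by (simp add: cker_def x_def y_def max_def)
qed

text \<open>On each cell the smallest kernel value is a constant factor, so Jensen's inequality with
  exponent 2 applies to the average; afterwards that value is replaced by the kernel itself under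
  the integral.\<close>

lemma sum_cker_cell_average_le:
  fixes f :: "real \<Rightarrow> 'h::{banach, second_countable_topology}"
  assumes P: "is_partition T N tt" and a: "0 < a" "a \<le> 1" and [measurable]: "f \<in> borel_measurable borel"
    and int: "integrable lborel f" and n: "n \<le> N"
    and F: "\<And>j. j \<in> {1..N} \<Longrightarrow> F j = (1 / (tt j - tt (j - 1))) *\<^sub>R (LINT s:{tt (j - 1)..tt j}|lborel. f s)"
  shows "ennreal (\<Sum>j=1..n. cker a tt j (tt n) * (norm (F j))\<^sup>2)
    \<le> ennreal (1 / Gamma (a + 1)) * fint a (\<lambda>s. ennreal ((norm (f s))\<^sup>2)) (tt n)"
proof -
  let ?g = "\<lambda>s. ennreal (pker a (tt n - s)) * ennreal ((norm (f s))\<^sup>2)"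
  have G: "0 < Gamma (a + 1)" using a by simp
  have cell: "ennreal (cker a tt j (tt n) * (norm (F j))\<^sup>2) \<le> ennreal (1 / Gamma (a + 1)) * (\<integral>\<^sup>+s\<in>{tt (j - 1)<..tt j}. ?g s \<partial>lborel)"
    if j: "j \<in> {1..n}" for j
  proof -
    have jN: "1 \<le> j" "j \<le> N" "j \<in> {1..N}" using j n by auto
    have lt: "tt (j - 1) < tt j" using partition_strict_mono[OF P, of "j - 1" j] jN by simp
    have le: "tt j \<le> tt n" using partition_mono[OF P, of j n] j n by simp
    define k where "k = (tt n - tt (j - 1)) powr (a - 1)"
    have k0: "0 \<le> k" by (simp add: k_def)
    have "cker a tt j (tt n) * (norm (F j))\<^sup>2 \<le> ((tt j - tt (j - 1)) * k / Gamma (a + 1)) * (norm (F j))\<^sup>2"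
      unfolding k_def using cker_le[OF P a jN(1,2) le] by (intro mult_right_mono) auto
    then have "ennreal (cker a tt j (tt n) * (norm (F j))\<^sup>2) \<le> ennreal (k / Gamma (a + 1) * ((tt j - tt (j - 1)) * norm (F j) powr 2))"
      by (intro ennreal_leI) (simp add: powr_numeral mult_ac)
    also have "\<dots> = ennreal (k / Gamma (a + 1)) * (ennreal (tt j - tt (j - 1)) * ennreal (norm (F j) powr 2))"
    proof -
      have "ennreal (x * (y * z)) = ennreal x * (ennreal y * ennreal z)" if "0 \<le> x" "0 \<le> y" "0 \<le> z" for x y z :: real
        using that by (simp add: ennreal_mult)
      then show ?thesis using k0 G lt by (simp only: zero_le_divide_iff less_imp_le diff_ge_0_iff_ge powr_ge_zero simp_thms)
    qed
    also have "\<dots> \<le> ennreal (k / Gamma (a + 1)) * (\<integral>\<^sup>+s\<in>{tt (j - 1)..tt j}. ennreal (norm (f s) powr 2) \<partial>lborel)"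
    proof (rule mult_left_mono)
      have "set_integrable lborel {tt (j - 1)..tt j} f"
        unfolding set_integrable_def using int by (intro integrable_mult_indicator) auto
      then show "ennreal (tt j - tt (j - 1)) * ennreal (norm (F j) powr 2) \<le> (\<integral>\<^sup>+s\<in>{tt (j - 1)..tt j}. ennreal (norm (f s) powr 2) \<partial>lborel)"
        unfolding F[OF jN(3)] using lt by (intro norm_average_powr_le) auto
    qed simp
    also have "\<dots> = ennreal (1 / Gamma (a + 1)) * (\<integral>\<^sup>+s. ennreal k * (ennreal (norm (f s) powr 2) * indicator {tt (j - 1)..tt j} s) \<partial>lborel)"
    proof -
      have "ennreal (k / Gamma (a + 1)) = ennreal (1 / Gamma (a + 1)) * ennreal k"
        using G k0 by (simp add: ennreal_mult[symmetric])
      then show ?thesis by (simp add: nn_integral_cmult mult.assoc)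
    qed
    also have "\<dots> \<le> ennreal (1 / Gamma (a + 1)) * (\<integral>\<^sup>+s\<in>{tt (j - 1)<..tt j}. ?g s \<partial>lborel)"
    proof (rule mult_left_mono, rule nn_integral_mono_AE)
      show "AE s in lborel. ennreal k * (ennreal (norm (f s) powr 2) * indicator {tt (j - 1)..tt j} s) \<le> ?g s * indicator {tt (j - 1)<..tt j} s"
        using AE_lborel_singleton[of "tt (j - 1)"] AE_lborel_singleton[of "tt n"]
      proof eventually_elim
        case (elim s)
        show ?case
        proof (cases "s \<in> {tt (j - 1)<..tt j}")
          case True
          then have "k \<le> pker a (tt n - s)" using elim le a by (auto simp: k_def pker_def intro!: powr_mono2')
          then show ?thesis using True by (auto simp: powr_numeral intro!: mult_right_mono ennreal_leI)
        next
          case False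
          then have "s \<notin> {tt (j - 1)..tt j}" using elim by auto
          then show ?thesis by simp
        qed
      qed
    qed simp
    finally show ?thesis .
  qed
  have "ennreal (\<Sum>j=1..n. cker a tt j (tt n) * (norm (F j))\<^sup>2) = (\<Sum>j=1..n. ennreal (cker a tt j (tt n) * (norm (F j))\<^sup>2))"
    using n cker_nonneg[OF P a(1)] by (intro sum_ennreal[symmetric] mult_nonneg_nonneg) auto
  also have "\<dots> \<le> (\<Sum>j=1..n. ennreal (1 / Gamma (a + 1)) * (\<integral>\<^sup>+s\<in>{tt (j - 1)<..tt j}. ?g s \<partial>lborel))"
    by (intro sum_mono cell)
  also have "\<dots> = ennreal (1 / Gamma (a + 1)) * (\<integral>\<^sup>+s. (\<Sum>j=1..n. ?g s * indicator {tt (j - 1)<..tt j} s) \<partial>lborel)"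
    by (subst sum_distrib_left[symmetric], subst nn_integral_sum) auto
  also have "\<dots> \<le> ennreal (1 / Gamma (a + 1)) * (\<integral>\<^sup>+s. ?g s \<partial>lborel)"
  proof (intro mult_left_mono nn_integral_mono)
    fix s
    show "(\<Sum>j=1..n. ?g s * indicator {tt (j - 1)<..tt j} s) \<le> ?g s"
    proof (cases "\<exists>m\<in>{1..n}. tt (m - 1) < s \<and> s \<le> tt m")
      case True
      then obtain m where m: "m \<in> {1..n}" "tt (m - 1) < s" "s \<le> tt m" by blast
      have "(\<Sum>j=1..n. ?g s * indicator {tt (j - 1)<..tt j} s) = (\<Sum>j\<in>{1..n}. if j = m then ?g s else 0)"
      proof (rule sum.cong[OF refl])
        fix j assume j: "j \<in> {1..n}"
        show "?g s * indicator {tt (j - 1)<..tt j} s = (if j = m then ?g s else 0)"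
        proof (cases "j = m")
          case False
          have "j \<in> {1..N}" "m \<in> {1..N}" using j m n by auto
          then have "\<not> (tt (j - 1) < s \<and> s \<le> tt j)" using cell_unique[OF P, of m j s] m False by blast
          then show ?thesis using False by simp
        qed (use m in simp)
      qed
      also have "\<dots> = ?g s" using m(1) by (simp add: sum.delta)
      finally show ?thesis by (rule eq_refl)
    next
      case False
      have "(\<Sum>j=1..n. ?g s * indicator {tt (j - 1)<..tt j} s) = 0"
      proof (rule sum.neutral, rule ballI)
        fix j assume "j \<in> {1..n}"
        then have "s \<notin> {tt (j - 1)<..tt j}" using False by auto
        then show "?g s * indicator {tt (j - 1)<..tt j} s = 0" by simp
      qed
      then show ?thesis by (rule order_trans[OF eq_refl]) simp
    qed
  qed simp
  finally show ?thesis unfolding fint_def .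
qed

text \<open>Jensen's inequality on the cell of length h, then \<open>\<bar>s - y\<bar>\<close> <= h
  inserts the Gagliardo weight at the cost of h^(1 + \<sigma> q). One factor h cancels against the
  averaging, the rest is at most \<tau>^(\<sigma> q).\<close>

lemma powr_norm_diff_average_le:
  fixes f :: "real \<Rightarrow> 'h::{banach, second_countable_topology}"
  assumes P: "is_partition T N tt" and q: "1 < q" and \<sigma>: "0 < \<sigma>" and [measurable]: "f \<in> borel_measurable borel"
    and int: "integrable lborel f" and \<tau>: "max_step N tt \<le> \<tau>"
    and n: "n \<in> {1..N}" "tt (n - 1) < s" "s \<le> tt n"
    and F: "F = (1 / (tt n - tt (n - 1))) *\<^sub>R (LINT y:{tt (n - 1)..tt n}|lborel. f y)"
  shows "ennreal (norm (f s - F) powr q) \<le> ennreal (\<tau> powr (\<sigma> * q)) *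
     (\<integral>\<^sup>+y\<in>{0..T}. ennreal (norm (f s - f y) powr q / \<bar>s - y\<bar> powr (1 + \<sigma> * q)) \<partial>lborel)"
proof -
  define c d where "c = tt (n - 1)" and "d = tt n"
  define h where "h = d - c"
  have h: "0 < h" "c < d" using n by (auto simp: c_def d_def h_def)
  have h\<tau>: "h \<le> \<tau>" using max_step_bound[OF n(1), of tt] \<tau> by (simp add: h_def c_def d_def)
  have nN: "n \<le> N" "n - 1 \<le> N" using n(1) by auto
  have cd: "0 \<le> c" "d \<le> T"
    using partition_bounds[OF P nN(1)] partition_bounds[OF P nN(2)] by (auto simp: c_def d_def)
  have fi: "set_integrable lborel {c..d} f"
    unfolding set_integrable_def using int by (intro integrable_mult_indicator) auto
  have ci: "set_integrable lborel {c..d} (\<lambda>y. f s)"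
    unfolding set_integrable_def using h by (intro integrable_scaleR_left integrable_real_indicator) (auto simp: emeasure_lborel_Icc_eq)
  have "(LINT y:{c..d}|lborel. f s - f y) = (LINT y:{c..d}|lborel. f s) - (LINT y:{c..d}|lborel. f y)"
    by (rule set_integral_diff(2)[OF ci fi])
  also have "(LINT y:{c..d}|lborel. f s) = h *\<^sub>R f s"
    unfolding set_lebesgue_integral_def h_def using h by simp
  finally have "(1 / h) *\<^sub>R (LINT y:{c..d}|lborel. f s - f y) = f s - F"
    using h unfolding F c_def[symmetric] d_def[symmetric] h_def[symmetric] by (simp add: scaleR_diff_right)
  then have "ennreal h * ennreal (norm (f s - F) powr q) = ennreal (d - c) * ennreal (norm ((1 / (d - c)) *\<^sub>R (LINT y:{c..d}|lborel. f s - f y)) powr q)"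
    by (simp add: h_def)
  also have "\<dots> \<le> (\<integral>\<^sup>+y\<in>{c..d}. ennreal (norm (f s - f y) powr q) \<partial>lborel)"
    using h set_integral_diff(1)[OF ci fi] by (intro norm_average_powr_le[OF q]) auto
  also have "\<dots> \<le> (\<integral>\<^sup>+y. ennreal (h * \<tau> powr (\<sigma> * q)) * (ennreal (norm (f s - f y) powr q / \<bar>s - y\<bar> powr (1 + \<sigma> * q)) * indicator {0..T} y) \<partial>lborel)"
  proof (intro nn_integral_mono)
    fix y
    show "ennreal (norm (f s - f y) powr q) * indicator {c..d} y
      \<le> ennreal (h * \<tau> powr (\<sigma> * q)) * (ennreal (norm (f s - f y) powr q / \<bar>s - y\<bar> powr (1 + \<sigma> * q)) * indicator {0..T} y)"
    proof (cases "y \<in> {c..d} \<and> y \<noteq> s")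
      case True
      have "\<bar>s - y\<bar> \<le> h" using True n by (auto simp: h_def c_def d_def)
      then have "\<bar>s - y\<bar> powr (1 + \<sigma> * q) \<le> h powr (1 + \<sigma> * q)" using q \<sigma> by (intro powr_mono2) auto
      also have "\<dots> = h * h powr (\<sigma> * q)" using h by (simp add: powr_add)
      also have "\<dots> \<le> h * \<tau> powr (\<sigma> * q)" using h h\<tau> q \<sigma> by (intro mult_left_mono powr_mono2) auto
      finally have "norm (f s - f y) powr q * (\<bar>s - y\<bar> powr (1 + \<sigma> * q)) \<le> norm (f s - f y) powr q * (h * \<tau> powr (\<sigma> * q))"
        by (intro mult_left_mono) auto
      then have "norm (f s - f y) powr q \<le> (h * \<tau> powr (\<sigma> * q)) * (norm (f s - f y) powr q / \<bar>s - y\<bar> powr (1 + \<sigma> * q))"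
        using True by (simp add: field_simps)
      then have "ennreal (norm (f s - f y) powr q) \<le> ennreal (h * \<tau> powr (\<sigma> * q)) * ennreal (norm (f s - f y) powr q / \<bar>s - y\<bar> powr (1 + \<sigma> * q))"
        using h by (subst ennreal_mult[symmetric]) (auto intro: ennreal_leI)
      then show ?thesis using True cd by (auto simp: indicator_def)
    next
      case False
      then have "y \<notin> {c..d} \<or> y = s" by auto
      then show ?thesis using q by auto
    qed
  qed
  also have "\<dots> = ennreal h * (ennreal (\<tau> powr (\<sigma> * q)) * (\<integral>\<^sup>+y\<in>{0..T}. ennreal (norm (f s - f y) powr q / \<bar>s - y\<bar> powr (1 + \<sigma> * q)) \<partial>lborel))"
    using h by (simp add: nn_integral_cmult ennreal_mult mult.assoc)
  finally show ?thesis
    using h by (subst (asm) ennreal_mult_le_mult_iff) auto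
qed

section \<open>Weighted norm estimates\<close>

text \<open>The weighted estimates below balance two terms at a scale y that must be positive. If
  the data bound y0 vanishes, the limit along y = 1/(n + 1) replaces the choice y = y0.\<close>

lemma le_powr_limit:
  fixes A :: ennreal
  assumes le: "\<And>y. 0 < y \<Longrightarrow> y0 \<le> y \<Longrightarrow> A \<le> ennreal (K * y powr \<theta>)" and \<theta>: "0 < \<theta>" and y0: "0 \<le> y0"
  shows "A \<le> ennreal (K * y0 powr \<theta>)"
proof (cases "y0 = 0")
  case True
  have "(\<lambda>n. K * (1 / real (Suc n)) powr \<theta>) \<longlonglongrightarrow> K * 0 powr \<theta>"
    using \<theta> LIMSEQ_Suc[OF lim_1_over_n] by (intro tendsto_intros tendsto_powr2) auto
  then have "(\<lambda>n. ennreal (K * (1 / real (Suc n)) powr \<theta>)) \<longlonglongrightarrow> ennreal (K * 0 powr \<theta>)"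
    by (rule tendsto_ennrealI)
  moreover have "A \<le> ennreal (K * (1 / real (Suc n)) powr \<theta>)" for n
    using True by (intro le) auto
  ultimately have "A \<le> ennreal (K * 0 powr \<theta>)" by (intro LIMSEQ_le_const) auto
  then show ?thesis using True by simp
next
  case False
  then show ?thesis using y0 by (intro le) auto
qed

text \<open>Young's inequality with a free scale y and without sharp constants: the comparison of x
  with y k^(1/(q - 1)) decides which of the two terms suffices.\<close>

lemma mult_le_split_powr:
  fixes k x y :: real
  assumes q: "1 < q" and "0 \<le> k" "0 \<le> x" "0 < y"
  shows "k * x \<le> y * k powr (q / (q - 1)) + y powr (1 - q) * x powr q"
proof -
  define r where "r = 1 / (q - 1)"
  have r: "0 < r" "q / (q - 1) = r + 1" using q by (auto simp: r_def field_simps)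
  have nn: "0 \<le> y * k powr (r + 1)" "0 \<le> y powr (1 - q) * x powr q" using assms by auto
  show ?thesis
  proof (cases "x \<le> y * k powr r")
    case True
    then have "k * x \<le> k * (y * k powr r)" using assms by (intro mult_left_mono) auto
    also have "\<dots> = y * k powr (r + 1)"
      using assms powr_mult_base[of k r] by (simp add: mult_ac add.commute)
    finally show ?thesis unfolding r(2) using nn by linarith
  next
    case False
    then have "k powr r \<le> x / y" using assms by (simp add: field_simps)
    then have "(k powr r) powr (q - 1) \<le> (x / y) powr (q - 1)" using q by (intro powr_mono2) auto
    moreover have "(k powr r) powr (q - 1) = k" using q assms by (simp add: powr_powr r_def)
    ultimately have "k * x \<le> (x / y) powr (q - 1) * x" using assms by (intro mult_right_mono) auto
    also have "\<dots> = y powr (1 - q) * x powr q"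
    proof -
      have "x * x powr (q - 1) = x powr q" using assms powr_mult_base[of x "q - 1"] by simp
      moreover have "y powr (1 - q) = 1 / y powr (q - 1)" using powr_minus_divide[of y "q - 1"] by simp
      ultimately show ?thesis using assms by (simp add: powr_divide mult.commute)
    qed
    finally show ?thesis unfolding r(2) using nn by linarith
  qed
qed

text \<open>Hoelder's inequality through Young's at the scale of the L^q norm. The dual power of the
  kernel is again a kernel, \<open>pker e\<close>, and q > 1/a says precisely that e > 0, so that it
  has finite mass.\<close>

lemma fint_holder_le:
  fixes x :: "real \<Rightarrow> real"
  assumes a: "0 < a" "a < 1" and q: "1 / a < q" and [measurable]: "x \<in> borel_measurable borel"
    and x: "\<And>s. 0 \<le> x s" "\<And>s. s < 0 \<Longrightarrow> x s = 0"
    and int: "(\<integral>\<^sup>+s. ennreal (x s powr q) \<partial>lborel) \<le> ennreal (y0 powr q)" and y0: "0 \<le> y0" and t: "t \<le> T"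
    and e: "e = q / (q - 1) * (a - 1) + 1"
  shows "fint a (\<lambda>s. ennreal (x s)) t \<le> ennreal ((max 0 T powr e / e + 1) * y0)"
proof -
  have "1 < 1 / a" using a by simp
  then have q1: "1 < q" using q by simp
  have e0: "0 < e"
  proof -
    have "1 < q * a" using q a by (simp add: field_simps)
    then have "0 < (q * (a - 1) + (q - 1)) / (q - 1)" using q1 by (intro divide_pos_pos) (auto simp: algebra_simps)
    also have "\<dots> = e" using q1 by (simp add: e add_divide_distrib)
    finally show ?thesis .
  qed
  have kp: "pker a r powr (q / (q - 1)) = pker e r" for r
    using q1 by (simp add: pker_def powr_powr e mult.commute)
  have "fint a (\<lambda>s. ennreal (x s)) t \<le> ennreal ((max 0 T powr e / e + 1) * y powr 1)" if y: "0 < y" "y0 \<le> y" for y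
  proof -
    have "fint a (\<lambda>s. ennreal (x s)) t \<le> (\<integral>\<^sup>+s. ennreal y * (ennreal (pker e (t - s)) * indicator {0..} s)
        + ennreal (y powr (1 - q)) * ennreal (x s powr q) \<partial>lborel)"
      unfolding fint_def
    proof (intro nn_integral_mono)
      fix s
      show "ennreal (pker a (t - s)) * ennreal (x s) \<le> ennreal y * (ennreal (pker e (t - s)) * indicator {0..} s)
        + ennreal (y powr (1 - q)) * ennreal (x s powr q)"
      proof (cases "s < 0")
        case False
        have "pker a (t - s) * x s \<le> y * pker e (t - s) + y powr (1 - q) * x s powr q"
          using mult_le_split_powr[OF q1 pker_nonneg[of a "t - s"] x(1)[of s] y(1)] unfolding kp .
        then have "ennreal (pker a (t - s) * x s) \<le> ennreal (y * pker e (t - s) + y powr (1 - q) * x s powr q)"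
          by (rule ennreal_leI)
        then show ?thesis using False x y by (simp add: ennreal_mult)
      qed (simp add: x)
    qed
    also have "\<dots> = ennreal y * ennreal (max 0 t powr e / e) + ennreal (y powr (1 - q)) * (\<integral>\<^sup>+s. ennreal (x s powr q) \<partial>lborel)"
      using e0 by (subst nn_integral_add) (auto simp: nn_integral_cmult nn_integral_pker_line)
    also have "\<dots> \<le> ennreal y * ennreal (max 0 T powr e / e) + ennreal (y powr (1 - q)) * ennreal (y powr q)"
    proof (intro add_mono mult_left_mono)
      show "ennreal (max 0 t powr e / e) \<le> ennreal (max 0 T powr e / e)"
        using e0 t by (intro ennreal_leI divide_right_mono powr_mono2) auto
      have "ennreal (y0 powr q) \<le> ennreal (y powr q)" using y y0 q1 by (intro ennreal_leI powr_mono2) auto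
      then show "(\<integral>\<^sup>+s. ennreal (x s powr q) \<partial>lborel) \<le> ennreal (y powr q)" using int by (rule order_trans[rotated])
    qed auto
    also have "\<dots> = ennreal (y * (max 0 T powr e / e) + y powr (1 - q) * y powr q)"
      using y e0 by (simp add: ennreal_mult[symmetric] ennreal_plus[symmetric] del: ennreal_plus)
    also have "y * (max 0 T powr e / e) + y powr (1 - q) * y powr q = (max 0 T powr e / e + 1) * y powr 1"
      using y by (simp add: powr_add[symmetric] algebra_simps)
    finally show ?thesis .
  qed
  from le_powr_limit[of y0, OF this _ y0] show ?thesis using y0 by simp
qed

text \<open>Jensen's inequality for a concave power, from x^\<theta> <= y^(\<theta> - 1) x +
  y^\<theta> at the scale y of the integral of X.\<close>

lemma fint_powr_le:
  fixes X :: "real \<Rightarrow> real"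
  assumes a: "0 < a" and \<theta>: "0 < \<theta>" "\<theta> \<le> 1" and [measurable]: "X \<in> borel_measurable borel"
    and X: "\<And>s. 0 \<le> X s" "\<And>s. s < 0 \<Longrightarrow> X s = 0"
    and int: "fint a (\<lambda>s. ennreal (X s)) t \<le> ennreal y0" and y0: "0 \<le> y0" and t: "t \<le> T"
  shows "fint a (\<lambda>s. ennreal (X s powr \<theta>)) t \<le> ennreal ((1 + max 0 T powr a / a) * y0 powr \<theta>)"
proof (rule le_powr_limit[OF _ \<theta>(1) y0])
  fix y :: real assume y: "0 < y" "y0 \<le> y"
  have pt: "x powr \<theta> \<le> y powr (\<theta> - 1) * x + y powr \<theta>" if "0 \<le> x" for x
  proof (cases "x \<le> y")
    case True
    then have "x powr \<theta> \<le> y powr \<theta>" using that \<theta> by (intro powr_mono2) auto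
    moreover have "0 \<le> y powr (\<theta> - 1) * x" using that by simp
    ultimately show ?thesis by linarith
  next
    case False
    then have "x powr (\<theta> - 1) \<le> y powr (\<theta> - 1)" using \<theta> y by (intro powr_mono2') auto
    then have "x powr (\<theta> - 1) * x \<le> y powr (\<theta> - 1) * x" using that by (intro mult_right_mono) auto
    moreover have "x powr (\<theta> - 1) * x = x powr \<theta>" using that powr_mult_base[of x "\<theta> - 1"] by (simp add: mult.commute)
    moreover have "0 \<le> y powr \<theta>" by simp
    ultimately show ?thesis by linarith
  qed
  have "fint a (\<lambda>s. ennreal (X s powr \<theta>)) t \<le> (\<integral>\<^sup>+s. ennreal (y powr (\<theta> - 1)) * (ennreal (pker a (t - s)) * ennreal (X s))
     + ennreal (y powr \<theta>) * (ennreal (pker a (t - s)) * indicator {0..} s) \<partial>lborel)"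
    unfolding fint_def
  proof (intro nn_integral_mono)
    fix s
    show "ennreal (pker a (t - s)) * ennreal (X s powr \<theta>) \<le> ennreal (y powr (\<theta> - 1)) * (ennreal (pker a (t - s)) * ennreal (X s))
     + ennreal (y powr \<theta>) * (ennreal (pker a (t - s)) * indicator {0..} s)"
    proof (cases "s < 0")
      case False
      have "pker a (t - s) * X s powr \<theta> \<le> pker a (t - s) * (y powr (\<theta> - 1) * X s + y powr \<theta>)"
        by (intro mult_left_mono pt X) auto
      then have "ennreal (pker a (t - s) * X s powr \<theta>) \<le> ennreal (y powr (\<theta> - 1) * (pker a (t - s) * X s) + y powr \<theta> * pker a (t - s))"
        by (intro ennreal_leI) (simp add: algebra_simps)
      then show ?thesis using False X by (simp add: ennreal_mult)
    qed (simp add: X)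
  qed
  also have "\<dots> = ennreal (y powr (\<theta> - 1)) * fint a (\<lambda>s. ennreal (X s)) t + ennreal (y powr \<theta>) * ennreal (max 0 t powr a / a)"
    unfolding fint_def using a by (subst nn_integral_add) (auto simp: nn_integral_cmult nn_integral_pker_line)
  also have "\<dots> \<le> ennreal (y powr (\<theta> - 1)) * ennreal y + ennreal (y powr \<theta>) * ennreal (max 0 T powr a / a)"
  proof (intro add_mono mult_left_mono)
    show "fint a (\<lambda>s. ennreal (X s)) t \<le> ennreal y" using int y by (meson ennreal_leI order_trans)
    show "ennreal (max 0 t powr a / a) \<le> ennreal (max 0 T powr a / a)"
      using a t by (intro ennreal_leI divide_right_mono powr_mono2) auto
  qed auto
  also have "\<dots> = ennreal (y powr (\<theta> - 1) * y + y powr \<theta> * (max 0 T powr a / a))"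
    using y a by (simp add: ennreal_mult[symmetric] ennreal_plus[symmetric] del: ennreal_plus)
  also have "y powr (\<theta> - 1) * y + y powr \<theta> * (max 0 T powr a / a) = (1 + max 0 T powr a / a) * y powr \<theta>"
    using y powr_mult_base[of y "\<theta> - 1"] by (simp add: algebra_simps)
  finally show "fint a (\<lambda>s. ennreal (X s powr \<theta>)) t \<le> ennreal ((1 + max 0 T powr a / a) * y powr \<theta>)" .
qed

text \<open>Integrating a fractional integral once more gives order 1 + a, whose kernel is
  bounded.\<close>

lemma nn_integral_fint_le:
  assumes a: "0 < a" and [measurable]: "g \<in> borel_measurable borel" and g0: "\<And>s. s < 0 \<Longrightarrow> g s = 0"
  shows "(\<integral>\<^sup>+t\<in>{..<T}. fint a g t \<partial>lborel) \<le> ennreal (Beta 1 a * max 0 T powr a) * (\<integral>\<^sup>+s. g s \<partial>lborel)"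
proof -
  have B: "0 \<le> Beta 1 a" using a by (simp add: Beta_def less_imp_le)
  have "(\<integral>\<^sup>+t\<in>{..<T}. fint a g t \<partial>lborel) = fint 1 (fint a g) T"
    unfolding fint_def[of 1] by (intro nn_integral_cong) (auto simp: pker_def indicator_def)
  also have "\<dots> = ennreal (Beta 1 a) * fint (1 + a) g T" using a by (intro fint_fint) auto
  also have "\<dots> \<le> ennreal (Beta 1 a) * (ennreal (max 0 T powr (1 + a - 1)) * (\<integral>\<^sup>+s. g s \<partial>lborel))"
    using a g0 by (intro mult_left_mono fint_ge_1_le) auto
  also have "\<dots> = ennreal (Beta 1 a * max 0 T powr a) * (\<integral>\<^sup>+s. g s \<partial>lborel)"
    using B by (simp add: ennreal_mult mult.assoc)
  finally show ?thesis .
qed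

lemma AE_fint_finite:
  assumes a: "0 < a" and [measurable]: "g \<in> borel_measurable borel" and g0: "\<And>s. s < 0 \<Longrightarrow> g s = 0"
    and fin: "(\<integral>\<^sup>+s. g s \<partial>lborel) < \<infinity>"
  shows "AE t in lborel. t < T \<longrightarrow> fint a g t < \<infinity>"
proof -
  have "(\<integral>\<^sup>+t\<in>{..<T}. fint a g t \<partial>lborel) \<le> ennreal (Beta 1 a * max 0 T powr a) * (\<integral>\<^sup>+s. g s \<partial>lborel)"
    using a g0 by (intro nn_integral_fint_le) auto
  also have "\<dots> < \<infinity>" using fin by (simp add: ennreal_mult_less_top)
  finally have "(\<integral>\<^sup>+t\<in>{..<T}. fint a g t \<partial>lborel) < \<infinity>" .
  then have "AE t in lborel. fint a g t * indicator {..<T} t \<noteq> \<infinity>"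
    by (intro nn_integral_PInf_AE) auto
  then show ?thesis by eventually_elim (auto simp: less_top[symmetric])
qed

text \<open>Cauchy-Schwarz with respect to the kernel on [0, t], of total mass t^a / a.\<close>

lemma fint_square_le:
  assumes a: "0 < a" and [measurable]: "g \<in> borel_measurable borel" and g0: "\<And>s. s < 0 \<Longrightarrow> g s = 0"
  shows "(fint a g t)\<^sup>2 \<le> ennreal (max 0 t powr a / a) * fint a (\<lambda>s. (g s)\<^sup>2) t"
proof -
  have sq: "ennreal (sqrt (pker a r)) * ennreal (sqrt (pker a r)) = ennreal (pker a r)" for r
    by (simp add: ennreal_mult[symmetric])
  have "fint a g t = (\<integral>\<^sup>+s. (ennreal (sqrt (pker a (t - s))) * indicator {0..} s) * (ennreal (sqrt (pker a (t - s))) * g s) \<partial>lborel)"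
    unfolding fint_def
  proof (intro nn_integral_cong)
    fix s
    show "ennreal (pker a (t - s)) * g s = (ennreal (sqrt (pker a (t - s))) * indicator {0..} s) * (ennreal (sqrt (pker a (t - s))) * g s)"
      using g0[of s] sq[of "t - s"] by (cases "s < 0") (auto simp: mult.assoc[symmetric])
  qed
  then have "(fint a g t)\<^sup>2 \<le> (\<integral>\<^sup>+s. (ennreal (sqrt (pker a (t - s))) * indicator {0..} s)\<^sup>2 \<partial>lborel) * (\<integral>\<^sup>+s. (ennreal (sqrt (pker a (t - s))) * g s)\<^sup>2 \<partial>lborel)"
    by (simp only:) (rule Cauchy_Schwarz_nn_integral; measurable)
  also have "(\<integral>\<^sup>+s. (ennreal (sqrt (pker a (t - s))) * indicator {0..} s)\<^sup>2 \<partial>lborel) = (\<integral>\<^sup>+s. ennreal (pker a (t - s)) * indicator {0..} s \<partial>lborel)"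
    by (intro nn_integral_cong) (auto simp: indicator_def power2_eq_square sq)
  also have "\<dots> = ennreal (max 0 t powr a / a)" by (rule nn_integral_pker_line[OF a])
  also have "(\<integral>\<^sup>+s. (ennreal (sqrt (pker a (t - s))) * g s)\<^sup>2 \<partial>lborel) = fint a (\<lambda>s. (g s)\<^sup>2) t"
    unfolding fint_def by (intro nn_integral_cong) (simp add: power_mult_distrib power2_eq_square[of "ennreal _"] sq)
  finally show ?thesis .
qed

text \<open>These are the two finiteness conditions of \<open>fractional_chain_inequality\<close>.
  They hold almost everywhere because \<open>norm D\<close> and its product with its own fractional
  integral are integrable, the latter by x y <= x^2 + y^2 and \<open>fint_square_le\<close>.\<close>

lemma AE_good_times:
  fixes D :: "real \<Rightarrow> 'h::{banach, second_countable_topology}"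
  assumes a: "0 < a" and [measurable]: "D \<in> borel_measurable borel"
    and D0: "\<And>s. s \<notin> {0..T} \<Longrightarrow> D s = 0" and fin: "(\<integral>\<^sup>+s. ennreal ((norm (D s))\<^sup>2) \<partial>lborel) < \<infinity>"
  shows "AE t in lborel. t < T \<longrightarrow> fint a (\<lambda>s. ennreal (norm (D s))) t < \<infinity> \<and>
      fint a (\<lambda>s. ennreal (norm (D s)) * fint a (\<lambda>s. ennreal (norm (D s))) s) t < \<infinity>"
proof -
  let ?n = "\<lambda>s. ennreal (norm (D s))"
  have prod_le: "x * y \<le> x\<^sup>2 + y\<^sup>2" for x y :: ennreal
  proof (cases "x \<le> y")
    case True
    then have "x * y \<le> y * y" by (rule mult_right_mono) simp
    then show ?thesis by (simp add: power2_eq_square add_increasing)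
  next
    case False
    then have "x * y \<le> x * x" by (intro mult_left_mono) auto
    then show ?thesis by (simp add: power2_eq_square add_increasing2)
  qed
  have n0: "?n s = 0" if "s < 0" for s using that D0 by simp
  have n2: "(?n s)\<^sup>2 = ennreal ((norm (D s))\<^sup>2)" for s by (simp add: ennreal_power)
  have "(\<integral>\<^sup>+s. ?n s \<partial>lborel) \<le> (\<integral>\<^sup>+s. indicator {0..T} s + ennreal ((norm (D s))\<^sup>2) \<partial>lborel)"
  proof (intro nn_integral_mono)
    fix s
    show "?n s \<le> indicator {0..T} s + ennreal ((norm (D s))\<^sup>2)"
      using prod_le[of 1 "?n s"] D0[of s] by (cases "s \<in> {0..T}") (auto simp: n2)
  qed
  also have "\<dots> = emeasure lborel {0..T} + (\<integral>\<^sup>+s. ennreal ((norm (D s))\<^sup>2) \<partial>lborel)"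
    by (subst nn_integral_add) auto
  also have "\<dots> < \<infinity>" using fin by (simp add: emeasure_lborel_Icc_eq)
  finally have f1: "(\<integral>\<^sup>+s. ?n s \<partial>lborel) < \<infinity>" .
  have "(\<integral>\<^sup>+s. ?n s * fint a ?n s \<partial>lborel) \<le> (\<integral>\<^sup>+s. ennreal ((norm (D s))\<^sup>2) + ennreal (max 0 T powr a / a) * (fint a (\<lambda>s. ennreal ((norm (D s))\<^sup>2)) s * indicator {..<T} s) \<partial>lborel)"
  proof (rule nn_integral_mono_AE)
    show "AE s in lborel. ?n s * fint a ?n s \<le> ennreal ((norm (D s))\<^sup>2) + ennreal (max 0 T powr a / a) * (fint a (\<lambda>s. ennreal ((norm (D s))\<^sup>2)) s * indicator {..<T} s)"
      using AE_lborel_singleton[of T]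
    proof eventually_elim
      case (elim s)
      show ?case
      proof (cases "s < T")
        case True
        have "(fint a ?n s)\<^sup>2 \<le> ennreal (max 0 s powr a / a) * fint a (\<lambda>s. (?n s)\<^sup>2) s"
          using a n0 by (intro fint_square_le) auto
        also have "\<dots> \<le> ennreal (max 0 T powr a / a) * fint a (\<lambda>s. (?n s)\<^sup>2) s"
          using True a by (intro mult_right_mono ennreal_leI divide_right_mono powr_mono2) auto
        finally have "(?n s)\<^sup>2 + (fint a ?n s)\<^sup>2 \<le> ennreal ((norm (D s))\<^sup>2) + ennreal (max 0 T powr a / a) * fint a (\<lambda>s. ennreal ((norm (D s))\<^sup>2)) s"
          unfolding n2 by (rule add_left_mono)
        from order_trans[OF prod_le this] show ?thesis using True by simp
      next
        case False
        then show ?thesis using elim D0[of s] by simp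
      qed
    qed
  qed
  also have "\<dots> = (\<integral>\<^sup>+s. ennreal ((norm (D s))\<^sup>2) \<partial>lborel) + ennreal (max 0 T powr a / a) * (\<integral>\<^sup>+s\<in>{..<T}. fint a (\<lambda>s. ennreal ((norm (D s))\<^sup>2)) s \<partial>lborel)"
    by (subst nn_integral_add) (auto simp: nn_integral_cmult)
  also have "\<dots> < \<infinity>"
  proof -
    have "(\<integral>\<^sup>+s\<in>{..<T}. fint a (\<lambda>s. ennreal ((norm (D s))\<^sup>2)) s \<partial>lborel) \<le> ennreal (Beta 1 a * max 0 T powr a) * (\<integral>\<^sup>+s. ennreal ((norm (D s))\<^sup>2) \<partial>lborel)"
      using a D0 by (intro nn_integral_fint_le) auto
    also have "\<dots> < \<infinity>" using fin by (simp add: ennreal_mult_less_top)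
    finally show ?thesis using fin by (simp add: ennreal_mult_less_top)
  qed
  finally have f2: "(\<integral>\<^sup>+s. ?n s * fint a ?n s \<partial>lborel) < \<infinity>" .
  have "AE t in lborel. t < T \<longrightarrow> fint a ?n t < \<infinity>"
    using a f1 n0 by (intro AE_fint_finite) auto
  moreover have "AE t in lborel. t < T \<longrightarrow> fint a (\<lambda>s. ?n s * fint a ?n s) t < \<infinity>"
    using a f2 n0 by (intro AE_fint_finite) auto
  ultimately show ?thesis by eventually_elim auto
qed

section \<open>Coercivity moduli and passage to all times\<close>

text \<open>An infinite value at z would make the right-hand side of the subgradient inequality at w
  equal to -\<infinity>.\<close>

lemma subdiff_finite:
  assumes gt: "\<forall>w. \<Phi> w \<noteq> -\<infinity>" and \<xi>: "\<xi> \<in> subdiff \<Phi> z" and w: "\<Phi> w < \<infinity>"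
  shows "\<Phi> z < \<infinity>"
proof -
  have "ereal (\<xi> \<bullet> (w - z)) \<le> \<Phi> w - \<Phi> z" using \<xi> by (simp add: subdiff_def)
  then show ?thesis using w gt by (cases "\<Phi> w"; cases "\<Phi> z") auto
qed

lemma coercivity_modulus_le:
  assumes \<xi>: "\<xi> \<in> subdiff \<Phi> w" and w: "\<Phi> w = ereal p" and h: "\<Phi> h = ereal r"
  shows "coercivity_modulus \<Phi> w h \<le> ereal (r - p - \<xi> \<bullet> (h - w))" and "0 \<le> r - p - \<xi> \<bullet> (h - w)"
proof -
  have "coercivity_modulus \<Phi> w h \<le> \<Phi> h - \<Phi> w - ereal (\<xi> \<bullet> (h - w))"
    unfolding coercivity_modulus_def using \<xi> by (intro ereal_minus_mono order_refl SUP_upper)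
  then show "coercivity_modulus \<Phi> w h \<le> ereal (r - p - \<xi> \<bullet> (h - w))" using w h by simp
  have "ereal (\<xi> \<bullet> (h - w)) \<le> \<Phi> h - \<Phi> w" using \<xi> by (simp add: subdiff_def)
  then show "0 \<le> r - p - \<xi> \<bullet> (h - w)" using w h by simp
qed

text \<open>The two subgradient inequalities and the assumed upper bound for \<open>\<Phi> h - \<Phi> z\<close> add up; the
  values of \<open>\<Phi>\<close> cancel.\<close>

lemma coercivity_moduli_sum_le:
  fixes \<Phi> :: "'h::real_inner \<Rightarrow> ereal"
  assumes gt: "\<forall>w. \<Phi> w \<noteq> -\<infinity>" and \<xi>\<^sub>1: "\<xi>\<^sub>1 \<in> subdiff \<Phi> w" and w: "\<Phi> w < \<infinity>" and \<xi>\<^sub>2: "\<xi>\<^sub>2 \<in> subdiff \<Phi> z"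
    and h: "\<Phi> h - \<Phi> z - ereal (\<xi>\<^sub>2 \<bullet> (h - z)) \<le> ereal r"
  shows "e2ennreal (coercivity_modulus \<Phi> w h + coercivity_modulus \<Phi> z w) \<le> ennreal (r + (\<xi>\<^sub>1 - \<xi>\<^sub>2) \<bullet> (w - h))"
    and "0 \<le> r + (\<xi>\<^sub>1 - \<xi>\<^sub>2) \<bullet> (w - h)"
proof -
  obtain p where p: "\<Phi> w = ereal p" using w gt by (cases "\<Phi> w") auto
  obtain z' where z': "\<Phi> z = ereal z'" using subdiff_finite[OF gt \<xi>\<^sub>2 w] gt by (cases "\<Phi> z") auto
  obtain h' where h': "\<Phi> h = ereal h'" using h gt z' by (cases "\<Phi> h") auto
  note 1 = coercivity_modulus_le[OF \<xi>\<^sub>1 p h'] and 2 = coercivity_modulus_le[OF \<xi>\<^sub>2 z' p]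
  have r: "h' - z' - \<xi>\<^sub>2 \<bullet> (h - z) \<le> r" using h z' h' by simp
  have eq: "(h' - p - \<xi>\<^sub>1 \<bullet> (h - w)) + (p - z' - \<xi>\<^sub>2 \<bullet> (w - z)) = (h' - z' - \<xi>\<^sub>2 \<bullet> (h - z)) + (\<xi>\<^sub>1 - \<xi>\<^sub>2) \<bullet> (w - h)"
    by (simp add: inner_diff_left inner_diff_right)
  have "coercivity_modulus \<Phi> w h + coercivity_modulus \<Phi> z w \<le> ereal (h' - p - \<xi>\<^sub>1 \<bullet> (h - w)) + ereal (p - z' - \<xi>\<^sub>2 \<bullet> (w - z))"
    by (intro add_mono 1 2)
  also have "\<dots> \<le> ereal (r + (\<xi>\<^sub>1 - \<xi>\<^sub>2) \<bullet> (w - h))" using r eq by simp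
  finally show "e2ennreal (coercivity_modulus \<Phi> w h + coercivity_modulus \<Phi> z w) \<le> ennreal (r + (\<xi>\<^sub>1 - \<xi>\<^sub>2) \<bullet> (w - h))"
    unfolding e2ennreal_ereal[symmetric] by (rule e2ennreal_mono)
  show "0 \<le> r + (\<xi>\<^sub>1 - \<xi>\<^sub>2) \<bullet> (w - h)" using 1(2) 2(2) r eq by linarith
qed

lemma AE_dense_sequence:
  assumes T: "0 < T" and ae: "AE t in lborel. t \<in> {0<..<T} \<longrightarrow> Q t" and t: "t \<in> {0..T}"
  shows "\<exists>s :: nat \<Rightarrow> real. (\<forall>n. s n \<in> {0<..<T} \<and> Q (s n)) \<and> s \<longlonglongrightarrow> t"
proof -
  have "\<exists>x. x \<in> {0<..<T} \<and> Q x \<and> \<bar>x - t\<bar> < \<epsilon>" if \<epsilon>: "0 < \<epsilon>" for \<epsilon>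
  proof (rule ccontr)
    assume no: "\<not> ?thesis"
    define c d where "c = max 0 (t - \<epsilon>)" and "d = min T (t + \<epsilon>)"
    have cd: "c < d" using T t \<epsilon> by (auto simp: c_def d_def)
    have "x \<notin> {c<..<d}" if "x \<in> {0<..<T} \<longrightarrow> Q x" for x
      using no that by (auto simp: c_def d_def)
    then have "AE x in lborel. x \<notin> {c<..<d}" using ae by (auto elim!: AE_mp)
    then have "emeasure lborel {c<..<d} = 0"
      by (subst (asm) AE_iff_null_sets[symmetric]) auto
    then show False using cd by (simp add: emeasure_lborel_Ioo)
  qed
  then have "\<exists>x. x \<in> {0<..<T} \<and> Q x \<and> \<bar>x - t\<bar> < 1 / real (Suc n)" for n by simp
  then obtain s where s: "\<And>n. s n \<in> {0<..<T} \<and> Q (s n) \<and> \<bar>s n - t\<bar> < 1 / real (Suc n)" by metis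
  have "s \<longlonglongrightarrow> t"
  proof (rule Lim_null[THEN iffD2], rule Lim_null_comparison)
    show "\<forall>\<^sub>F n in sequentially. norm (s n - t) \<le> 1 / real (Suc n)"
      using s by (intro always_eventually allI) (simp add: less_imp_le)
    show "(\<lambda>n. 1 / real (Suc n)) \<longlonglongrightarrow> 0" by (rule LIMSEQ_Suc[OF lim_1_over_n])
  qed
  then show ?thesis using s by blast
qed

lemma pker_tendsto:
  assumes "s \<longlonglongrightarrow> t" "t \<noteq> x"
  shows "(\<lambda>n. pker a (s n - x)) \<longlonglongrightarrow> pker a (t - x)"
proof (cases "x < t")
  case True
  have "\<forall>\<^sub>F n in sequentially. x < s n" using assms(1) True by (rule order_tendstoD)
  then have ev: "\<forall>\<^sub>F n in sequentially. (s n - x) powr (a - 1) = pker a (s n - x)"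
    by eventually_elim (simp add: pker_def)
  have "(\<lambda>n. (s n - x) powr (a - 1)) \<longlonglongrightarrow> (t - x) powr (a - 1)"
    using True by (intro tendsto_powr tendsto_diff tendsto_const assms(1)) auto
  from Lim_transform_eventually[OF this ev] show ?thesis using True by (simp add: pker_def)
next
  case False
  then have "t < x" using assms by simp
  with assms(1) have "\<forall>\<^sub>F n in sequentially. s n < x" by (rule order_tendstoD)
  then have "\<forall>\<^sub>F n in sequentially. pker a (s n - x) = pker a (t - x)"
    by eventually_elim (use False in simp)
  then show ?thesis by (rule tendsto_eventually)
qed

text \<open>Fatou's lemma, since the kernels at the times \<open>s n\<close> converge pointwise
  except at x = t.\<close>

lemma fint_lower_semicontinuous:
  assumes s: "s \<longlonglongrightarrow> t" and [measurable]: "G \<in> borel_measurable borel"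
  shows "fint a (\<lambda>x. ennreal (G x)) t \<le> liminf (\<lambda>n. fint a (\<lambda>x. ennreal (G x)) (s n))"
proof -
  have eq: "ennreal (pker a r) * ennreal (G x) = ennreal (pker a r * max 0 (G x))" for r x
    by (simp add: ennreal_mult max_def ennreal_neg)
  have "fint a (\<lambda>x. ennreal (G x)) t = (\<integral>\<^sup>+x. liminf (\<lambda>n. ennreal (pker a (s n - x) * max 0 (G x))) \<partial>lborel)"
    unfolding fint_def eq
  proof (rule nn_integral_cong_AE)
    show "AE x in lborel. ennreal (pker a (t - x) * max 0 (G x)) = liminf (\<lambda>n. ennreal (pker a (s n - x) * max 0 (G x)))"
      using AE_lborel_singleton[of t]
    proof eventually_elim
      case (elim x)
      have "(\<lambda>n. ennreal (pker a (s n - x) * max 0 (G x))) \<longlonglongrightarrow> ennreal (pker a (t - x) * max 0 (G x))"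
        using elim s by (intro tendsto_ennrealI tendsto_mult pker_tendsto tendsto_const) auto
      from lim_imp_Liminf[OF trivial_limit_sequentially this] show ?case by (rule sym)
    qed
  qed
  also have "\<dots> \<le> liminf (\<lambda>n. \<integral>\<^sup>+x. ennreal (pker a (s n - x) * max 0 (G x)) \<partial>lborel)"
    by (rule nn_integral_liminf) measurable
  finally show ?thesis unfolding fint_def eq .
qed

lemma AE_bound_imp_bound:
  assumes T: "0 < T" and E: "continuous_on {0..T} E" "\<And>t. t \<in> {0..T} \<Longrightarrow> 0 \<le> E t"
    and [measurable]: "G \<in> borel_measurable borel"
    and ae: "AE t in lborel. t \<in> {0<..<T} \<longrightarrow> ennreal (E t) + fint a (\<lambda>x. ennreal (G x)) t \<le> ennreal K"
    and K: "0 \<le> K" and t: "t \<in> {0..T}"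
  shows "ennreal (E t) + fint a (\<lambda>x. ennreal (G x)) t \<le> ennreal K" and "E t \<le> K"
proof -
  obtain s where s: "\<And>n. s n \<in> {0<..<T}" "s \<longlonglongrightarrow> t"
      and le: "\<And>n. ennreal (E (s n)) + fint a (\<lambda>x. ennreal (G x)) (s n) \<le> ennreal K"
    using AE_dense_sequence[OF T ae t] by blast
  have Es: "0 \<le> E (s n)" "E (s n) \<le> K" for n
  proof -
    show "0 \<le> E (s n)" using s(1)[of n] by (intro E) auto
    have "ennreal (E (s n)) \<le> ennreal K" using le[of n] by (rule order_trans[rotated]) simp
    then show "E (s n) \<le> K" using K by simp
  qed
  have lim: "(\<lambda>n. E (s n)) \<longlonglongrightarrow> E t"
    using s t by (intro continuous_on_tendsto_compose[OF E(1) s(2)]) (auto intro!: always_eventually less_imp_le)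
  then show Et: "E t \<le> K" using Es by (intro LIMSEQ_le_const2) auto
  have "fint a (\<lambda>x. ennreal (G x)) t \<le> liminf (\<lambda>n. fint a (\<lambda>x. ennreal (G x)) (s n))"
    by (rule fint_lower_semicontinuous[OF s(2)]) measurable
  also have "\<dots> \<le> liminf (\<lambda>n. ennreal (K - E (s n)))"
  proof (rule Liminf_mono, rule always_eventually, rule allI)
    fix n
    have "fint a (\<lambda>x. ennreal (G x)) (s n) \<le> ennreal K - ennreal (E (s n))"
      using le[of n] by (simp add: ennreal_le_minus_iff add.commute)
    then show "fint a (\<lambda>x. ennreal (G x)) (s n) \<le> ennreal (K - E (s n))"
      using Es by (simp add: ennreal_minus)
  qed
  also have "\<dots> = ennreal (K - E t)"
    by (intro lim_imp_Liminf tendsto_ennrealI tendsto_diff tendsto_const lim) simp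
  finally have "ennreal (E t) + fint a (\<lambda>x. ennreal (G x)) t \<le> ennreal (E t) + ennreal (K - E t)"
    by (rule add_left_mono)
  also have "\<dots> = ennreal K" using Et E(2)[OF t] by (simp add: ennreal_plus[symmetric] del: ennreal_plus)
  finally show "ennreal (E t) + fint a (\<lambda>x. ennreal (G x)) t \<le> ennreal K" .
qed

section \<open>Square roots and the quadratic inequality\<close>

lemma ennreal_powr_half_square: "(ennreal_powr x (1 / 2))\<^sup>2 = x"
proof (cases x)
  case (real r)
  have "(r powr (1 / 2))\<^sup>2 = r" using real by (simp add: powr_half_sqrt)
  then show ?thesis using real by (simp add: ennreal_powr_def ennreal_power)
qed (simp add: ennreal_powr_def)

lemma ennreal_powr_half_le:
  assumes "x \<le> ennreal (Z\<^sup>2)" "0 \<le> Z"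
  shows "ennreal_powr x (1 / 2) \<le> ennreal Z"
proof (cases x)
  case (real r)
  then have "r \<le> Z\<^sup>2" using assms by simp
  then have "sqrt r \<le> Z" using assms(2) real_le_lsqrt[of Z r] by simp
  then show ?thesis using real by (simp add: ennreal_powr_def powr_half_sqrt ennreal_leI)
qed (use assms in \<open>simp add: top_unique\<close>)

lemma nonneg_integrable_bound:
  fixes h :: "real \<Rightarrow> real"
  assumes [measurable]: "h \<in> borel_measurable borel" and h: "\<And>x. 0 \<le> h x"
    and le: "(\<integral>\<^sup>+x. ennreal (h x) \<partial>lborel) \<le> ennreal A" and A: "0 \<le> A"
  shows "integrable lborel h" and "(\<integral>x. h x \<partial>lborel) \<le> A"
proof -
  show int: "integrable lborel h"
    using le h by (intro integrableI_nonneg) (auto intro: le_less_trans)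
  have "ennreal (\<integral>x. h x \<partial>lborel) = (\<integral>\<^sup>+x. ennreal (h x) \<partial>lborel)"
    using int h by (intro nn_integral_eq_integral[symmetric]) auto
  then have "ennreal (\<integral>x. h x \<partial>lborel) \<le> ennreal A" using le by simp
  then show "(\<integral>x. h x \<partial>lborel) \<le> A" using A by simp
qed

text \<open>With b = a + sqrt A the hypothesis gives m^2 <= b^2 + 2 B m, hence m <= b + 2 B, which
  is inserted back. Here a is the initial error, whose coefficient remains 1.\<close>

lemma quadratic_bound:
  fixes a A B m :: real
  assumes "0 \<le> a" "0 \<le> A" "0 \<le> B" and le: "m\<^sup>2 \<le> a\<^sup>2 + A + 2 * B * m"
  shows "a\<^sup>2 + A + 2 * B * m \<le> (a + sqrt A + 2 * B)\<^sup>2"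
proof -
  define b where "b = a + sqrt A"
  have b: "0 \<le> b" using assms by (simp add: b_def)
  have "a\<^sup>2 + A \<le> b\<^sup>2" using assms by (simp add: b_def power2_sum)
  have m: "m \<le> b + 2 * B"
  proof (rule ccontr)
    assume *: "\<not> m \<le> b + 2 * B"
    then have "0 < m" "b < m - 2 * B" "b \<le> m" using assms b by auto
    then have "b * b \<le> m * b" "m * b < m * (m - 2 * B)"
      using b by (auto intro: mult_right_mono mult_strict_left_mono)
    then have "b\<^sup>2 < m\<^sup>2 - 2 * B * m" by (simp add: power2_eq_square algebra_simps)
    then show False using le \<open>a\<^sup>2 + A \<le> b\<^sup>2\<close> by linarith
  qed
  have "a\<^sup>2 + A + 2 * B * m \<le> b\<^sup>2 + 2 * B * (b + 2 * B)"
    using \<open>a\<^sup>2 + A \<le> b\<^sup>2\<close> m assms by (intro add_mono mult_left_mono) auto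
  also have "\<dots> \<le> (b + 2 * B)\<^sup>2" using b assms by (simp add: power2_eq_square algebra_simps)
  finally show ?thesis by (simp add: b_def)
qed

section \<open>The error in terms of the residuals\<close>

lemma nn_integral_square_diff_finite:
  fixes v w :: "real \<Rightarrow> 'h::real_inner"
  assumes [measurable]: "(\<lambda>s. ennreal ((norm (v s))\<^sup>2)) \<in> borel_measurable borel" "(\<lambda>s. ennreal ((norm (w s))\<^sup>2)) \<in> borel_measurable borel"
    and v: "(\<integral>\<^sup>+s. ennreal ((norm (v s))\<^sup>2) \<partial>lborel) < \<infinity>" and w: "(\<integral>\<^sup>+s. ennreal ((norm (w s))\<^sup>2) \<partial>lborel) < \<infinity>"
  shows "(\<integral>\<^sup>+s. ennreal ((norm (v s - w s))\<^sup>2) \<partial>lborel) < \<infinity>"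
proof -
  have "(\<integral>\<^sup>+s. ennreal ((norm (v s - w s))\<^sup>2) \<partial>lborel) \<le> (\<integral>\<^sup>+s. 2 * ennreal ((norm (v s))\<^sup>2) + 2 * ennreal ((norm (w s))\<^sup>2) \<partial>lborel)"
  proof (intro nn_integral_mono)
    fix s
    have "0 \<le> (norm (v s + w s))\<^sup>2" by simp
    then have "(norm (v s - w s))\<^sup>2 \<le> 2 * (norm (v s))\<^sup>2 + 2 * (norm (w s))\<^sup>2"
      by (simp add: power2_norm_eq_inner inner_diff_left inner_diff_right inner_add_left inner_add_right inner_commute)
    then have "ennreal ((norm (v s - w s))\<^sup>2) \<le> ennreal (2 * (norm (v s))\<^sup>2 + 2 * (norm (w s))\<^sup>2)" by (rule ennreal_leI)
    then show "ennreal ((norm (v s - w s))\<^sup>2) \<le> 2 * ennreal ((norm (v s))\<^sup>2) + 2 * ennreal ((norm (w s))\<^sup>2)"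
      by (simp add: ennreal_mult)
  qed
  also have "\<dots> = 2 * (\<integral>\<^sup>+s. ennreal ((norm (v s))\<^sup>2) \<partial>lborel) + 2 * (\<integral>\<^sup>+s. ennreal ((norm (w s))\<^sup>2) \<partial>lborel)"
    using assms(1,2) by (simp add: nn_integral_add nn_integral_cmult)
  also have "\<dots> < \<infinity>" using v w by (simp add: ennreal_mult_less_top)
  finally show ?thesis .
qed

text \<open>At a node the fractional integral of the piecewise constant derivative is the
  convolution sum. Thus every U n lies in the range of the interpolant, where the assumed upper
  bound may be used with U n as base point.\<close>

lemma interp_frac_at_node:
  fixes U :: "nat \<Rightarrow> 'h::{banach, second_countable_topology}"
  assumes P: "is_partition T N tt" and a: "0 < a" and n: "n \<le> N"
  shows "interp_frac a N tt U (tt n) = U n"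
proof -
  let ?V = "discrete_caputo a N tt U"
  have G: "0 < Gamma a" using a by simp
  have "interp_frac a N tt U (tt n) = U 0 + (1 / Gamma a) *\<^sub>R (\<Sum>j=1..N. (Gamma a * cker a tt j (tt n)) *\<^sub>R ?V j)"
    unfolding interp_frac_eq[OF P partition_bounds(2)[OF P n]] rl_step_fun[OF P a] ..
  also have "(1 / Gamma a) *\<^sub>R (\<Sum>j=1..N. (Gamma a * cker a tt j (tt n)) *\<^sub>R ?V j) = (\<Sum>j=1..N. cker a tt j (tt n) *\<^sub>R ?V j)"
    unfolding scaleR_sum_right using G by (intro sum.cong) auto
  also have "\<dots> = (\<Sum>j=1..n. cker a tt j (tt n) *\<^sub>R ?V j)"
    using n cker_eq_0[OF P, of n _ "tt n" a] by (intro sum.mono_neutral_right) auto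
  also have "U 0 + \<dots> = U n" by (rule sum_K_matrix_discrete_caputo[OF P a n, symmetric])
  finally show ?thesis .
qed

text \<open>The analysis is separated from the rates: \<open>Ax\<close> measures the gap between the
  interpolants, \<open>Ay\<close> the averaging error of the data. The first enters under a square
  root because it bounds the squared error, the second linearly because it is paired with the
  error.\<close>

lemma error_bound_of_residuals:
  fixes u f D :: "real \<Rightarrow> 'h::{real_inner, banach, second_countable_topology}" and U F :: "nat \<Rightarrow> 'h"
  assumes T: "0 < T" and a: "0 < a" "a < 1" and gt: "\<forall>w. \<Phi> w \<noteq> -\<infinity>"
    and u_cont: "continuous_on {0..T} u"
    and D [measurable]: "D \<in> borel_measurable borel" and D0: "\<And>s. s \<notin> {0..T} \<Longrightarrow> D s = 0"
    and D2: "(\<integral>\<^sup>+s. ennreal ((norm (D s))\<^sup>2) \<partial>lborel) < \<infinity>"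
    and f [measurable]: "f \<in> borel_measurable borel"
    and u_rep: "AE t in lborel. t \<in> {0..T} \<longrightarrow> u t = u0 + (1 / Gamma a) *\<^sub>R rl a D t"
    and u_sub: "AE t in lborel. t \<in> {0..T} \<longrightarrow> \<Phi> (u t) < \<infinity> \<and> f t - D t \<in> subdiff \<Phi> (u t)"
    and P: "is_partition T N tt"
    and sub: "\<And>n. n \<in> {1..N} \<Longrightarrow> F n - discrete_caputo a N tt U n \<in> subdiff \<Phi> (U n)"
    and Cb: "0 \<le> Cb"
    and up: "\<forall>w\<^sub>1\<in>interp_frac a N tt U ` {0..T}. \<forall>w\<^sub>2\<in>interp_frac a N tt U ` {0..T}. \<forall>\<xi>\<^sub>1\<in>subdiff \<Phi> w\<^sub>1.
         \<Phi> w\<^sub>2 - \<Phi> w\<^sub>1 - ereal (\<xi>\<^sub>1 \<bullet> (w\<^sub>2 - w\<^sub>1)) \<le> ereal (Cb * norm (w\<^sub>2 - w\<^sub>1) powr (1 + \<beta>))"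
    and Ax: "0 \<le> Ax" "\<And>t. t \<le> T \<Longrightarrow> fint a (\<lambda>s. ennreal (indicator {0<..T} s * norm (interp_frac a N tt U s - step_fun N tt U s) powr (1 + \<beta>))) t \<le> ennreal Ax"
    and Ay: "0 \<le> Ay" "\<And>t. t \<le> T \<Longrightarrow> fint a (\<lambda>s. ennreal (norm (indicator {0<..T} s *\<^sub>R (f s - step_fun N tt F s)))) t \<le> ennreal Ay"
  shows "err_total a T \<Phi> N tt U u \<le> ennreal (norm (u0 - U 0) + sqrt (2 / Gamma a * (Cb * Ax)) + 2 * (1 / Gamma a * Ay))"
proof -
  define c where "c = 1 / Gamma a"
  have c: "0 < c" using a by (simp add: c_def)
  define V where "V = discrete_caputo a N tt U"
  define Vb where "Vb = step_fun N tt V"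
  have [measurable]: "Vb \<in> borel_measurable borel" unfolding Vb_def by measurable
  have Vb0: "Vb s = 0" if "s \<le> 0 \<or> T < s" for s unfolding Vb_def using that by (rule step_fun_outside[OF P])
  define MV where "MV = (\<Sum>n=1..N. norm (V n))"
  have MV: "norm (Vb s) \<le> MV" for s unfolding Vb_def MV_def by (rule norm_step_fun_le)
  define Uh where "Uh t = U 0 + c *\<^sub>R rl a Vb t" for t
  have Uh_eq: "interp_frac a N tt U t = Uh t" if "t \<le> T" for t
    unfolding Uh_def Vb_def V_def c_def using that by (rule interp_frac_eq[OF P])
  have Vb_int: "integrable lborel (\<lambda>s. pker a (t - s) *\<^sub>R Vb s)" for t
    using a MV Vb0 by (intro rl_integrable_bounded) auto
  have Uh_cont: "continuous_on {0..T} Uh"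
    unfolding Uh_def using a MV Vb0
    by (intro continuous_intros continuous_on_subset[OF continuous_on_rl[of a Vb MV]]) auto
  define e where "e t = indicator {0..T} t *\<^sub>R (u t - Uh t)" for t
  have e_cont: "continuous_on {0..T} e"
  proof -
    have "continuous_on {0..T} (\<lambda>t. u t - Uh t)" by (intro continuous_intros u_cont Uh_cont)
    then show ?thesis by (rule continuous_on_eq) (simp add: e_def)
  qed
  have [measurable]: "e \<in> borel_measurable borel"
    unfolding e_def[abs_def] by (intro borel_measurable_continuous_on_indicator continuous_intros u_cont Uh_cont) auto
  have e_out: "e t = 0" if "t \<notin> {0..T}" for t using that by (simp add: e_def)
  obtain t1 where t1: "t1 \<in> {0..T}" "\<And>t. t \<in> {0..T} \<Longrightarrow> norm (e t) \<le> norm (e t1)"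
    using continuous_attains_sup[of "{0..T}" "\<lambda>t. norm (e t)"] T e_cont continuous_on_norm by fastforce
  \<comment> \<open>The maximal error, finite by continuity but not yet estimated; it is eliminated
    through \<open>quadratic_bound\<close>.\<close>
  define m where "m = norm (e t1)"
  have m: "norm (e t) \<le> m" for t using t1(2)[of t] e_out[of t] by (cases "t \<in> {0..T}") (auto simp: m_def)
  have m0: "0 \<le> m" by (simp add: m_def)
  define e0 where "e0 = u0 - U 0"
  define De where "De s = D s - Vb s" for s
  have [measurable]: "De \<in> borel_measurable borel" unfolding De_def by measurable
  have De0: "De s = 0" if "s \<notin> {0..T}" for s using that D0 Vb0 by (auto simp: De_def)
  have Vb2: "(\<integral>\<^sup>+s. ennreal ((norm (Vb s))\<^sup>2) \<partial>lborel) < \<infinity>"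
  proof -
    have "(\<integral>\<^sup>+s. ennreal ((norm (Vb s))\<^sup>2) \<partial>lborel) \<le> (\<integral>\<^sup>+s. ennreal (MV\<^sup>2) * indicator {0..T} s \<partial>lborel)"
    proof (intro nn_integral_mono)
      fix s
      show "ennreal ((norm (Vb s))\<^sup>2) \<le> ennreal (MV\<^sup>2) * indicator {0..T} s"
        using MV[of s] Vb0[of s] by (cases "s \<in> {0..T}") (auto intro!: ennreal_leI power_mono)
    qed
    also have "\<dots> < \<infinity>" using T by (simp add: nn_integral_cmult_indicator emeasure_lborel_Icc_eq ennreal_mult_less_top)
    finally show ?thesis .
  qed
  have De2: "(\<integral>\<^sup>+s. ennreal ((norm (De s))\<^sup>2) \<partial>lborel) < \<infinity>"
    unfolding De_def by (rule nn_integral_square_diff_finite[OF _ _ D2 Vb2]) auto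
  have goodD: "AE t in lborel. t < T \<longrightarrow> fint a (\<lambda>s. ennreal (norm (D s))) t < \<infinity>"
    using AE_good_times[of a D T] a(1) D D0 D2 by auto
  have e_rep: "AE t in lborel. t \<in> {0..T} \<longrightarrow> e t = e0 + c *\<^sub>R rl a De t"
    using u_rep goodD AE_lborel_singleton[of T]
  proof eventually_elim
    case (elim t)
    show ?case
    proof
      assume t: "t \<in> {0..T}"
      then have "fint a (\<lambda>s. ennreal (norm (D s))) t < \<infinity>" using elim by auto
      then have "integrable lborel (\<lambda>s. pker a (t - s) *\<^sub>R D s)" by (rule rl_integrable[OF D])
      then have "rl a De t = rl a D t - rl a Vb t"
        using Vb_int[of t] by (simp add: rl_def De_def scaleR_diff_right)
      then show "e t = e0 + c *\<^sub>R rl a De t"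
        using elim t by (simp add: e_def Uh_def e0_def c_def[symmetric] scaleR_diff_right)
    qed
  qed
  define x where "x s = indicator {0<..T} s * norm (Uh s - step_fun N tt U s) powr (1 + \<beta>)" for s :: real
  define y where "y s = indicator {0<..T} s *\<^sub>R (f s - step_fun N tt F s)" for s :: real
  have [measurable]: "Uh \<in> borel_measurable borel" unfolding Uh_def by measurable
  have [measurable]: "x \<in> borel_measurable borel" "y \<in> borel_measurable borel"
    unfolding x_def y_def by measurable
  have x0: "0 \<le> x s" for s by (simp add: x_def)
  have xAR: "fint a (\<lambda>s. ennreal (x s)) t \<le> ennreal Ax" if "t \<le> T" for t
  proof -
    have "x s = indicator {0<..T} s * norm (interp_frac a N tt U s - step_fun N tt U s) powr (1 + \<beta>)" for s
      by (cases "s \<in> {0<..T}") (auto simp: x_def Uh_eq)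
    then show ?thesis using Ax(2)[OF that] by simp
  qed
  have yAB: "fint a (\<lambda>s. ennreal (norm (y s))) t \<le> ennreal Ay" if "t \<le> T" for t
    unfolding y_def using that by (rule Ay(2))
  \<comment> \<open>A Borel majorant of the sum of the two moduli; the integrals that have to be
    computed are those of \<open>G\<close>.\<close>
  define G where "G s = Cb * x s + y s \<bullet> e s - De s \<bullet> e s" for s
  have [measurable]: "G \<in> borel_measurable borel" unfolding G_def by measurable
  have G_out: "G s = 0" if "s \<notin> {0..T}" for s using that by (auto simp: G_def x_def e_out)
  have G_pt: "AE s in lborel. s \<in> {0<..T} \<longrightarrow> 0 \<le> G s \<and>
     e2ennreal (coercivity_modulus \<Phi> (u s) (interp_frac a N tt U s) + coercivity_modulus \<Phi> (interp_const N tt U s) (u s)) \<le> ennreal (G s)"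
    using u_sub
  proof eventually_elim
    case (elim s)
    show ?case
    proof
      assume s: "s \<in> {0<..T}"
      then obtain n where n: "n \<in> {1..N}" "tt (n - 1) < s" "s \<le> tt n" using cell_exists[OF P, of s] by auto
      have Un: "interp_const N tt U s = U n" by (simp add: interp_const_def interval_index_eq[OF P n])
      have node: "interp_frac a N tt U (tt n) = U n" using n by (intro interp_frac_at_node[OF P a(1)]) auto
      have tn: "tt n \<in> {0..T}" using n partition_bounds[OF P, of n] by auto
      have "U n \<in> interp_frac a N tt U ` {0..T}" using node tn by force
      moreover have "interp_frac a N tt U s \<in> interp_frac a N tt U ` {0..T}" using s by auto
      ultimately have upper: "\<Phi> (interp_frac a N tt U s) - \<Phi> (U n) - ereal ((F n - V n) \<bullet> (interp_frac a N tt U s - U n))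
          \<le> ereal (Cb * norm (interp_frac a N tt U s - U n) powr (1 + \<beta>))"
        using up sub[OF n(1)] unfolding V_def by blast
      have us: "\<Phi> (u s) < \<infinity>" "f s - D s \<in> subdiff \<Phi> (u s)" using elim s by auto
      note main = coercivity_moduli_sum_le[OF gt us(2,1) sub[OF n(1), folded V_def] upper]
      have "Cb * norm (interp_frac a N tt U s - U n) powr (1 + \<beta>) + (f s - D s - (F n - V n)) \<bullet> (u s - interp_frac a N tt U s) = G s"
        using s by (simp add: step_fun_eq[OF P n] G_def x_def y_def e_def De_def Vb_def Uh_eq inner_diff_left)
      then show "0 \<le> G s \<and> e2ennreal (coercivity_modulus \<Phi> (u s) (interp_frac a N tt U s) + coercivity_modulus \<Phi> (interp_const N tt U s) (u s)) \<le> ennreal (G s)"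
        using main unfolding Un by simp
    qed
  qed
  define J where "J t = fint a (\<lambda>s. ennreal (G s)) t" for t
  define K where "K = (norm e0)\<^sup>2 + 2 * c * (Cb * Ax) + 2 * (c * Ay) * m"
  have K0: "0 \<le> K" using c Cb Ax(1) Ay(1) m0 by (simp add: K_def)
  have scaleJ: "ennreal (2 * c) * J t = fint a (\<lambda>s. ennreal (2 * c * G s)) t" for t
  proof -
    have "ennreal (2 * c) * J t = (\<integral>\<^sup>+s. ennreal (2 * c) * (ennreal (pker a (t - s)) * ennreal (G s)) \<partial>lborel)"
      unfolding J_def fint_def by (rule nn_integral_cmult[symmetric]) measurable
    also have "\<dots> = (\<integral>\<^sup>+s. ennreal (pker a (t - s)) * ennreal (2 * c * G s) \<partial>lborel)"
    proof (intro nn_integral_cong)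
      fix s
      have "ennreal (2 * c * G s) = ennreal (2 * c) * ennreal (G s)" using c by (intro ennreal_mult') auto
      then show "ennreal (2 * c) * (ennreal (pker a (t - s)) * ennreal (G s)) = ennreal (pker a (t - s)) * ennreal (2 * c * G s)"
        by (simp only: mult.left_commute)
    qed
    finally show ?thesis unfolding fint_def .
  qed
  have goodDe: "AE t in lborel. t < T \<longrightarrow> fint a (\<lambda>s. ennreal (norm (De s))) t < \<infinity> \<and>
      fint a (\<lambda>s. ennreal (norm (De s)) * fint a (\<lambda>s. ennreal (norm (De s))) s) t < \<infinity>"
    using a(1) De0 De2 by (intro AE_good_times) auto
  \<comment> \<open>Only at times satisfying both finiteness conditions, and at which
    \<open>e\<close> agrees with its representation, does the chain inequality apply to
    \<open>e t\<close> itself.\<close>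
  have good: "AE t in lborel. t \<in> {0<..<T} \<longrightarrow> ennreal ((norm (e t))\<^sup>2) + fint a (\<lambda>s. ennreal (2 * c * G s)) t \<le> ennreal K"
    using goodDe e_rep
  proof eventually_elim
    case (elim t)
    show ?case
    proof
      assume t: "t \<in> {0<..<T}"
      then have fin: "fint a (\<lambda>s. ennreal (norm (De s))) t < \<infinity>"
        "fint a (\<lambda>s. ennreal (norm (De s)) * fint a (\<lambda>s. ennreal (norm (De s))) s) t < \<infinity>"
        and et: "e t = e0 + c *\<^sub>R rl a De t" using elim by auto
      have e_eq: "AE s in lborel. De s \<noteq> 0 \<longrightarrow> s < t \<longrightarrow> e s = e0 + c *\<^sub>R rl a De s"
        using e_rep by eventually_elim (use De0 in blast)
      have De_meas: "De \<in> borel_measurable borel" and e_meas: "e \<in> borel_measurable borel" by measurable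
      note chain = fractional_chain_inequality[OF a less_imp_le[OF c] De_meas fin e_meas e_eq]
      have ix: "integrable lborel (\<lambda>s. pker a (t - s) * x s)" "(\<integral>s. pker a (t - s) * x s \<partial>lborel) \<le> Ax"
        using xAR[of t] t x0 Ax(1)
        by (auto intro!: nonneg_integrable_bound simp: fint_def ennreal_mult)
      have iy: "integrable lborel (\<lambda>s. pker a (t - s) * norm (y s))" "(\<integral>s. pker a (t - s) * norm (y s) \<partial>lborel) \<le> Ay"
        using yAB[of t] t Ay(1)
        by (auto intro!: nonneg_integrable_bound simp: fint_def ennreal_mult)
      have ye: "\<bar>pker a (t - s) * (y s \<bullet> e s)\<bar> \<le> m * (pker a (t - s) * norm (y s))" for s
      proof -
        have "\<bar>y s \<bullet> e s\<bar> \<le> norm (y s) * norm (e s)" by (rule Cauchy_Schwarz_ineq2)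
        also have "\<dots> \<le> norm (y s) * m" using m by (intro mult_left_mono) auto
        finally have "pker a (t - s) * \<bar>y s \<bullet> e s\<bar> \<le> pker a (t - s) * (norm (y s) * m)" by (intro mult_left_mono) auto
        then show ?thesis by (simp add: abs_mult mult_ac)
      qed
      have iye: "integrable lborel (\<lambda>s. pker a (t - s) * (y s \<bullet> e s))"
      proof (rule Bochner_Integration.integrable_bound)
        show "integrable lborel (\<lambda>s. m * (pker a (t - s) * norm (y s)))" using iy(1) by simp
        show "AE s in lborel. norm (pker a (t - s) * (y s \<bullet> e s)) \<le> norm (m * (pker a (t - s) * norm (y s)))"
          by (intro AE_I2) (unfold real_norm_def, rule order_trans[OF ye abs_ge_self])
      qed measurable
      have "(\<integral>s. pker a (t - s) * (y s \<bullet> e s) \<partial>lborel) \<le> (\<integral>s. m * (pker a (t - s) * norm (y s)) \<partial>lborel)"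
        using iye iy(1) ye by (intro integral_mono) (auto dest: abs_le_D1)
      also have "\<dots> \<le> m * Ay" using iy(2) m0 by (simp add: mult_left_mono)
      finally have ye_le: "(\<integral>s. pker a (t - s) * (y s \<bullet> e s) \<partial>lborel) \<le> m * Ay" .
      have split: "pker a (t - s) * (2 * c * G s) = 2 * c * (Cb * (pker a (t - s) * x s) + pker a (t - s) * (y s \<bullet> e s) - pker a (t - s) * (De s \<bullet> e s))" for s
        by (simp add: G_def algebra_simps)
      have iG: "integrable lborel (\<lambda>s. pker a (t - s) * (2 * c * G s))"
        unfolding split using ix(1) iye chain(2) by (intro integrable_mult_right Bochner_Integration.integrable_diff Bochner_Integration.integrable_add)
      \<comment> \<open>Nonnegativity allows the extended integral to be rewritten as a Bochner
        integral, in which the signed terms of \<open>G\<close> separate.\<close>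
      have G_nonneg: "AE s in lborel. 0 \<le> pker a (t - s) * (2 * c * G s)"
        using G_pt AE_lborel_singleton[of 0]
      proof eventually_elim
        case (elim s)
        have "0 \<le> G s" using elim G_out[of s] by (cases "s \<in> {0<..T}") auto
        then show ?case using c by simp
      qed
      have "fint a (\<lambda>s. ennreal (2 * c * G s)) t = (\<integral>\<^sup>+s. ennreal (pker a (t - s) * (2 * c * G s)) \<partial>lborel)"
        unfolding fint_def by (intro nn_integral_cong) (simp add: ennreal_mult')
      also have "\<dots> = ennreal (\<integral>s. pker a (t - s) * (2 * c * G s) \<partial>lborel)"
        using iG G_nonneg by (rule nn_integral_eq_integral)
      finally have J: "fint a (\<lambda>s. ennreal (2 * c * G s)) t = ennreal (\<integral>s. pker a (t - s) * (2 * c * G s) \<partial>lborel)" .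
      have I0: "0 \<le> (\<integral>s. pker a (t - s) * (2 * c * G s) \<partial>lborel)" using G_nonneg by (rule integral_nonneg_AE)
      have "(\<integral>s. pker a (t - s) * (2 * c * G s) \<partial>lborel)
        = 2 * c * (Cb * (\<integral>s. pker a (t - s) * x s \<partial>lborel) + (\<integral>s. pker a (t - s) * (y s \<bullet> e s) \<partial>lborel) - (\<integral>s. pker a (t - s) * (De s \<bullet> e s) \<partial>lborel))"
        unfolding split using ix(1) iye chain(2) by simp
      also have "\<dots> \<le> 2 * c * (Cb * Ax + m * Ay - (\<integral>s. pker a (t - s) * (De s \<bullet> e s) \<partial>lborel))"
        using ix(2) ye_le c Cb by (intro mult_left_mono diff_mono add_mono) auto
      finally have "(norm (e t))\<^sup>2 + (\<integral>s. pker a (t - s) * (2 * c * G s) \<partial>lborel) \<le> K"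
        using chain(1) unfolding et[symmetric] K_def by (simp add: algebra_simps)
      then show "ennreal ((norm (e t))\<^sup>2) + fint a (\<lambda>s. ennreal (2 * c * G s)) t \<le> ennreal K"
        unfolding J using I0 by (simp add: ennreal_plus[symmetric] ennreal_leI del: ennreal_plus)
    qed
  qed
  have E_cont: "continuous_on {0..T} (\<lambda>t. (norm (e t))\<^sup>2)" using e_cont by (intro continuous_intros)
  have bound: "ennreal ((norm (e t))\<^sup>2) + fint a (\<lambda>s. ennreal (2 * c * G s)) t \<le> ennreal K" "(norm (e t))\<^sup>2 \<le> K"
    if "t \<in> {0..T}" for t
    using AE_bound_imp_bound[OF T E_cont _ _ good K0 that] by auto
  have sigma: "(err_sigma a \<Phi> N tt U u t)\<^sup>2 \<le> fint a (\<lambda>s. ennreal (2 * c * G s)) t" if t: "t \<in> {0..T}" for t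
  proof -
    let ?S = "\<lambda>s. e2ennreal (coercivity_modulus \<Phi> (u s) (interp_frac a N tt U s) + coercivity_modulus \<Phi> (interp_const N tt U s) (u s))"
    have "(err_sigma a \<Phi> N tt U u t)\<^sup>2 = ennreal (2 * c) * (\<integral>\<^sup>+s\<in>{0..t}. (ennreal ((t - s) powr (a - 1)) * ?S s) \<partial>lborel)"
      unfolding err_sigma_def ennreal_powr_half_square nn_integral_completion by (simp add: c_def)
    also have "\<dots> \<le> ennreal (2 * c) * J t"
      unfolding J_def fint_def
    proof (rule mult_left_mono, rule nn_integral_mono_AE)
      show "AE s in lborel. ennreal ((t - s) powr (a - 1)) * ?S s * indicator {0..t} s \<le> ennreal (pker a (t - s)) * ennreal (G s)"
        using G_pt AE_lborel_singleton[of 0] AE_lborel_singleton[of t]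
      proof eventually_elim
        case (elim s)
        show ?case
        proof (cases "s \<in> {0..t}")
          case True
          then have "s \<in> {0<..T}" "s < t" using elim t by auto
          then show ?thesis using elim True by (auto simp: pker_def intro!: mult_left_mono)
        qed simp
      qed
    qed simp
    finally show ?thesis unfolding scaleJ .
  qed
  define Z where "Z = norm e0 + sqrt (2 * c * (Cb * Ax)) + 2 * (c * Ay)"
  have "m\<^sup>2 \<le> K" unfolding m_def using bound(2)[OF t1(1)] .
  then have KZ: "K \<le> Z\<^sup>2"
    unfolding K_def Z_def using c Cb Ax(1) Ay(1) by (intro quadratic_bound) auto
  have Z0: "0 \<le> Z" unfolding Z_def using c Cb Ax(1) Ay(1) by (intro add_nonneg_nonneg) auto
  have "err_total a T \<Phi> N tt U u \<le> ennreal Z"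
    unfolding err_total_def
  proof (rule ennreal_powr_half_le[OF _ Z0], rule SUP_least)
    fix t assume t: "t \<in> {0..T}"
    have "(err_H a N tt U u t)\<^sup>2 = (norm (e t))\<^sup>2"
      using t by (simp add: err_H_def e_def Uh_eq)
    then have "ennreal ((err_H a N tt U u t)\<^sup>2) + (err_sigma a \<Phi> N tt U u t)\<^sup>2 \<le> ennreal ((norm (e t))\<^sup>2) + fint a (\<lambda>s. ennreal (2 * c * G s)) t"
      using sigma[OF t] by (intro add_mono) auto
    also have "\<dots> \<le> ennreal K" by (rule bound(1)[OF t])
    also have "\<dots> \<le> ennreal (Z\<^sup>2)" by (rule ennreal_leI[OF KZ])
    finally show "ennreal ((err_H a N tt U u t)\<^sup>2) + (err_sigma a \<Phi> N tt U u t)\<^sup>2 \<le> ennreal (Z\<^sup>2)" .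
  qed
  then show ?thesis by (simp add: Z_def c_def e0_def)
qed

section \<open>Bounds for the residuals\<close>

text \<open>Borel versions vanishing outside [0, T] make the product measure arguments over
  \<open>lborel\<close> available and turn integrals over the interval into integrals over the
  line.\<close>

lemma borel_representative:
  fixes w :: "real \<Rightarrow> 'h::{banach, second_countable_topology}"
  assumes w: "w \<in> borel_measurable (lebesgue_on {0..T})"
  obtains w' where "w' \<in> borel_measurable borel" "\<And>t. t \<notin> {0..T} \<Longrightarrow> w' t = 0"
    "AE t in lborel. t \<in> {0..T} \<longrightarrow> w' t = w t"
proof -
  have "(\<lambda>t. indicator {0..T} t *\<^sub>R w t) \<in> borel_measurable lebesgue"
    using w by (subst (asm) borel_measurable_restrict_space_iff) auto
  then obtain v where v: "v \<in> borel_measurable lborel" "AE t in lborel. indicator {0..T} t *\<^sub>R w t = v t"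
    using completion_ex_borel_measurable_metric by blast
  define w' where "w' t = indicator {0..T} t *\<^sub>R v t" for t
  have [measurable]: "v \<in> borel_measurable borel" using v(1) by simp
  have "w' \<in> borel_measurable borel" unfolding w'_def by measurable
  moreover have "w' t = 0" if "t \<notin> {0..T}" for t using that by (simp add: w'_def)
  moreover have "AE t in lborel. t \<in> {0..T} \<longrightarrow> w' t = w t"
    using v(2) by eventually_elim (auto simp: w'_def)
  ultimately show ?thesis by (rule that)
qed

lemma Lp_alpha_space_bound:
  fixes f f' :: "real \<Rightarrow> 'h::{banach, second_countable_topology}"
  assumes f: "f \<in> Lp_alpha_space a 2 T" and [measurable]: "f' \<in> borel_measurable borel"
    and f'0: "\<And>t. t \<notin> {0..T} \<Longrightarrow> f' t = 0" and f': "AE t in lborel. t \<in> {0..T} \<longrightarrow> f' t = f t" and t: "t \<le> T"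
  shows "fint a (\<lambda>s. ennreal ((norm (f' s))\<^sup>2)) t \<le> ennreal ((enn2real (Lp_alpha_norm a 2 T f))\<^sup>2)"
proof (cases "0 \<le> t")
  case False
  have eq: "ennreal (pker a (t - s)) * ennreal ((norm (f' s))\<^sup>2) = 0" for s
    using False f'0[of s] by (cases "s \<in> {0..T}") auto
  show ?thesis unfolding fint_def eq by simp
next
  case True
  let ?I = "\<integral>\<^sup>+ s\<in>{0..t}. ennreal ((t - s) powr (a - 1) * norm (f s) powr 2) \<partial>lborel"
  have fin: "Lp_alpha_norm a 2 T f < \<infinity>" using f by (simp add: Lp_alpha_space_def)
  have "ennreal_powr ?I (1 / 2) \<le> Lp_alpha_norm a 2 T f"
    unfolding Lp_alpha_norm_def nn_integral_completion using True t by (intro SUP_upper) auto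
  then have "(ennreal_powr ?I (1 / 2))\<^sup>2 \<le> (Lp_alpha_norm a 2 T f)\<^sup>2" by (rule power_mono) simp
  also have "Lp_alpha_norm a 2 T f = ennreal (enn2real (Lp_alpha_norm a 2 T f))" using fin by simp
  finally have "?I \<le> ennreal ((enn2real (Lp_alpha_norm a 2 T f))\<^sup>2)"
    unfolding ennreal_powr_half_square by (simp add: ennreal_power)
  moreover have "fint a (\<lambda>s. ennreal ((norm (f' s))\<^sup>2)) t \<le> ?I"
    unfolding fint_def
  proof (rule nn_integral_mono_AE)
    show "AE s in lborel. ennreal (pker a (t - s)) * ennreal ((norm (f' s))\<^sup>2) \<le> ennreal ((t - s) powr (a - 1) * norm (f s) powr 2) * indicator {0..t} s"
      using f'
    proof eventually_elim
      case (elim s)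
      show ?case
      proof (cases "s \<in> {0..T} \<and> s < t")
        case True
        then show ?thesis using elim by (auto simp: pker_def ennreal_mult)
      next
        case False
        then show ?thesis using f'0[of s] by (cases "s \<in> {0..T}") auto
      qed
    qed
  qed
  ultimately show ?thesis by (rule order_trans[rotated])
qed

text \<open>For a < 1 the kernel at t = T is bounded below by T^(a - 1) on the interval.\<close>

lemma Lp_alpha_space_subset_L2:
  fixes f :: "real \<Rightarrow> 'h::{banach, second_countable_topology}"
  assumes T: "0 < T" and a: "0 < a" "a < 1" and f: "f \<in> Lp_alpha_space a 2 T"
  shows "f \<in> Lp_space 2 T"
proof -
  have meas: "f \<in> borel_measurable (lebesgue_on {0..T})" using f by (simp add: Lp_alpha_space_def)
  obtain f' where f' [measurable]: "f' \<in> borel_measurable borel" and f'0: "\<And>t. t \<notin> {0..T} \<Longrightarrow> f' t = 0"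
    and f'_eq: "AE t in lborel. t \<in> {0..T} \<longrightarrow> f' t = f t" using borel_representative[OF meas] by metis
  have "(\<integral>\<^sup>+s\<in>{0..T}. ennreal (norm (f s) powr 2) \<partial>lborel)
     \<le> (\<integral>\<^sup>+s. ennreal (T powr (1 - a)) * (ennreal (pker a (T - s)) * ennreal ((norm (f' s))\<^sup>2)) \<partial>lborel)"
  proof (rule nn_integral_mono_AE)
    show "AE s in lborel. ennreal (norm (f s) powr 2) * indicator {0..T} s \<le> ennreal (T powr (1 - a)) * (ennreal (pker a (T - s)) * ennreal ((norm (f' s))\<^sup>2))"
      using f'_eq AE_lborel_singleton[of T]
    proof eventually_elim
      case (elim s)
      show ?case
      proof (cases "s \<in> {0..T}")
        case True
        then have s: "0 < T - s" "T - s \<le> T" using elim by auto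
        then have "T powr (a - 1) \<le> pker a (T - s)" using a by (auto simp: pker_def intro!: powr_mono2')
        then have "T powr (1 - a) * T powr (a - 1) \<le> T powr (1 - a) * pker a (T - s)" by (intro mult_left_mono) auto
        then have "1 \<le> T powr (1 - a) * pker a (T - s)" using T by (simp add: powr_add[symmetric])
        from mult_right_mono[OF this, of "(norm (f s))\<^sup>2"]
        have "(norm (f s))\<^sup>2 \<le> T powr (1 - a) * pker a (T - s) * (norm (f s))\<^sup>2" by simp
        then have "ennreal ((norm (f s))\<^sup>2) \<le> ennreal (T powr (1 - a) * pker a (T - s) * (norm (f s))\<^sup>2)" by (rule ennreal_leI)
        also have "\<dots> = ennreal (T powr (1 - a)) * (ennreal (pker a (T - s)) * ennreal ((norm (f s))\<^sup>2))"
          by (simp add: ennreal_mult mult.assoc)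
        finally show ?thesis using True elim by simp
      qed simp
    qed
  qed
  also have "\<dots> = ennreal (T powr (1 - a)) * fint a (\<lambda>s. ennreal ((norm (f' s))\<^sup>2)) T"
    unfolding fint_def by (rule nn_integral_cmult) measurable
  also have "\<dots> \<le> ennreal (T powr (1 - a)) * ennreal ((enn2real (Lp_alpha_norm a 2 T f))\<^sup>2)"
    using Lp_alpha_space_bound[OF f f' f'0 f'_eq, of T] by (intro mult_left_mono) auto
  also have "\<dots> < \<infinity>" by (simp add: ennreal_mult_less_top)
  finally show ?thesis using meas by (simp add: Lp_space_def nn_integral_completion)
qed

lemma L2_representative:
  fixes w w' :: "real \<Rightarrow> 'h::{banach, second_countable_topology}"
  assumes w: "w \<in> Lp_space 2 T" and w' [measurable]: "w' \<in> borel_measurable borel"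
    and w'0: "\<And>t. t \<notin> {0..T} \<Longrightarrow> w' t = 0" and eq: "AE t in lborel. t \<in> {0..T} \<longrightarrow> w' t = w t"
  shows "(\<integral>\<^sup>+s. ennreal ((norm (w' s))\<^sup>2) \<partial>lborel) < \<infinity>" and "integrable lborel w'"
proof -
  have "(\<integral>\<^sup>+s. ennreal ((norm (w' s))\<^sup>2) \<partial>lborel) = (\<integral>\<^sup>+s\<in>{0..T}. ennreal (norm (w s) powr 2) \<partial>lborel)"
  proof (rule nn_integral_cong_AE)
    show "AE s in lborel. ennreal ((norm (w' s))\<^sup>2) = ennreal (norm (w s) powr 2) * indicator {0..T} s"
      using eq
    proof eventually_elim
      case (elim s)
      then show ?case using w'0[of s] by (cases "s \<in> {0..T}") auto
    qed
  qed
  also have "\<dots> < \<infinity>" using w by (simp add: Lp_space_def nn_integral_completion)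
  finally show *: "(\<integral>\<^sup>+s. ennreal ((norm (w' s))\<^sup>2) \<partial>lborel) < \<infinity>" .
  show "integrable lborel w'"
  proof (rule integrableI_bounded)
    have "(\<integral>\<^sup>+s. ennreal (norm (w' s)) \<partial>lborel) \<le> (\<integral>\<^sup>+s. indicator {0..T} s + ennreal ((norm (w' s))\<^sup>2) \<partial>lborel)"
    proof (intro nn_integral_mono)
      fix s
      have "2 * norm (w' s) \<le> 1 + (norm (w' s))\<^sup>2" using sum_squares_bound[of 1 "norm (w' s)"] by simp
      then have "norm (w' s) \<le> 1 + (norm (w' s))\<^sup>2" using norm_ge_zero[of "w' s"] by linarith
      then have "ennreal (norm (w' s)) \<le> 1 + ennreal ((norm (w' s))\<^sup>2)"
        by (simp add: ennreal_1[symmetric] ennreal_plus[symmetric] ennreal_leI del: ennreal_1 ennreal_plus)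
      then show "ennreal (norm (w' s)) \<le> indicator {0..T} s + ennreal ((norm (w' s))\<^sup>2)"
        using w'0[of s] by (cases "s \<in> {0..T}") auto
    qed
    also have "\<dots> = emeasure lborel {0..T} + (\<integral>\<^sup>+s. ennreal ((norm (w' s))\<^sup>2) \<partial>lborel)"
      by (subst nn_integral_add) auto
    also have "\<dots> < \<infinity>" using * by (simp add: emeasure_lborel_Icc_eq)
    finally show "(\<integral>\<^sup>+s. ennreal (norm (w' s)) \<partial>lborel) < \<infinity>" .
  qed measurable
qed

section \<open>Rates of the data residual and of the interpolation gap\<close>

lemma cell_average_eq:
  fixes f f' :: "real \<Rightarrow> 'h::{banach, second_countable_topology}"
  assumes f: "f \<in> borel_measurable (lebesgue_on {0..T})" and f' [measurable]: "f' \<in> borel_measurable borel"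
    and eq: "AE t in lborel. t \<in> {0..T} \<longrightarrow> f' t = f t" and P: "is_partition T N tt" and n: "n \<in> {1..N}"
  shows "cell_average tt f n = (1 / (tt n - tt (n - 1))) *\<^sub>R (LINT s:{tt (n - 1)..tt n}|lborel. f' s)"
proof -
  let ?C = "{tt (n - 1)..tt n}"
  have "n \<le> N" "n - 1 \<le> N" using n by auto
  then have C: "?C \<subseteq> {0..T}" using partition_bounds[OF P] by force
  have fm: "(\<lambda>t. indicator {0..T} t *\<^sub>R f t) \<in> borel_measurable lebesgue"
    using f by (subst (asm) borel_measurable_restrict_space_iff) auto
  have "(\<integral>s. indicator ?C s *\<^sub>R f s \<partial>lebesgue) = (\<integral>s. indicator ?C s *\<^sub>R f' s \<partial>lebesgue)"
  proof (rule integral_cong_AE)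
    have "(\<lambda>s. indicator ?C s *\<^sub>R f s) = (\<lambda>s. indicator ?C s *\<^sub>R (indicator {0..T} s *\<^sub>R f s))"
      using C by (auto simp: indicator_def fun_eq_iff)
    moreover have "(\<lambda>s. indicator ?C s *\<^sub>R (indicator {0..T} s *\<^sub>R f s)) \<in> borel_measurable lebesgue"
      by (intro borel_measurable_scaleR fm borel_measurable_indicator) auto
    ultimately show "(\<lambda>s. indicator ?C s *\<^sub>R f s) \<in> borel_measurable lebesgue" by simp
    show "(\<lambda>s. indicator ?C s *\<^sub>R f' s) \<in> borel_measurable lebesgue" by (rule measurable_completion) measurable
    have "AE s in lborel. indicator ?C s *\<^sub>R f s = indicator ?C s *\<^sub>R f' s"
      using eq by eventually_elim (use C in \<open>auto simp: indicator_def\<close>)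
    then show "AE s in lebesgue. indicator ?C s *\<^sub>R f s = indicator ?C s *\<^sub>R f' s" by (rule AE_completion)
  qed
  also have "\<dots> = (\<integral>s. indicator ?C s *\<^sub>R f' s \<partial>lborel)" by (rule integral_completion) measurable
  finally show ?thesis by (simp add: cell_average_def set_lebesgue_integral_def step_size_def)
qed

text \<open>Integrating \<open>powr_norm_diff_average_le\<close> over s bounds the L^q norm of the
  averaging error by \<tau>^\<sigma> times the seminorm; \<open>fint_holder_le\<close> then absorbs
  the singular kernel.\<close>

lemma fint_cell_average_error_le:
  fixes f f' :: "real \<Rightarrow> 'h::{banach, second_countable_topology}"
  assumes a: "0 < a" "a < 1" and q: "1 / a < q" and \<sigma>: "0 < \<sigma>" and T: "0 < T"
    and f: "f \<in> Wsq_space \<sigma> q T" and f' [measurable]: "f' \<in> borel_measurable borel" and f'_int: "integrable lborel f'"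
    and eq: "AE t in lborel. t \<in> {0..T} \<longrightarrow> f' t = f t" and P: "is_partition T N tt"
    and F: "\<And>n. n \<in> {1..N} \<Longrightarrow> F n = (1 / (tt n - tt (n - 1))) *\<^sub>R (LINT s:{tt (n - 1)..tt n}|lborel. f' s)"
    and e: "e = q / (q - 1) * (a - 1) + 1" and t: "t \<le> T"
  shows "fint a (\<lambda>s. ennreal (norm (indicator {0<..T} s *\<^sub>R (f' s - step_fun N tt F s)))) t
    \<le> ennreal ((T powr e / e + 1) * (max_step N tt powr \<sigma> * enn2real (slobodeckij_seminorm \<sigma> q T f)))"
proof -
  have "1 < 1 / a" using a by simp
  then have q1: "1 < q" using q by simp
  define W where "W = enn2real (slobodeckij_seminorm \<sigma> q T f)"
  define \<tau> where "\<tau> = max_step N tt"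
  have \<tau>: "0 < \<tau>" unfolding \<tau>_def by (rule max_step_pos[OF P T])
  let ?h = "\<lambda>g x y. ennreal (norm (g x - g y) powr q / \<bar>x - y\<bar> powr (1 + \<sigma> * q))"
  define WW where "WW = (\<integral>\<^sup>+ x\<in>{0..T}. (\<integral>\<^sup>+ y\<in>{0..T}. ?h f x y \<partial>lborel) \<partial>lborel)"
  have semi: "slobodeckij_seminorm \<sigma> q T f = ennreal_powr WW (1 / q)"
    unfolding slobodeckij_seminorm_def WW_def nn_integral_completion ..
  have "ennreal_powr WW (1 / q) < \<infinity>" using f semi by (simp add: Wsq_space_def)
  then have "WW \<noteq> \<infinity>" by (auto simp: ennreal_powr_def)
  then obtain w where w: "WW = ennreal w" "0 \<le> w" by (cases WW) auto
  have "W = w powr (1 / q)" unfolding W_def semi using w by (simp add: ennreal_powr_def)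
  then have Wq: "W powr q = w" and W0: "0 \<le> W" using w(2) q1 by (auto simp: powr_powr)
  have WW': "WW = (\<integral>\<^sup>+ x\<in>{0..T}. (\<integral>\<^sup>+ y\<in>{0..T}. ?h f' x y \<partial>lborel) \<partial>lborel)"
    unfolding WW_def
  proof (rule nn_integral_cong_AE)
    show "AE x in lborel. (\<integral>\<^sup>+ y\<in>{0..T}. ?h f x y \<partial>lborel) * indicator {0..T} x = (\<integral>\<^sup>+ y\<in>{0..T}. ?h f' x y \<partial>lborel) * indicator {0..T} x"
      using eq
    proof eventually_elim
      case (elim x)
      show ?case
      proof (cases "x \<in> {0..T}")
        case True
        have "(\<integral>\<^sup>+ y\<in>{0..T}. ?h f x y \<partial>lborel) = (\<integral>\<^sup>+ y\<in>{0..T}. ?h f' x y \<partial>lborel)"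
        proof (rule nn_integral_cong_AE)
          show "AE y in lborel. ?h f x y * indicator {0..T} y = ?h f' x y * indicator {0..T} y"
            using eq by eventually_elim (use True elim in \<open>auto simp: indicator_def\<close>)
        qed
        then show ?thesis by simp
      qed simp
    qed
  qed
  define x where "x s = norm (indicator {0<..T} s *\<^sub>R (f' s - step_fun N tt F s))" for s
  have [measurable]: "x \<in> borel_measurable borel" unfolding x_def by measurable
  have "(\<integral>\<^sup>+s. ennreal (x s powr q) \<partial>lborel) \<le> (\<integral>\<^sup>+s. ennreal (\<tau> powr (\<sigma> * q)) * ((\<integral>\<^sup>+ y\<in>{0..T}. ?h f' s y \<partial>lborel) * indicator {0..T} s) \<partial>lborel)"
  proof (intro nn_integral_mono)
    fix s
    show "ennreal (x s powr q) \<le> ennreal (\<tau> powr (\<sigma> * q)) * ((\<integral>\<^sup>+ y\<in>{0..T}. ?h f' s y \<partial>lborel) * indicator {0..T} s)"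
    proof (cases "s \<in> {0<..T}")
      case True
      then obtain n where n: "n \<in> {1..N}" "tt (n - 1) < s" "s \<le> tt n" using cell_exists[OF P, of s] by auto
      have "ennreal (norm (f' s - F n) powr q) \<le> ennreal (\<tau> powr (\<sigma> * q)) * (\<integral>\<^sup>+ y\<in>{0..T}. ?h f' s y \<partial>lborel)"
        by (rule powr_norm_diff_average_le[OF P q1 \<sigma> f' f'_int _ n F[OF n(1)]]) (simp add: \<tau>_def)
      then show ?thesis using True by (simp add: x_def step_fun_eq[OF P n])
    qed (use q1 in \<open>simp add: x_def\<close>)
  qed
  also have "\<dots> = ennreal (\<tau> powr (\<sigma> * q)) * WW"
    unfolding WW' by (rule nn_integral_cmult) measurable
  also have "\<dots> = ennreal ((\<tau> powr \<sigma> * W) powr q)"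
    using \<tau> W0 by (simp add: w ennreal_mult[symmetric] powr_mult powr_powr Wq)
  finally have int: "(\<integral>\<^sup>+s. ennreal (x s powr q) \<partial>lborel) \<le> ennreal ((\<tau> powr \<sigma> * W) powr q)" .
  have "fint a (\<lambda>s. ennreal (x s)) t \<le> ennreal ((max 0 T powr e / e + 1) * (\<tau> powr \<sigma> * W))"
    using W0 by (intro fint_holder_le[OF a q _ _ _ int _ t e]) (auto simp: x_def)
  then show ?thesis using T by (simp add: x_def W_def \<tau>_def max_def)
qed

text \<open>The gap is estimated in the square first, where the stability bound S applies, and then
  lowered to the power \<theta> by concavity. The constant is 10 / a^2 times 2
  \<open>Gamma a\<close>, divided by the square of \<open>Gamma a\<close>, since \<open>rl\<close>
  lacks the factor \<open>1 / Gamma a\<close>.\<close>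

lemma fint_interpolation_gap_le:
  fixes U :: "nat \<Rightarrow> 'h::{banach, second_countable_topology}"
  assumes T: "0 < T" and a: "0 < a" "a < 1" and \<theta>: "0 < \<theta>" "\<theta> \<le> 1" and P: "is_partition T N tt"
    and S: "0 \<le> S" "\<And>n. n \<le> N \<Longrightarrow> (\<Sum>j=1..n. cker a tt j (tt n) * (norm (discrete_caputo a N tt U j))\<^sup>2) \<le> S"
    and t: "t \<le> T"
  shows "fint a (\<lambda>s. ennreal (indicator {0<..T} s * norm (interp_frac a N tt U s - step_fun N tt U s) powr (2 * \<theta>))) t
    \<le> ennreal ((1 + T powr a / a) * (20 / (a\<^sup>2 * Gamma a) * max_step N tt powr (2 * a) * S) powr \<theta>)"
proof -
  define V where "V = discrete_caputo a N tt U"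
  define \<tau> where "\<tau> = max_step N tt"
  have \<tau>: "0 < \<tau>" unfolding \<tau>_def by (rule max_step_pos[OF P T])
  have G: "0 < Gamma a" using a by simp
  define Uh where "Uh s = U 0 + (1 / Gamma a) *\<^sub>R rl a (step_fun N tt V) s" for s
  have [measurable]: "Uh \<in> borel_measurable borel" unfolding Uh_def by measurable
  have Uh_eq: "interp_frac a N tt U s = Uh s" if "s \<le> T" for s
    unfolding Uh_def V_def using that by (rule interp_frac_eq[OF P])
  define x where "x s = indicator {0<..T} s * (norm (Uh s - step_fun N tt U s))\<^sup>2" for s :: real
  have [measurable]: "x \<in> borel_measurable borel" unfolding x_def by measurable
  have x0: "0 \<le> x s" for s by (simp add: x_def)
  have "fint a (\<lambda>s. ennreal ((Gamma a)\<^sup>2 * x s)) t \<le> ennreal (10 / a\<^sup>2 * \<tau> powr (2 * a)) * fint a (\<lambda>s. ennreal ((norm (step_fun N tt V s))\<^sup>2)) t"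
  proof (rule fint_interp_error_le[OF P a _ \<tau> _ _ t])
    show "max_step N tt \<le> \<tau>" by (simp add: \<tau>_def)
    show "ennreal ((Gamma a)\<^sup>2 * x s) = 0" if "s \<le> 0" for s using that by (simp add: x_def)
    fix n s assume n: "n \<in> {1..N}" "tt (n - 1) < s" "s \<le> tt n"
    have nN: "n \<le> N" using n by simp
    have sT: "s \<le> T" using n partition_bounds(2)[OF P nN] by simp
    have "U n = Uh (tt n)" using interp_frac_at_node[OF P a(1) nN, of U] Uh_eq[OF partition_bounds(2)[OF P nN]] by simp
    then have "Uh s - step_fun N tt U s = (1 / Gamma a) *\<^sub>R (rl a (step_fun N tt V) s - rl a (step_fun N tt V) (tt n))"
      by (simp add: step_fun_eq[OF P n] Uh_def scaleR_diff_right)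
    then have "(Gamma a)\<^sup>2 * (norm (Uh s - step_fun N tt U s))\<^sup>2 = (norm (rl a (step_fun N tt V) (tt n) - rl a (step_fun N tt V) s))\<^sup>2"
      using G by (simp add: power_mult_distrib power_divide norm_minus_commute)
    then show "ennreal ((Gamma a)\<^sup>2 * x s) \<le> ennreal ((norm (rl a (step_fun N tt V) (tt n) - rl a (step_fun N tt V) s))\<^sup>2)"
      by (intro ennreal_leI) (auto simp: x_def indicator_def)
  qed
  also have "fint a (\<lambda>s. ennreal ((norm (step_fun N tt V s))\<^sup>2)) t \<le> ennreal (2 * Gamma a * S)"
  proof -
    have "(norm (step_fun N tt V s))\<^sup>2 = step_fun N tt (\<lambda>n. (norm (V n))\<^sup>2) s" for s
      by (rule step_fun_compose[OF P]) simp
    then show ?thesis using fint_step_fun_le[OF P a(1) less_imp_le[OF a(2)] _ S(2) t] by (simp add: V_def)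
  qed
  finally have "fint a (\<lambda>s. ennreal ((Gamma a)\<^sup>2 * x s)) t \<le> ennreal (10 / a\<^sup>2 * \<tau> powr (2 * a)) * ennreal (2 * Gamma a * S)"
    by (simp add: mult_left_mono)
  then have 1: "fint a (\<lambda>s. ennreal ((Gamma a)\<^sup>2 * x s)) t \<le> ennreal (10 / a\<^sup>2 * \<tau> powr (2 * a) * (2 * Gamma a * S))"
    using G S(1) by (subst ennreal_mult) auto
  have "fint a (\<lambda>s. ennreal (x s)) t = (\<integral>\<^sup>+s. ennreal (1 / (Gamma a)\<^sup>2) * (ennreal (pker a (t - s)) * ennreal ((Gamma a)\<^sup>2 * x s)) \<partial>lborel)"
    unfolding fint_def
  proof (intro nn_integral_cong)
    fix s
    have "ennreal (x s) = ennreal (1 / (Gamma a)\<^sup>2) * ennreal ((Gamma a)\<^sup>2 * x s)"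
      using G x0 by (simp add: ennreal_mult[symmetric])
    then show "ennreal (pker a (t - s)) * ennreal (x s) = ennreal (1 / (Gamma a)\<^sup>2) * (ennreal (pker a (t - s)) * ennreal ((Gamma a)\<^sup>2 * x s))"
      by (simp only: mult.left_commute)
  qed
  also have "\<dots> = ennreal (1 / (Gamma a)\<^sup>2) * fint a (\<lambda>s. ennreal ((Gamma a)\<^sup>2 * x s)) t"
    unfolding fint_def by (rule nn_integral_cmult) measurable
  also have "\<dots> \<le> ennreal (1 / (Gamma a)\<^sup>2) * ennreal (10 / a\<^sup>2 * \<tau> powr (2 * a) * (2 * Gamma a * S))"
    by (intro mult_left_mono 1) simp
  also have "\<dots> = ennreal (20 / (a\<^sup>2 * Gamma a) * \<tau> powr (2 * a) * S)"
    using G S(1) a by (simp add: ennreal_mult[symmetric] power2_eq_square mult_ac)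
  finally have 2: "fint a (\<lambda>s. ennreal (x s)) t \<le> ennreal (20 / (a\<^sup>2 * Gamma a) * \<tau> powr (2 * a) * S)" .
  have "fint a (\<lambda>s. ennreal (x s powr \<theta>)) t \<le> ennreal ((1 + max 0 T powr a / a) * (20 / (a\<^sup>2 * Gamma a) * \<tau> powr (2 * a) * S) powr \<theta>)"
    using G S by (intro fint_powr_le[OF a(1) \<theta> _ x0 _ 2 _ t]) (auto simp: x_def)
  moreover have "x s powr \<theta> = indicator {0<..T} s * norm (interp_frac a N tt U s - step_fun N tt U s) powr (2 * \<theta>)" for s
  proof (cases "s \<in> {0<..T}")
    case True
    have "((norm (Uh s - step_fun N tt U s))\<^sup>2) powr \<theta> = norm (Uh s - step_fun N tt U s) powr (2 * \<theta>)"
      by (simp flip: powr_powr)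
    then show ?thesis using True Uh_eq by (simp add: x_def)
  qed (simp add: x_def)
  ultimately show ?thesis using T by (simp add: \<tau>_def max_def)
qed

text \<open>Stability gives L^2 / \<open>Gamma (a + 1)\<close> plus twice the energy drop. Each of
  the two parts is enlarged to the common quantity L^2 + \<Phi>(U 0) - inf \<Phi>, so the
  coefficients add up.\<close>

lemma discrete_derivative_bound:
  fixes f f' :: "real \<Rightarrow> 'h::{real_inner, banach, second_countable_topology}"
  assumes T: "0 < T" and a: "0 < a" "a < 1" and gt: "\<forall>w. \<Phi> w \<noteq> -\<infinity>" and bdd: "\<exists>c::real. \<forall>w. ereal c \<le> \<Phi> w"
    and f' [measurable]: "f' \<in> borel_measurable borel" and f'_int: "integrable lborel f'"
    and L: "\<And>t. t \<le> T \<Longrightarrow> fint a (\<lambda>s. ennreal ((norm (f' s))\<^sup>2)) t \<le> ennreal (L\<^sup>2)"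
    and P: "is_partition T N tt" and U0: "U 0 \<in> eff_dom \<Phi>"
    and F: "\<And>n. n \<in> {1..N} \<Longrightarrow> F n = (1 / (tt n - tt (n - 1))) *\<^sub>R (LINT s:{tt (n - 1)..tt n}|lborel. f' s)"
    and sub: "\<And>n. n \<in> {1..N} \<Longrightarrow> F n - discrete_caputo a N tt U n \<in> subdiff \<Phi> (U n)" and n: "n \<le> N"
  shows "(\<Sum>j=1..n. cker a tt j (tt n) * (norm (discrete_caputo a N tt U j))\<^sup>2)
    \<le> (1 / Gamma (a + 1) + 2) * (L\<^sup>2 + real_of_ereal (\<Phi> (U 0) - energy_inf \<Phi>))"
    and "0 \<le> real_of_ereal (\<Phi> (U 0) - energy_inf \<Phi>)"
proof -
  define \<phi> where "\<phi> i = real_of_ereal (\<Phi> (U i))" for i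
  have G: "0 < Gamma (a + 1)" using a by simp
  have U0': "\<Phi> (U 0) < \<infinity>" using U0 by (simp add: eff_dom_def)
  have \<phi>: "\<Phi> (U i) = ereal (\<phi> i)" if "i \<le> N" for i
  proof -
    have "\<Phi> (U i) < \<infinity>"
      using U0' subdiff_finite[OF gt sub[of i] U0'] that by (cases "i = 0") auto
    then show ?thesis using gt by (cases "\<Phi> (U i)") (auto simp: \<phi>_def)
  qed
  obtain c :: real where c: "\<And>w. ereal c \<le> \<Phi> w" using bdd by blast
  have "ereal c \<le> energy_inf \<Phi>" unfolding energy_inf_def using c by (intro INF_greatest) auto
  moreover have inf_le: "energy_inf \<Phi> \<le> \<Phi> w" for w unfolding energy_inf_def by (intro INF_lower) auto
  ultimately obtain i where i: "energy_inf \<Phi> = ereal i" using \<phi>[of 0] inf_le[of "U 0"] by (cases "energy_inf \<Phi>") auto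
  have gap: "real_of_ereal (\<Phi> (U 0) - energy_inf \<Phi>) = \<phi> 0 - i" using \<phi>[of 0] i by simp
  have i_le: "i \<le> \<phi> k" if "k \<le> N" for k using inf_le[of "U k"] \<phi>[OF that] i by simp
  show nonneg: "0 \<le> real_of_ereal (\<Phi> (U 0) - energy_inf \<Phi>)" using gap i_le[of 0] by simp
  have "(\<Sum>j=1..n. cker a tt j (tt n) * (norm (discrete_caputo a N tt U j))\<^sup>2)
      \<le> (\<Sum>j=1..n. cker a tt j (tt n) * (norm (F j))\<^sup>2) + 2 * (\<phi> 0 - \<phi> n)"
  proof (rule discrete_stability[OF P a(1) less_imp_le[OF a(2)] _ _ n])
    show "U k = U 0 + (\<Sum>j=1..k. cker a tt j (tt k) *\<^sub>R discrete_caputo a N tt U j)" if "k \<le> N" for k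
      by (rule sum_K_matrix_discrete_caputo[OF P a(1) that])
    show "(F k - discrete_caputo a N tt U k) \<bullet> (U j - U k) \<le> \<phi> j - \<phi> k" if "1 \<le> k" "j < k" "k \<le> N" for j k
      using sub[of k] that \<phi>[of j] \<phi>[of k] by (auto simp: subdiff_def dest!: spec[of _ "U j"])
  qed
  also have "(\<Sum>j=1..n. cker a tt j (tt n) * (norm (F j))\<^sup>2) \<le> 1 / Gamma (a + 1) * L\<^sup>2"
  proof -
    have "ennreal (\<Sum>j=1..n. cker a tt j (tt n) * (norm (F j))\<^sup>2) \<le> ennreal (1 / Gamma (a + 1)) * fint a (\<lambda>s. ennreal ((norm (f' s))\<^sup>2)) (tt n)"
      using a by (intro sum_cker_cell_average_le[OF P _ _ f' f'_int n F]) auto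
    also have "\<dots> \<le> ennreal (1 / Gamma (a + 1)) * ennreal (L\<^sup>2)"
      using partition_bounds(2)[OF P n] by (intro mult_left_mono L) auto
    also have "\<dots> = ennreal (1 / Gamma (a + 1) * L\<^sup>2)" using G by (subst ennreal_mult) auto
    finally show ?thesis using G by simp
  qed
  also have "1 / Gamma (a + 1) * L\<^sup>2 + 2 * (\<phi> 0 - \<phi> n) \<le> 1 / Gamma (a + 1) * (L\<^sup>2 + (\<phi> 0 - i)) + 2 * (L\<^sup>2 + (\<phi> 0 - i))"
  proof (intro add_mono mult_left_mono)
    have "0 \<le> L\<^sup>2" by simp
    then show "\<phi> 0 - \<phi> n \<le> L\<^sup>2 + (\<phi> 0 - i)" "L\<^sup>2 \<le> L\<^sup>2 + (\<phi> 0 - i)"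
      using i_le[OF n] i_le[of 0] by linarith+
  qed (use G in auto)
  finally show "(\<Sum>j=1..n. cker a tt j (tt n) * (norm (discrete_caputo a N tt U j))\<^sup>2)
    \<le> (1 / Gamma (a + 1) + 2) * (L\<^sup>2 + real_of_ereal (\<Phi> (U 0) - energy_inf \<Phi>))"
    unfolding gap by (simp add: distrib_right)
qed

theorem theorem5p7:
  fixes \<alpha> T \<beta> C\<^sub>\<beta> q :: real
    and \<Phi> :: "'h::{real_inner, banach, second_countable_topology} \<Rightarrow> ereal"
    and f u :: "real \<Rightarrow> 'h" and u\<^sub>0 :: 'h
  assumes T: "0 < T" and \<alpha>: "0 < \<alpha>" "\<alpha> < 1"
    and \<Phi>_gt: "\<forall>w. \<Phi> w \<noteq> -\<infinity>"
    and \<Phi>_convex: "convex_ereal \<Phi>"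
    and \<Phi>_lsc: "lower_semicont \<Phi>"
    and \<Phi>_proper: "eff_dom \<Phi> \<noteq> {}"
    and \<Phi>_bdd_below: "\<exists>c::real. \<forall>w. ereal c \<le> \<Phi> w"
    and u0: "u\<^sub>0 \<in> eff_dom \<Phi>"
    and f: "f \<in> Lp_alpha_space \<alpha> 2 T"
    and u: "energy_solution \<alpha> T \<Phi> f u\<^sub>0 u"
    and u_cont: "continuous_on {0..T} u"
    and \<beta>: "0 < \<beta>" "\<beta> \<le> 1"
    and C\<beta>: "0 < C\<^sub>\<beta>"
    and q: "1 / \<alpha> < q"
    and f_W: "f \<in> Wsq_space (\<alpha> * (\<beta> + 1) / 2) q T"
  shows "\<exists>C::real. \<forall>N tt (U :: nat \<Rightarrow> 'h).
    is_partition T N tt \<longrightarrow>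
    U 0 \<in> eff_dom \<Phi> \<longrightarrow>
    discrete_solution \<alpha> \<Phi> f N tt U \<longrightarrow>
    (\<forall>w\<^sub>1\<in>interp_frac \<alpha> N tt U ` {0..T}. \<forall>w\<^sub>2\<in>interp_frac \<alpha> N tt U ` {0..T}.
       \<forall>\<xi>\<^sub>1\<in>subdiff \<Phi> w\<^sub>1.
         \<Phi> w\<^sub>2 - \<Phi> w\<^sub>1 - ereal (\<xi>\<^sub>1 \<bullet> (w\<^sub>2 - w\<^sub>1)) \<le> ereal (C\<^sub>\<beta> * norm (w\<^sub>2 - w\<^sub>1) powr (1 + \<beta>))) \<longrightarrow>
    err_total \<alpha> T \<Phi> N tt U u \<le> ennreal (norm (u\<^sub>0 - U 0) +
      C * max_step N tt powr (\<alpha> * (\<beta> + 1) / 2) *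
        (((enn2real (Lp_alpha_norm \<alpha> 2 T f))\<^sup>2
            + real_of_ereal (\<Phi> (U 0) - energy_inf \<Phi>)) powr ((\<beta> + 1) / 4)
         + enn2real (slobodeckij_seminorm (\<alpha> * (\<beta> + 1) / 2) q T f)))"
proof -
  define \<sigma> where "\<sigma> = \<alpha> * (\<beta> + 1) / 2"
  define \<theta> where "\<theta> = (1 + \<beta>) / 2"
  define L where "L = enn2real (Lp_alpha_norm \<alpha> 2 T f)"
  define W where "W = enn2real (slobodeckij_seminorm \<sigma> q T f)"
  have \<sigma>: "0 < \<sigma>" using \<alpha> \<beta> by (simp add: \<sigma>_def)
  have \<theta>: "0 < \<theta>" "\<theta> \<le> 1" "1 + \<beta> = 2 * \<theta>" using \<beta> by (auto simp: \<theta>_def field_simps)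
  have G: "0 < Gamma \<alpha>" "0 < Gamma (\<alpha> + 1)" using \<alpha> by auto
  have f_meas: "f \<in> borel_measurable (lebesgue_on {0..T})" using f by (simp add: Lp_alpha_space_def)
  have f_L2: "f \<in> Lp_space 2 T" by (rule Lp_alpha_space_subset_L2[OF T \<alpha> f])
  obtain f' where f' [measurable]: "f' \<in> borel_measurable borel" and f'0: "\<And>t. t \<notin> {0..T} \<Longrightarrow> f' t = 0"
    and f'_eq: "AE t in lborel. t \<in> {0..T} \<longrightarrow> f' t = f t" using borel_representative[OF f_meas] by metis
  have f'_int: "integrable lborel f'" by (rule L2_representative(2)[OF f_L2 f' f'0 f'_eq])
  have f'_L: "fint \<alpha> (\<lambda>s. ennreal ((norm (f' s))\<^sup>2)) t \<le> ennreal (L\<^sup>2)" if "t \<le> T" for t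
    unfolding L_def by (rule Lp_alpha_space_bound[OF f f' f'0 f'_eq that])
  from u obtain Du where Du: "Du \<in> Lp_space 2 T" and cap: "has_caputo_derivative \<alpha> T u u\<^sub>0 Du"
    and u_L2: "u \<in> Lp_space 2 T" and u_fin: "finite_energy \<Phi> T u"
    and ineq: "\<forall>w\<in>Lp_space 2 T. finite_energy \<Phi> T w \<longrightarrow>
           (LINT t:{0..T}|lebesgue. Du t \<bullet> (u t - w t) + real_of_ereal (\<Phi> (u t)) - real_of_ereal (\<Phi> (w t)))
           \<le> (LINT t:{0..T}|lebesgue. f t \<bullet> (u t - w t))"
    unfolding energy_solution_def by blast
  have Du_meas: "Du \<in> borel_measurable (lebesgue_on {0..T})" using Du by (simp add: Lp_space_def)
  obtain D where D [measurable]: "D \<in> borel_measurable borel" and D0: "\<And>t. t \<notin> {0..T} \<Longrightarrow> D t = 0"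
    and D_eq: "AE t in lborel. t \<in> {0..T} \<longrightarrow> D t = Du t" using borel_representative[OF Du_meas] by metis
  note D2 = L2_representative[OF Du D D0 D_eq]
  have u_rep: "AE t in lborel. t \<in> {0..T} \<longrightarrow> u t = u\<^sub>0 + (1 / Gamma \<alpha>) *\<^sub>R rl \<alpha> D t"
    using D0 by (intro caputo_representation[OF T \<alpha> u_cont cap D2(2) D_eq]) auto
  have u_sub: "AE t in lborel. t \<in> {0..T} \<longrightarrow> \<Phi> (u t) < \<infinity> \<and> f' t - D t \<in> subdiff \<Phi> (u t)"
    using AE_subdiff_of_variational_inequality[OF \<Phi>_gt u_L2 f_L2 Du u_fin ineq] f'_eq D_eq
    by eventually_elim auto
  define e where "e = q / (q - 1) * (\<alpha> - 1) + 1"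
  \<comment> \<open>Both constants are fixed before the partition: \<open>C1\<close> is the square
    root of the \<open>Ax\<close> term with \<tau> and the data factored out, \<open>C2\<close> the
    coefficient of the \<open>Ay\<close> term.\<close>
  define C1 where "C1 = sqrt (2 / Gamma \<alpha> * (C\<^sub>\<beta> * ((1 + T powr \<alpha> / \<alpha>) * (20 / (\<alpha>\<^sup>2 * Gamma \<alpha>) * (1 / Gamma (\<alpha> + 1) + 2)) powr \<theta>)))"
  \<comment> \<open>The absolute value makes nonnegativity immediate without establishing the sign
    of e again.\<close>
  define C2 where "C2 = 2 / Gamma \<alpha> * \<bar>T powr e / e + 1\<bar>"
  have C1: "0 \<le> C1" unfolding C1_def using G \<alpha> C\<beta> by simp
  have C2: "0 \<le> C2" unfolding C2_def using G by simp
  show ?thesis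
  proof (intro exI[of _ "C1 + C2"] allI impI)
    fix N :: nat and tt :: "nat \<Rightarrow> real" and U :: "nat \<Rightarrow> 'h"
    assume P: "is_partition T N tt" and U0: "U 0 \<in> eff_dom \<Phi>" and sol: "discrete_solution \<alpha> \<Phi> f N tt U"
      and up: "\<forall>w\<^sub>1\<in>interp_frac \<alpha> N tt U ` {0..T}. \<forall>w\<^sub>2\<in>interp_frac \<alpha> N tt U ` {0..T}. \<forall>\<xi>\<^sub>1\<in>subdiff \<Phi> w\<^sub>1.
         \<Phi> w\<^sub>2 - \<Phi> w\<^sub>1 - ereal (\<xi>\<^sub>1 \<bullet> (w\<^sub>2 - w\<^sub>1)) \<le> ereal (C\<^sub>\<beta> * norm (w\<^sub>2 - w\<^sub>1) powr (1 + \<beta>))"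
    define F where "F = cell_average tt f"
    define \<tau> where "\<tau> = max_step N tt"
    define Q where "Q = L\<^sup>2 + real_of_ereal (\<Phi> (U 0) - energy_inf \<Phi>)"
    have \<tau>: "0 < \<tau>" unfolding \<tau>_def by (rule max_step_pos[OF P T])
    have F: "F n = (1 / (tt n - tt (n - 1))) *\<^sub>R (LINT s:{tt (n - 1)..tt n}|lborel. f' s)" if "n \<in> {1..N}" for n
      unfolding F_def by (rule cell_average_eq[OF f_meas f' f'_eq P that])
    have sub: "F n - discrete_caputo \<alpha> N tt U n \<in> subdiff \<Phi> (U n)" if "n \<in> {1..N}" for n
      using sol that by (simp add: discrete_solution_def F_def)
    note stab = discrete_derivative_bound[OF T \<alpha> \<Phi>_gt \<Phi>_bdd_below f' f'_int f'_L P U0 F sub, folded Q_def]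
    have Q0: "0 \<le> Q" using stab(2)[of 0] by (simp add: Q_def)
    define S where "S = (1 / Gamma (\<alpha> + 1) + 2) * Q"
    have S0: "0 \<le> S" using Q0 G by (simp add: S_def)
    define Ax where "Ax = (1 + T powr \<alpha> / \<alpha>) * (20 / (\<alpha>\<^sup>2 * Gamma \<alpha>) * \<tau> powr (2 * \<alpha>) * S) powr \<theta>"
    define Ay where "Ay = \<bar>T powr e / e + 1\<bar> * (\<tau> powr \<sigma> * W)"
    have "err_total \<alpha> T \<Phi> N tt U u \<le> ennreal (norm (u\<^sub>0 - U 0) + sqrt (2 / Gamma \<alpha> * (C\<^sub>\<beta> * Ax)) + 2 * (1 / Gamma \<alpha> * Ay))"
    proof (rule error_bound_of_residuals[OF T \<alpha> \<Phi>_gt u_cont D D0 D2(1) f' u_rep u_sub P sub less_imp_le[OF C\<beta>] up])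
      show "0 \<le> Ax" using \<alpha> T by (simp add: Ax_def)
      show "0 \<le> Ay" by (simp add: Ay_def W_def)
      show "fint \<alpha> (\<lambda>s. ennreal (indicator {0<..T} s * norm (interp_frac \<alpha> N tt U s - step_fun N tt U s) powr (1 + \<beta>))) t \<le> ennreal Ax" if "t \<le> T" for t
        unfolding \<theta>(3) Ax_def \<tau>_def
        using stab(1) by (intro fint_interpolation_gap_le[OF T \<alpha> \<theta>(1,2) P S0 _ that]) (simp add: S_def)
      show "fint \<alpha> (\<lambda>s. ennreal (norm (indicator {0<..T} s *\<^sub>R (f' s - step_fun N tt F s)))) t \<le> ennreal Ay" if "t \<le> T" for t
      proof -
        have "fint \<alpha> (\<lambda>s. ennreal (norm (indicator {0<..T} s *\<^sub>R (f' s - step_fun N tt F s)))) t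
          \<le> ennreal ((T powr e / e + 1) * (\<tau> powr \<sigma> * W))"
          unfolding \<tau>_def W_def
          by (rule fint_cell_average_error_le[OF \<alpha> q \<sigma> T f_W[folded \<sigma>_def] f' f'_int f'_eq P F e_def that])
        also have "\<dots> \<le> ennreal Ay" unfolding Ay_def by (intro ennreal_leI mult_right_mono) (auto simp: W_def)
        finally show ?thesis .
      qed
    qed
    also have "\<dots> \<le> ennreal (norm (u\<^sub>0 - U 0) + (C1 + C2) * \<tau> powr \<sigma> * (Q powr ((\<beta> + 1) / 4) + W))"
    proof (intro ennreal_leI)
      have "(20 / (\<alpha>\<^sup>2 * Gamma \<alpha>) * \<tau> powr (2 * \<alpha>) * S) powr \<theta>
          = ((20 / (\<alpha>\<^sup>2 * Gamma \<alpha>) * (1 / Gamma (\<alpha> + 1) + 2)) * (\<tau> powr (2 * \<alpha>) * Q)) powr \<theta>"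
        by (simp only: S_def mult_ac)
      also have "\<dots> = (20 / (\<alpha>\<^sup>2 * Gamma \<alpha>) * (1 / Gamma (\<alpha> + 1) + 2)) powr \<theta> * (\<tau> powr (2 * \<alpha>) * Q) powr \<theta>"
        using G Q0 by (intro powr_mult)
      \<comment> \<open>The exponents match because 2 \<alpha> \<theta> = 2 \<sigma> and \<theta> is
        twice (\<beta> + 1)/4; the perfect square then leaves the root.\<close>
      also have "(\<tau> powr (2 * \<alpha>) * Q) powr \<theta> = (\<tau> powr \<sigma> * Q powr ((\<beta> + 1) / 4))\<^sup>2"
      proof -
        have "(\<tau> powr \<sigma>)\<^sup>2 = \<tau> powr (\<sigma> + \<sigma>)" unfolding powr_add by (rule power2_eq_square)
        also have "\<sigma> + \<sigma> = 2 * \<alpha> * \<theta>" by (simp add: \<sigma>_def \<theta>_def algebra_simps)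
        finally have "(\<tau> powr \<sigma>)\<^sup>2 = \<tau> powr (2 * \<alpha> * \<theta>)" .
        moreover have "(Q powr ((\<beta> + 1) / 4))\<^sup>2 = Q powr \<theta>"
        proof -
          have "(Q powr ((\<beta> + 1) / 4))\<^sup>2 = Q powr ((\<beta> + 1) / 4 + (\<beta> + 1) / 4)" unfolding powr_add by (rule power2_eq_square)
          also have "(\<beta> + 1) / 4 + (\<beta> + 1) / 4 = \<theta>" by (simp add: \<theta>_def)
          finally show ?thesis .
        qed
        ultimately show ?thesis using Q0 by (simp add: power_mult_distrib powr_mult powr_powr)
      qed
      finally have "2 / Gamma \<alpha> * (C\<^sub>\<beta> * Ax) = (2 / Gamma \<alpha> * (C\<^sub>\<beta> * ((1 + T powr \<alpha> / \<alpha>) * (20 / (\<alpha>\<^sup>2 * Gamma \<alpha>) * (1 / Gamma (\<alpha> + 1) + 2)) powr \<theta>))) * (\<tau> powr \<sigma> * Q powr ((\<beta> + 1) / 4))\<^sup>2"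
        unfolding Ax_def by (simp only: mult_ac)
      then have "sqrt (2 / Gamma \<alpha> * (C\<^sub>\<beta> * Ax)) = C1 * (\<tau> powr \<sigma> * Q powr ((\<beta> + 1) / 4))"
        by (simp only: C1_def real_sqrt_mult real_sqrt_abs) simp
      moreover have "2 * (1 / Gamma \<alpha> * Ay) = C2 * (\<tau> powr \<sigma> * W)" by (simp add: Ay_def C2_def)
      \<comment> \<open>These are the cross terms of the product of C1 + C2 with the sum of the two
        data terms; dropping them gives the previous bound.\<close>
      moreover have "0 \<le> C1 * (\<tau> powr \<sigma> * W)" "0 \<le> C2 * (\<tau> powr \<sigma> * Q powr ((\<beta> + 1) / 4))"
        using C1 C2 by (auto simp: W_def)
      ultimately show "norm (u\<^sub>0 - U 0) + sqrt (2 / Gamma \<alpha> * (C\<^sub>\<beta> * Ax)) + 2 * (1 / Gamma \<alpha> * Ay)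
        \<le> norm (u\<^sub>0 - U 0) + (C1 + C2) * \<tau> powr \<sigma> * (Q powr ((\<beta> + 1) / 4) + W)"
        by (simp add: distrib_left distrib_right mult.assoc)
    qed
    finally show "err_total \<alpha> T \<Phi> N tt U u \<le> ennreal (norm (u\<^sub>0 - U 0) +
      (C1 + C2) * max_step N tt powr (\<alpha> * (\<beta> + 1) / 2) *
        (((enn2real (Lp_alpha_norm \<alpha> 2 T f))\<^sup>2 + real_of_ereal (\<Phi> (U 0) - energy_inf \<Phi>)) powr ((\<beta> + 1) / 4)
         + enn2real (slobodeckij_seminorm (\<alpha> * (\<beta> + 1) / 2) q T f)))"
      by (simp only: \<tau>_def \<sigma>_def Q_def L_def W_def)
  qed
qed

end
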